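(* Let $R$ be a reduced irreducible root system of one of the types $B_n$ ($n\ge 3$), $C_n$ ($n\ge 3$), $D_n$ ($n\ge 4$), $E_6,E_7,E_8,F_4$. Let $w\in W$, fix a reduced decomposition of $w$, and let $\lambda(w)$ be the corresponding $\lambda$-sequence. Suppose that $\lambda(w)=\{\ldots,\beta,\ldots,\gamma,\ldots,\alpha\}$ contains three roots with $\alpha+\beta=\gamma$, where $\alpha$ is the first root of the sequence (so $\alpha$ is simple) and $\beta$ appears after $\gamma$. Suppose moreover that $\alpha,\beta,\gamma$ are all long if $R$ is of type $B_n$, all short if $R$ is of type $C_n$, and either all long or all short if $R$ is of type $F_4$. Let $[\beta,\alpha]\subset\lambda(w)$ be the segment between $\beta$ and $\alpha$ (inclusive). (i) Let $R$ be of type $B_n$, $C_n$ or $F_4$. The roots $\beta,\gamma,\alpha$ are non-gatherable inside the segment $[\beta,\alpha]$ if and only if there exists a root subsystem $R^3\subset R$ of type $B_3$ or $C_3$ (put $m=1$ for $B_3$ and $m=2$ for $C_3$) such that $$\beta=\epsilon_1+\epsilon_3,\qquad \alpha=\epsilon_2-\epsilon_3,\qquad \epsilon_1-\epsilon_2\notin[\beta,\alpha],\qquad m\epsilon_3\notin[\beta,\alpha],$$ in the coordinates $\epsilon_1,\epsilon_2,\epsilon_3$ of $R^3$. Equivalently, the sequence $[\beta,\alpha]\cap R^3_+$ (with the natural ordering) must be $$\{\epsilon_1+\epsilon_3,\ m\epsilon_1,\ \epsilon_2+\epsilon_3,\ \gamma=\epsilon_1+\epsilon_2,\ \epsilon_1-\epsilon_3,\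 m\epsilon_2,\ \epsilon_2-\epsilon_3\}$$ up to Coxeter transformations in $R^3$ and changing the order of all the roots in this sequence to the opposite. This sequence is the $\lambda$-sequence $\lambda^3(s_\gamma)$ in $R^3_+$, where $\gamma$ is the maximal root of $R^3$ for $B_3$ and the maximal short root of $R^3$ for $C_3$. (ii) Let $R$ be of type $D_n$ ($n\ge 4$) or $E_6,E_7,E_8$. The triple $\{\beta,\gamma,\alpha\}$ is non-gatherable inside $[\beta,\alpha]$ if and only if there exists a root subsystem $R^4\subset R$ of type $D_4$ such that $$\beta=\epsilon_1+\epsilon_3,\quad \gamma=\epsilon_1+\epsilon_2,\quad \alpha=\epsilon_2-\epsilon_3,\quad \{\epsilon_1-\epsilon_2,\ \epsilon_3-\epsilon_4,\ \epsilon_3+\epsilon_4\}\cap[\beta,\alpha]=\varnothing,$$ in the coordinates $\epsilon_1,\ldots,\epsilon_4$ of $R^4$. Equivalently, the sequence $[\beta,\alpha]\cap R^4_+$ must be $$\{\beta=\epsilon_1+\epsilon_3,\ \epsilon_1-\epsilon_4,\ \epsilon_1+\epsilon_4,\ \epsilon_1-\epsilon_3,\ \gamma=\epsilon_1+\epsilon_2,\ \epsilon_2+\epsilon_3,\ \epsilon_2+\epsilon_4,\ \epsilon_2-\epsilon_4,\ \alpha=\epsilon_2-\epsilon_3\}$$ up to Coxeter transformations in $R^4$. Equivalently, $[\beta,\alpha]\cap R^4_+$ is the $\lambda$-set of $s_{\theta^4}$ in $R^4_+$ for the maximal root $\theta^4$ of $R^4$.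
   Context: $R\subset\mathbb{R}^n$ is a (finite) reduced irreducible root system with simple roots $\alpha_1,\ldots,\alpha_n$, positive roots $R_+$, $R_-=-R_+$, and Weyl group $W$ generated by the simple reflections $s_i=s_{\alpha_i}$. For $w\in W$ the $\lambda$-set is $\lambda(w)=R_+\cap w^{-1}(R_-)=\{\alpha\in R_+ : w(\alpha)\in R_-\}$. A reduced decomposition $w=s_{i_l}\cdots s_{i_2}s_{i_1}$ orders this set as $$\lambda(w)=\{\alpha^l=w^{-1}s_{i_l}(\alpha_{i_l}),\ \ldots,\ \alpha^3=s_{i_1}s_{i_2}(\alpha_{i_3}),\ \alpha^2=s_{i_1}(\alpha_{i_2}),\ \alpha^1=\alpha_{i_1}\};$$ with this ordering it is called the $\lambda$-sequence. Sequences are written from right to left: the rightmost root $\alpha^1$ is the first one. A Coxeter transformation is a substitution $(\cdots s_is_js_i)\mapsto(\cdots s_js_is_j)$ in a reduced decomposition, with $2,3,4$ or $6$ factors when $\alpha_i,\alpha_j$ are connected by $0,1,2$ or $3$ laces in the Dynkin diagram. In the $\lambda$-sequence it reverses the order of the corresponding segment of $2,3,4$ or $6$ consecutive roots, which form the set of positive roots of a rank two root system of type $A_1\times A_1$, $A_2$, $B_2$ or $G_2$ respectively. A triple $\{\beta,\gamma=\alpha+\beta,\alpha\}\subset\lambda(w)$ is called gatherable inside $[\beta,\alpha]$ if its three roots can be made consecutive in the sequence by a series of Coxeter transformations performed only inside the segment $[\beta,\alpha]$ (the positions of the original sequence from that of $\alpha$ to that of $\beta$); otherwise it is non-gatherable.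 For a root subsystem $R^3$ or $R^4$ of $R$, put $R^3_+=R^3\cap R_+$, $R^4_+=R^4\cap R_+$. The coordinates $\epsilon_i$ are the standard orthogonal ones of Bourbaki's tables, chosen so that the positive roots are: $\epsilon_i\pm\epsilon_j$ ($1\le i<j\le3$) and $\epsilon_i$ ($1\le i\le 3$) for $B_3$; $\epsilon_i\pm\epsilon_j$ ($1\le i<j\le 3$) and $2\epsilon_i$ ($1\le i\le 3$) for $C_3$; $\epsilon_i\pm\epsilon_j$ ($1\le i<j\le 4$) for $D_4$. For an element $u$ of the Weyl group of $R^3$, $\lambda^3(u)$ is its $\lambda$-sequence with respect to $R^3_+$; similarly for $\lambda$-sets in $R^4_+$. *)

theory Defs
  imports "HOL-Analysis.Analysis"
begin

definition reflect :: "'a::euclidean_space \<Rightarrow> 'a \<Rightarrow> 'a" where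
  "reflect a x = x - (2 * (x \<bullet> a) / (a \<bullet> a)) *\<^sub>R a"

definition cartan_number :: "'a::euclidean_space \<Rightarrow> 'a \<Rightarrow> real" where
  "cartan_number a b = 2 * (a \<bullet> b) / (b \<bullet> b)"

text \<open>Finite reduced root systems in their own span; that \<open>R\<close> spans the ambient space is a separate
  condition, so that the same notion applies to root subsystems of smaller rank.\<close>

definition root_system :: "'a::euclidean_space set \<Rightarrow> bool" where
  "root_system R \<longleftrightarrow> finite R \<and> 0 \<notin> R \<and>
     (\<forall>a\<in>R. reflect a ` R = R) \<and>
     (\<forall>a\<in>R. \<forall>b\<in>R. cartan_number a b \<in> \<int>) \<and>
     (\<forall>a\<in>R. \<forall>c. c *\<^sub>R a \<in> R \<longrightarrow> c = 1 \<or> c = - 1)"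

definition irreducible_roots :: "'a::euclidean_space set \<Rightarrow> bool" where
  "irreducible_roots R \<longleftrightarrow> R \<noteq> {} \<and>
     \<not> (\<exists>A B. A \<noteq> {} \<and> B \<noteq> {} \<and> A \<inter> B = {} \<and> A \<union> B = R \<and> (\<forall>a\<in>A. \<forall>b\<in>B. a \<bullet> b = 0))"

definition nonneg_comb :: "'a::euclidean_space set \<Rightarrow> 'a set" where
  "nonneg_comb \<Delta> = {x. \<exists>c :: 'a \<Rightarrow> nat. x = (\<Sum>a\<in>\<Delta>. real (c a) *\<^sub>R a)}"

definition pos_roots :: "'a::euclidean_space set \<Rightarrow> 'a set \<Rightarrow> 'a set" where
  "pos_roots R \<Delta> = R \<inter> nonneg_comb \<Delta>"

definition is_base :: "'a::euclidean_space set \<Rightarrow> 'a set \<Rightarrow> bool" where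
  "is_base R \<Delta> \<longleftrightarrow> \<Delta> \<subseteq> R \<and> independent \<Delta> \<and>
     (\<forall>x\<in>R. x \<in> nonneg_comb \<Delta> \<or> - x \<in> nonneg_comb \<Delta>)"

datatype dynkin = TypeB nat | TypeC nat | TypeD nat | TypeE nat | TypeF4

fun rank :: "dynkin \<Rightarrow> nat" where
  "rank (TypeB n) = n"
| "rank (TypeC n) = n"
| "rank (TypeD n) = n"
| "rank (TypeE n) = n"
| "rank TypeF4 = 4"

text \<open>Edges of the Dynkin diagrams and the Cartan matrices in Bourbaki's numbering of the nodes.
  The entry at \<open>(i, j)\<close> is the value of \<open>cartan_number\<close> at the \<open>i\<close>-th and \<open>j\<close>-th simple roots: it is
  \<open>-2\<close> when \<open>i\<close> is the long and \<open>j\<close> the short end of a double edge. In particular the last simple root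
  is short for \<open>B\<close> and long for \<open>C\<close>. Only the ranks 6, 7, 8 are meant for \<open>TypeE\<close>.\<close>

fun dynkin_edges :: "dynkin \<Rightarrow> (nat \<times> nat) set" where
  "dynkin_edges (TypeB n) = {(i, i + 1) |i. 1 \<le> i \<and> i < n}"
| "dynkin_edges (TypeC n) = {(i, i + 1) |i. 1 \<le> i \<and> i < n}"
| "dynkin_edges (TypeD n) = {(i, i + 1) |i. 1 \<le> i \<and> i < n - 1} \<union> {(n - 2, n)}"
| "dynkin_edges (TypeE n) = {(1, 3), (2, 4)} \<union> {(i, i + 1) |i. 3 \<le> i \<and> i < n}"
| "dynkin_edges TypeF4 = {(1, 2), (2, 3), (3, 4)}"

fun double_entries :: "dynkin \<Rightarrow> (nat \<times> nat) set" where
  "double_entries (TypeB n) = {(n - 1, n)}"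
| "double_entries (TypeC n) = {(n, n - 1)}"
| "double_entries (TypeD n) = {}"
| "double_entries (TypeE n) = {}"
| "double_entries TypeF4 = {(2, 3)}"

definition cartan_matrix :: "dynkin \<Rightarrow> nat \<Rightarrow> nat \<Rightarrow> int" where
  "cartan_matrix X i j =
     (if i = j then 2
      else if (i, j) \<in> double_entries X then - 2
      else if (i, j) \<in> dynkin_edges X \<or> (j, i) \<in> dynkin_edges X then - 1
      else 0)"

definition has_type :: "dynkin \<Rightarrow> 'a::euclidean_space set \<Rightarrow> bool" where
  "has_type X \<Delta> \<longleftrightarrow> (\<exists>a :: nat \<Rightarrow> 'a. bij_betw a {1..rank X} \<Delta> \<and>
     (\<forall>i\<in>{1..rank X}. \<forall>j\<in>{1..rank X}. cartan_number (a i) (a j) = of_int (cartan_matrix X i j)))"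

definition long_root :: "'a::euclidean_space set \<Rightarrow> 'a \<Rightarrow> bool" where
  "long_root R x \<longleftrightarrow> x \<in> R \<and> (\<forall>y\<in>R. norm y \<le> norm x)"

definition short_root :: "'a::euclidean_space set \<Rightarrow> 'a \<Rightarrow> bool" where
  "short_root R x \<longleftrightarrow> x \<in> R \<and> (\<forall>y\<in>R. norm x \<le> norm y)"

definition maximal_root :: "'a::euclidean_space set \<Rightarrow> 'a set \<Rightarrow> 'a \<Rightarrow> bool" where
  "maximal_root \<Delta> A \<theta> \<longleftrightarrow> \<theta> \<in> A \<and> (\<forall>x\<in>A. \<theta> - x \<in> nonneg_comb \<Delta>)"

text \<open>A simple reflection is represented by its simple root, and the word
  \<open>s\<^bsub>i\<^sub>l\<^esub> \<dots> s\<^bsub>i\<^sub>2\<^esub> s\<^bsub>i\<^sub>1\<^esub>\<close> by the list of the simple roots number \<open>i\<^sub>1, i\<^sub>2, \<dots>, i\<^sub>l\<close>, in this order. So the head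
  of the list is the rightmost factor, the one that acts first. Since the generators are involutions,
  the products of such words already form a group.\<close>

definition word_map :: "'a::euclidean_space list \<Rightarrow> 'a \<Rightarrow> 'a" where
  "word_map ws = fold reflect ws"

definition weyl_group :: "'a::euclidean_space set \<Rightarrow> ('a \<Rightarrow> 'a) set" where
  "weyl_group \<Delta> = {word_map ws |ws. set ws \<subseteq> \<Delta>}"

definition reduced_decomposition ::
    "'a::euclidean_space set \<Rightarrow> ('a \<Rightarrow> 'a) \<Rightarrow> 'a list \<Rightarrow> bool" where
  "reduced_decomposition \<Delta> w ws \<longleftrightarrow> set ws \<subseteq> \<Delta> \<and> word_map ws = w \<and>
     (\<forall>vs. set vs \<subseteq> \<Delta> \<and> word_map vs = w \<longrightarrow> length ws \<le> length vs)"

definition lambda_set :: "'a::euclidean_space set \<Rightarrow> ('a \<Rightarrow> 'a) \<Rightarrow> 'a set" where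
  "lambda_set P w = {x \<in> P. - w x \<in> P}"

text \<open>The \<open>\<lambda>\<close>-sequence of a word, listed from its first root on: the entry at position \<open>p\<close> (counted
  from 0) is the root \<open>s\<^bsub>i\<^sub>1\<^esub> \<dots> s\<^bsub>i\<^sub>p\<^esub> (\<alpha>\<^bsub>i\<^sub>p\<^sub>+\<^sub>1\<^esub>)\<close>. A sequence displayed with its first root at the right end
  therefore corresponds to the reversed list.\<close>

definition lambda_seq :: "'a::euclidean_space list \<Rightarrow> 'a list" where
  "lambda_seq ws = map (\<lambda>p. word_map (rev (take p ws)) (ws ! p)) [0..<length ws]"

definition segment :: "nat \<Rightarrow> nat \<Rightarrow> 'b list \<Rightarrow> 'b list" where
  "segment p q xs = take (Suc q - p) (drop p xs)"

text \<open>For distinct simple roots the product of the two Cartan numbers is the number of laces.\<close>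

definition braid_length :: "'a::euclidean_space \<Rightarrow> 'a \<Rightarrow> nat" where
  "braid_length a b =
     (let k = cartan_number a b * cartan_number b a
      in if k = 0 then 2 else if k = 1 then 3 else if k = 2 then 4 else 6)"

fun alternating :: "'b \<Rightarrow> 'b \<Rightarrow> nat \<Rightarrow> 'b list" where
  "alternating a b 0 = []"
| "alternating a b (Suc k) = a # alternating b a k"

text \<open>The bounds confine the replaced factors to the positions in \<open>{p..<q}\<close>.\<close>

inductive coxeter_move ::
    "'a::euclidean_space set \<Rightarrow> nat \<Rightarrow> nat \<Rightarrow> 'a list \<Rightarrow> 'a list \<Rightarrow> bool"
  for \<Delta> p q where
  "\<lbrakk>a \<in> \<Delta>; b \<in> \<Delta>; a \<noteq> b; p \<le> length us; length us + braid_length a b \<le> q\<rbrakk> \<Longrightarrow>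
   coxeter_move \<Delta> p q
     (us @ alternating a b (braid_length a b) @ vs)
     (us @ alternating b a (braid_length a b) @ vs)"

definition gatherable_inside ::
    "'a::euclidean_space set \<Rightarrow> 'a list \<Rightarrow> nat \<Rightarrow> nat \<Rightarrow> 'a set \<Rightarrow> bool" where
  "gatherable_inside \<Delta> ws p q T \<longleftrightarrow>
     (\<exists>vs k. (coxeter_move \<Delta> p (Suc q))\<^sup>*\<^sup>* ws vs \<and> k + 2 < length vs \<and>
        set (segment k (k + 2) (lambda_seq vs)) = T)"

definition coxeter_equiv_seq ::
    "'a::euclidean_space set \<Rightarrow> 'a list \<Rightarrow> 'a list \<Rightarrow> bool" where
  "coxeter_equiv_seq \<Gamma> xs ys \<longleftrightarrow>
     (\<exists>us vs. reduced_decomposition \<Gamma> (word_map us) us \<and>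
        (coxeter_move \<Gamma> 0 (length us))\<^sup>*\<^sup>* us vs \<and> lambda_seq us = xs \<and> lambda_seq vs = ys)"

text \<open>The scalar product is only fixed up to a factor, so the standard basis is orthogonal with
  vectors of equal (not necessarily unit) length.\<close>

definition orthogonal_frame :: "nat \<Rightarrow> (nat \<Rightarrow> 'a::euclidean_space) \<Rightarrow> bool" where
  "orthogonal_frame n \<epsilon> \<longleftrightarrow>
     (\<forall>i\<in>{1..n}. \<epsilon> i \<noteq> 0) \<and>
     (\<forall>i\<in>{1..n}. \<forall>j\<in>{1..n}. norm (\<epsilon> i) = norm (\<epsilon> j) \<and> (i \<noteq> j \<longrightarrow> \<epsilon> i \<bullet> \<epsilon> j = 0))"

definition coord_roots_D :: "nat \<Rightarrow> (nat \<Rightarrow> 'a::euclidean_space) \<Rightarrow> 'a set" where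
  "coord_roots_D n \<epsilon> =
     {\<epsilon> i + \<epsilon> j |i j. 1 \<le> i \<and> i < j \<and> j \<le> n} \<union> {\<epsilon> i - \<epsilon> j |i j. 1 \<le> i \<and> i < j \<and> j \<le> n}"

definition coord_roots_B :: "nat \<Rightarrow> (nat \<Rightarrow> 'a::euclidean_space) \<Rightarrow> 'a set" where
  "coord_roots_B n \<epsilon> = coord_roots_D n \<epsilon> \<union> {\<epsilon> i |i. 1 \<le> i \<and> i \<le> n}"

definition coord_roots_C :: "nat \<Rightarrow> (nat \<Rightarrow> 'a::euclidean_space) \<Rightarrow> 'a set" where
  "coord_roots_C n \<epsilon> = coord_roots_D n \<epsilon> \<union> {2 *\<^sub>R \<epsilon> i |i. 1 \<le> i \<and> i \<le> n}"

fun standard_coords :: "dynkin \<Rightarrow> (nat \<Rightarrow> 'a::euclidean_space) \<Rightarrow> 'a set \<Rightarrow> bool" where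
  "standard_coords (TypeB n) \<epsilon> P \<longleftrightarrow> orthogonal_frame n \<epsilon> \<and> P = coord_roots_B n \<epsilon>"
| "standard_coords (TypeC n) \<epsilon> P \<longleftrightarrow> orthogonal_frame n \<epsilon> \<and> P = coord_roots_C n \<epsilon>"
| "standard_coords (TypeD n) \<epsilon> P \<longleftrightarrow> orthogonal_frame n \<epsilon> \<and> P = coord_roots_D n \<epsilon>"
| "standard_coords _ \<epsilon> P \<longleftrightarrow> False"

text \<open>\<open>S\<close> is a root subsystem of type \<open>Y\<close> of the root system \<open>R\<close> with simple roots \<open>\<Delta>\<close>; \<open>\<Gamma>\<close> is the set of
  simple roots of \<open>S\<close> that belongs to the positive roots of \<open>R\<close> in \<open>S\<close>, and \<open>\<epsilon>\<close> are standard
  coordinates of \<open>S\<close> for these positive roots.\<close>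

definition coord_subsystem :: "'a::euclidean_space set \<Rightarrow> 'a set \<Rightarrow> dynkin \<Rightarrow>
    'a set \<Rightarrow> 'a set \<Rightarrow> (nat \<Rightarrow> 'a) \<Rightarrow> bool" where
  "coord_subsystem R \<Delta> Y S \<Gamma> \<epsilon> \<longleftrightarrow>
     S \<subseteq> R \<and> root_system S \<and> is_base S \<Gamma> \<and> has_type Y \<Gamma> \<and>
     pos_roots S \<Gamma> = S \<inter> pos_roots R \<Delta> \<and>
     standard_coords Y \<epsilon> (S \<inter> pos_roots R \<Delta>)"

text \<open>The factor \<open>m\<close> for which \<open>m \<epsilon>\<^sub>i\<close> is a root; used for the types \<open>B\<close> and \<open>C\<close> only.\<close>

fun coord_factor :: "dynkin \<Rightarrow> real" where
  "coord_factor (TypeC n) = 2"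
| "coord_factor _ = 1"

text \<open>The sequences are displayed with the first root at the right end, whence
  \<open>rev\<close>.\<close>

definition seq_BC3 :: "real \<Rightarrow> (nat \<Rightarrow> 'a::euclidean_space) \<Rightarrow> 'a list" where
  "seq_BC3 m \<epsilon> = rev
     [\<epsilon> 1 + \<epsilon> 3, m *\<^sub>R \<epsilon> 1, \<epsilon> 2 + \<epsilon> 3, \<epsilon> 1 + \<epsilon> 2, \<epsilon> 1 - \<epsilon> 3, m *\<^sub>R \<epsilon> 2, \<epsilon> 2 - \<epsilon> 3]"

definition seq_D4 :: "(nat \<Rightarrow> 'a::euclidean_space) \<Rightarrow> 'a list" where
  "seq_D4 \<epsilon> = rev
     [\<epsilon> 1 + \<epsilon> 3, \<epsilon> 1 - \<epsilon> 4, \<epsilon> 1 + \<epsilon> 4, \<epsilon> 1 - \<epsilon> 3, \<epsilon> 1 + \<epsilon> 2,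
      \<epsilon> 2 + \<epsilon> 3, \<epsilon> 2 + \<epsilon> 4, \<epsilon> 2 - \<epsilon> 4, \<epsilon> 2 - \<epsilon> 3]"

end

(* Let N be the set of the roots of the segment and M its complement in the positive roots. By the
   word property the triple can be gathered iff some chamber that lies on the positive side of all
   roots of M has alpha and beta as simultaneous walls, that is iff some point orthogonal to alpha
   and beta is positive on M. Otherwise a sum of roots of M lies in the plane of alpha and beta.
   In a shortest such sum the roots have pairwise nonnegative scalar products, since a negative
   product would allow to replace two roots by their sum; comparing the scalar products of the
   roots with the sum forces two of them, x and y, to be such that beta - alpha - x - y is a root,
   which then belongs to M by minimality. So the triple is non-gatherable iff beta - alpha is a
   sum of three roots of M, in a root system where alpha and beta are long; if they are short,
   this applies to the dual root system. The three roots span, together with alpha, the subsystem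
   of type D4, or of type B3 or C3 if two of them coincide. *)
theory Submission
  imports Defs "HOL-Library.Multiset"
begin

section \<open>Reflections and words\<close>

text \<open>The positions of the outer roots are essential: \<alpha> comes first, so it is a wall of
  the fundamental chamber, and \<beta> comes last, so it is a wall of the chamber reached at the end
  of the segment. Hence there are linear forms \<open>f1\<close> and \<open>f2\<close> that vanish,
  among the roots, only at +-\<alpha> and only at +-\<beta>, and M consists of the roots where both
  are positive. Since \<open>f1\<close> ignores \<alpha> and \<open>f2\<close> ignores \<beta>, a
  root of M may be shifted by -\<alpha> or by \<beta> as long as it stays a root. This leaves three
  kinds of nonzero planar parts, and these are what the scalar products count. Convexity yields only
  real coefficients for a relation, whereas minimality needs a multiset; the integrality of Cartan
  numbers closes this gap. The estimates require that no root is longer than \<alpha> and \<beta>: a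
  root outside their plane then projects to 0 or to a shortest weight of A2. Short triples therefore
  pass to coroots, which are positive multiples of the roots and have the same inversions. With two
  root lengths, irreducibility supplies a root of the other length not orthogonal to \<alpha>, and
  this root folds three orthogonal roots into one long root and a short root taken twice.\<close>

lemma reflect_cartan: "reflect a x = x - cartan_number x a *\<^sub>R a"
  by (simp add: reflect_def cartan_number_def)

lemma linear_reflect: "linear (reflect a)"
  unfolding reflect_def
  by (rule linearI) (auto simp: inner_add_left algebra_simps add_divide_distrib)

lemma reflect_add [simp]: "reflect a (x + y) = reflect a x + reflect a y"
  by (rule linear_add[OF linear_reflect])

lemma reflect_diff [simp]: "reflect a (x - y) = reflect a x - reflect a y"
  by (rule linear_diff[OF linear_reflect])

lemma reflect_minus [simp]: "reflect a (- x) = - reflect a x"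
  by (rule linear_neg[OF linear_reflect])

lemma reflect_scale [simp]: "reflect a (c *\<^sub>R x) = c *\<^sub>R reflect a x"
  by (rule linear_scale[OF linear_reflect])

lemma reflect_self [simp]: "reflect a a = - a"
  by (cases "a = 0") (auto simp: reflect_def algebra_simps scaleR_2)

lemma reflect_reflect [simp]: "reflect a (reflect a x) = x"
  by (subst (2) reflect_cartan) (simp add: reflect_cartan[of a x])

lemma inner_reflect [simp]: "reflect a x \<bullet> reflect a y = x \<bullet> y"
proof (cases "a = 0")
  case False
  then have "a \<bullet> a \<noteq> 0" by simp
  then show ?thesis
    by (simp add: reflect_def inner_diff_left inner_diff_right inner_commute field_simps)
qed (simp add: reflect_def)

lemma reflect_conjugate:
  assumes "linear f" "\<And>x y. f x \<bullet> f y = x \<bullet> y"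
  shows "reflect (f a) (f x) = f (reflect a x)"
  by (simp add: reflect_def assms(2) linear_diff[OF assms(1)] linear_scale[OF assms(1)])

lemma word_map_Nil [simp]: "word_map [] = id"
  by (simp add: word_map_def fun_eq_iff)

lemma word_map_Cons [simp]: "word_map (a # ws) x = word_map ws (reflect a x)"
  by (simp add: word_map_def)

lemma word_map_append [simp]: "word_map (us @ vs) x = word_map vs (word_map us x)"
  by (simp add: word_map_def)

lemma linear_word_map: "linear (word_map ws)"
proof (induction ws)
  case Nil
  then show ?case by (simp add: linear_id[unfolded id_def] id_def)
next
  case (Cons a ws)
  have "word_map (a # ws) = word_map ws \<circ> reflect a" by auto
  then show ?case using linear_compose[OF linear_reflect Cons.IH] by metis
qed

lemmas word_map_linear_simps [simp] =
  linear_add[OF linear_word_map] linear_diff[OF linear_word_map]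
  linear_neg[OF linear_word_map] linear_scale[OF linear_word_map]

lemma inner_word_map [simp]: "word_map ws x \<bullet> word_map ws y = x \<bullet> y"
  by (induction ws arbitrary: x y) auto

lemma word_map_rev1 [simp]: "word_map (rev ws) (word_map ws x) = x"
  by (induction ws arbitrary: x) auto

lemma word_map_rev2 [simp]: "word_map ws (word_map (rev ws) x) = x"
  using word_map_rev1[of "rev ws" x] by simp

lemma word_map_inj [simp]: "word_map ws x = word_map ws y \<longleftrightarrow> x = y"
  by (metis word_map_rev1)

lemma lambda_seq_Nil [simp]: "lambda_seq [] = []"
  by (simp add: lambda_seq_def)

lemma length_lambda_seq [simp]: "length (lambda_seq ws) = length ws"
  by (simp add: lambda_seq_def)

lemma lambda_seq_snoc [simp]: "lambda_seq (us @ [a]) = lambda_seq us @ [word_map (rev us) a]"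
  by (rule nth_equalityI) (auto simp: lambda_seq_def nth_append less_Suc_eq)

lemma lambda_seq_nth: "p < length ws \<Longrightarrow> lambda_seq ws ! p = word_map (rev (take p ws)) (ws ! p)"
  by (simp add: lambda_seq_def)

lemma take_lambda_seq: "take k (lambda_seq ws) = lambda_seq (take k ws)"
  by (rule nth_equalityI) (auto simp: lambda_seq_nth min_absorb1)

text \<open>The roots after the first are those of the shorter word, all conjugated by the first
  reflection. This is the recursion by which explicit sequences are computed.\<close>

lemma lambda_seq_Cons: "lambda_seq (a # ws) = a # map (reflect a) (lambda_seq ws)"
proof (rule nth_equalityI)
  fix i assume "i < length (lambda_seq (a # ws))"
  then show "lambda_seq (a # ws) ! i = (a # map (reflect a) (lambda_seq ws)) ! i"
    by (cases i) (auto simp: lambda_seq_nth)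
qed simp

section \<open>Root systems with a base\<close>

lemma root_systemD:
  assumes "root_system R"
  shows "finite R" "0 \<notin> R"
    "\<And>a b. a \<in> R \<Longrightarrow> b \<in> R \<Longrightarrow> reflect a b \<in> R"
    "\<And>a b. a \<in> R \<Longrightarrow> b \<in> R \<Longrightarrow> cartan_number a b \<in> \<int>"
    "\<And>a c. a \<in> R \<Longrightarrow> c *\<^sub>R a \<in> R \<Longrightarrow> c = 1 \<or> c = - 1"
    "\<And>a. a \<in> R \<Longrightarrow> - a \<in> R"
proof -
  show r: "\<And>a b. a \<in> R \<Longrightarrow> b \<in> R \<Longrightarrow> reflect a b \<in> R"
    using assms unfolding root_system_def by blast
  show "\<And>a. a \<in> R \<Longrightarrow> - a \<in> R" using r by (metis reflect_self)
qed (use assms in \<open>auto simp: root_system_def\<close>)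

text \<open>Strict Cauchy-Schwarz: \<open>t\<close> is the coefficient of the projection of
  \<open>b\<close> to the line of \<open>a\<close>, and equality would make \<open>b\<close> a
  multiple of \<open>a\<close>, which in a reduced system leaves only the two excluded
  cases.\<close>

lemma cartan_product_less:
  assumes R: "root_system R" and ab: "a \<in> R" "b \<in> R" "a \<noteq> b" "a \<noteq> - b"
  shows "cartan_number a b * cartan_number b a < 4"
proof -
  note D = root_systemD[OF R]
  have pos: "0 < a \<bullet> a" "0 < b \<bullet> b" using ab D(2) by (auto simp: inner_gt_zero_iff)
  define t where "t = (a \<bullet> b) / (a \<bullet> a)"
  have "b \<noteq> t *\<^sub>R a"
  proof
    assume b: "b = t *\<^sub>R a"
    then have "t = 1 \<or> t = - 1" using D(5) ab by metis
    then show False using b ab by auto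
  qed
  then have "0 < (b - t *\<^sub>R a) \<bullet> (b - t *\<^sub>R a)" by (simp add: inner_gt_zero_iff)
  also have "\<dots> = b \<bullet> b - 2 * t * (a \<bullet> b) + t * t * (a \<bullet> a)"
    by (simp add: inner_diff_left inner_diff_right inner_commute[of b a] algebra_simps)
  also have "\<dots> = b \<bullet> b - t * (a \<bullet> b)" using pos by (simp add: t_def)
  finally have "t * (a \<bullet> b) < b \<bullet> b" by simp
  then have "4 * (t * (a \<bullet> b)) / (b \<bullet> b) < 4" using pos(2) by (simp only: divide_less_eq if_True)
  moreover have "cartan_number a b * cartan_number b a = 4 * (t * (a \<bullet> b)) / (b \<bullet> b)"
    by (simp add: cartan_number_def t_def inner_commute[of b a])
  ultimately show ?thesis by simp
qed

text \<open>Both Cartan numbers are negative integers with product below 4, so one of them is -1 and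
  the corresponding reflection produces the sum. This is the main source of new roots in the
  arguments about relations.\<close>

lemma root_add:
  assumes R: "root_system R" and ab: "a \<in> R" "b \<in> R" "a \<bullet> b < 0" "a \<noteq> - b"
  shows "a + b \<in> R"
proof -
  note D = root_systemD[OF R]
  have pos: "0 < a \<bullet> a" "0 < b \<bullet> b" using ab D(2) by (auto simp: inner_gt_zero_iff)
  obtain p q :: int where pq: "cartan_number a b = p" "cartan_number b a = q"
    using D(4) ab by (metis Ints_cases)
  have "cartan_number a b < 0" "cartan_number b a < 0"
    using pos ab(3) by (simp_all add: cartan_number_def inner_commute divide_neg_pos mult_pos_neg)
  then have neg: "p < 0" "q < 0" unfolding pq by simp_all
  have "a \<noteq> b" using ab(3) inner_ge_zero[of a] by (metis not_less)
  then have "p * q < 4" using cartan_product_less[OF R ab(1,2) _ ab(4)] unfolding pq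
    by (metis of_int_less_iff of_int_mult of_int_numeral)
  have "p = - 1 \<or> q = - 1"
  proof (rule ccontr)
    assume "\<not> ?thesis"
    then have "2 \<le> - p" "2 \<le> - q" using neg by auto
    then have "2 * 2 \<le> (- p) * (- q)" by (intro mult_mono) auto
    then show False using \<open>p * q < 4\<close> by simp
  qed
  then show ?thesis
  proof
    assume "p = - 1"
    then have "reflect b a = a + b" using pq by (simp add: reflect_cartan)
    then show ?thesis using D(3)[OF ab(2) ab(1)] by simp
  next
    assume "q = - 1"
    then have "reflect a b = a + b" using pq by (simp add: reflect_cartan)
    then show ?thesis using D(3)[OF ab(1) ab(2)] by simp
  qed
qed

lemma nonneg_comb_add: "x \<in> nonneg_comb D \<Longrightarrow> y \<in> nonneg_comb D \<Longrightarrow> x + y \<in> nonneg_comb D"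
  unfolding nonneg_comb_def
proof clarify
  fix c d :: "'a \<Rightarrow> nat"
  show "\<exists>e::'a \<Rightarrow> nat. (\<Sum>a\<in>D. real (c a) *\<^sub>R a) + (\<Sum>a\<in>D. real (d a) *\<^sub>R a) = (\<Sum>a\<in>D. real (e a) *\<^sub>R a)"
    by (rule exI[of _ "\<lambda>a. c a + d a"]) (simp add: sum.distrib scaleR_left_distrib)
qed

lemma nonneg_comb_0: "0 \<in> nonneg_comb D"
  unfolding nonneg_comb_def by (simp, rule exI[of _ "\<lambda>_. 0"]) simp

lemma nonneg_comb_base: "finite D \<Longrightarrow> a \<in> D \<Longrightarrow> a \<in> nonneg_comb D"
  unfolding nonneg_comb_def
  by (simp, rule exI[of _ "\<lambda>b. if b = a then 1 else 0"]) (simp add: if_distrib[of real] if_distrib[of "\<lambda>c. c *\<^sub>R _"] cong: if_cong)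

locale based_roots =
  fixes R \<Delta> :: "'a::euclidean_space set"
  assumes rs: "root_system R" and base: "is_base R \<Delta>"
begin

abbreviation P where "P \<equiv> pos_roots R \<Delta>"

lemmas root_finite = root_systemD(1)[OF rs]
lemmas root_zero = root_systemD(2)[OF rs]
lemmas root_reflect = root_systemD(3)[OF rs]
lemmas root_cartan = root_systemD(4)[OF rs]
lemmas root_multiple = root_systemD(5)[OF rs]
lemmas root_minus = root_systemD(6)[OF rs]

lemma base_sub: "\<Delta> \<subseteq> R" and base_indep: "independent \<Delta>"
  and root_cases: "x \<in> R \<Longrightarrow> x \<in> nonneg_comb \<Delta> \<or> - x \<in> nonneg_comb \<Delta>"
  using base unfolding is_base_def by auto

lemma base_finite: "finite \<Delta>"
  using base_sub root_finite finite_subset by auto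

lemma functional_exists: "\<exists>f :: 'a \<Rightarrow> real. linear f \<and> (\<forall>a\<in>\<Delta>. f a = g a)"
  using linear_independent_extend[OF base_indep] by blast

text \<open>Height and coordinates are linear extensions of prescribed values on the base. They are
  chosen by \<open>SOME\<close> because the base need not span the ambient space when the locale is
  used for a subsystem.\<close>

definition ht :: "'a \<Rightarrow> real" where "ht = (SOME f. linear f \<and> (\<forall>a\<in>\<Delta>. f a = 1))"

definition co :: "'a \<Rightarrow> 'a \<Rightarrow> real" where
  "co a = (SOME f. linear f \<and> (\<forall>b\<in>\<Delta>. f b = (if b = a then 1 else 0)))"

lemma linear_ht: "linear ht" and ht_base: "a \<in> \<Delta> \<Longrightarrow> ht a = 1"
  using someI_ex[OF functional_exists[of "\<lambda>_. 1"]] unfolding ht_def by auto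

lemma linear_co: "linear (co a)" and co_base: "b \<in> \<Delta> \<Longrightarrow> co a b = (if b = a then 1 else 0)"
  using someI_ex[OF functional_exists[of "\<lambda>b. if b = a then 1 else 0"]] unfolding co_def by auto

lemmas ht_simps [simp] = linear_add[OF linear_ht] linear_diff[OF linear_ht]
  linear_neg[OF linear_ht] linear_scale[OF linear_ht]

lemmas co_simps [simp] = linear_add[OF linear_co] linear_diff[OF linear_co]
  linear_neg[OF linear_co] linear_scale[OF linear_co]

lemma nonneg_comb_functional:
  assumes "x \<in> nonneg_comb \<Delta>"
  obtains c :: "'a \<Rightarrow> nat" where "x = (\<Sum>a\<in>\<Delta>. real (c a) *\<^sub>R a)"
    "\<And>f :: 'a \<Rightarrow> real. linear f \<Longrightarrow> f x = (\<Sum>a\<in>\<Delta>. real (c a) * f a)"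
    "\<And>a. a \<in> \<Delta> \<Longrightarrow> co a x = c a"
proof -
  from assms obtain c :: "'a \<Rightarrow> nat" where c: "x = (\<Sum>a\<in>\<Delta>. real (c a) *\<^sub>R a)"
    unfolding nonneg_comb_def by auto
  have f: "f x = (\<Sum>a\<in>\<Delta>. real (c a) * f a)" if "linear f" for f :: "'a \<Rightarrow> real"
    unfolding c by (simp add: linear_sum[OF that] linear_scale[OF that])
  have "co a x = c a" if "a \<in> \<Delta>" for a
    unfolding f[OF linear_co] using that base_finite
    by (simp add: co_base if_distrib[of "\<lambda>t. _ * t"] sum.delta cong: if_cong)
  then show ?thesis using that c f by blast
qed

lemma co_nonneg: "x \<in> nonneg_comb \<Delta> \<Longrightarrow> a \<in> \<Delta> \<Longrightarrow> 0 \<le> co a x"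
  by (erule nonneg_comb_functional) auto

lemma base_expand: "x \<in> R \<Longrightarrow> x = (\<Sum>a\<in>\<Delta>. co a x *\<^sub>R a)"
proof -
  have *: "x = (\<Sum>a\<in>\<Delta>. co a x *\<^sub>R a)" if "x \<in> nonneg_comb \<Delta>" for x
    using that
  proof (rule nonneg_comb_functional)
    fix c :: "'a \<Rightarrow> nat" assume "x = (\<Sum>a\<in>\<Delta>. real (c a) *\<^sub>R a)" "\<And>a. a \<in> \<Delta> \<Longrightarrow> co a x = c a"
    then show ?thesis by (metis (no_types, lifting) sum.cong)
  qed
  assume "x \<in> R"
  then consider "x \<in> nonneg_comb \<Delta>" | "- x \<in> nonneg_comb \<Delta>" using root_cases by blast
  then show ?thesis
  proof cases
    case 2
    from *[OF this] have "- x = - (\<Sum>a\<in>\<Delta>. co a x *\<^sub>R a)" by (simp add: sum_negf)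
    then show ?thesis by simp
  qed (rule *)
qed

lemma linear_expand:
  "x \<in> R \<Longrightarrow> linear f \<Longrightarrow> f x = (\<Sum>a\<in>\<Delta>. co a x * f a)" for f :: "'a \<Rightarrow> real"
  by (subst base_expand) (auto simp: linear_sum linear_scale)

lemma pos_root: "x \<in> P \<Longrightarrow> x \<in> R" and pos_nonneg: "x \<in> P \<Longrightarrow> x \<in> nonneg_comb \<Delta>"
  by (auto simp: pos_roots_def)

lemma pos_finite: "finite P" using root_finite by (simp add: pos_roots_def)

lemma pos_cases: "x \<in> R \<Longrightarrow> x \<in> P \<or> - x \<in> P"
  using root_cases root_minus by (auto simp: pos_roots_def)

lemma base_pos: "a \<in> \<Delta> \<Longrightarrow> a \<in> P"
  using base_sub nonneg_comb_base[OF base_finite] by (auto simp: pos_roots_def)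

lemma ht_pos: assumes "x \<in> P" shows "1 \<le> ht x"
proof -
  obtain c :: "'a \<Rightarrow> nat" where c: "x = (\<Sum>a\<in>\<Delta>. real (c a) *\<^sub>R a)" "ht x = (\<Sum>a\<in>\<Delta>. real (c a) * ht a)"
    using nonneg_comb_functional[OF pos_nonneg[OF assms]] linear_ht by metis
  then have h: "ht x = real (\<Sum>a\<in>\<Delta>. c a)" by (simp add: ht_base)
  have "(\<Sum>a\<in>\<Delta>. c a) \<noteq> 0"
  proof
    assume "(\<Sum>a\<in>\<Delta>. c a) = 0"
    then have "\<forall>a\<in>\<Delta>. c a = 0" using base_finite by simp
    then have "x = 0" using c(1) by simp
    then show False using assms root_zero pos_root by auto
  qed
  then show ?thesis unfolding h by linarith
qed

lemma pos_iff_ht: "x \<in> R \<Longrightarrow> x \<in> P \<longleftrightarrow> 0 < ht x"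
  using ht_pos[of x] ht_pos[of "- x"] pos_cases[of x] by auto

lemma neg_iff: "x \<in> R \<Longrightarrow> - x \<in> P \<longleftrightarrow> x \<notin> P"
  using pos_iff_ht[of x] pos_iff_ht[of "- x"] root_minus[of x] pos_cases[of x] by auto

lemma pos_not_neg: "x \<in> P \<Longrightarrow> - x \<notin> P"
  using neg_iff pos_root by blast

lemma pos_by_co: "x \<in> R \<Longrightarrow> b \<in> \<Delta> \<Longrightarrow> 0 < co b x \<Longrightarrow> x \<in> P"
  using co_nonneg[of "- x" b] pos_nonneg pos_cases[of x] by fastforce

text \<open>Otherwise the root would be a multiple of \<open>a\<close>, hence +-\<open>a\<close> by
  reducedness. The coefficient found here is unchanged by the reflection in \<open>a\<close>, which
  is why that reflection keeps the root positive.\<close>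

lemma pos_other_coefficient:
  assumes "a \<in> \<Delta>" "x \<in> P" "x \<noteq> a"
  shows "\<exists>b\<in>\<Delta>. b \<noteq> a \<and> 0 < co b x"
proof (rule ccontr)
  assume "\<not> ?thesis"
  then have "\<And>b. b \<in> \<Delta> - {a} \<Longrightarrow> co b x = 0"
    using co_nonneg[OF pos_nonneg[OF assms(2)]] by (metis DiffE insertCI order_le_less)
  then have "x = co a x *\<^sub>R a"
    using base_expand[OF pos_root[OF assms(2)]] base_finite assms(1)
    by (simp add: sum.remove)
  moreover from this have "co a x = 1 \<or> co a x = - 1"
    using root_multiple[of a "co a x"] assms base_sub pos_root by auto
  ultimately show False
    using co_nonneg[OF pos_nonneg[OF assms(2)] assms(1)] assms(3) by auto
qed

lemma simple_reflect_pos: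
  assumes "a \<in> \<Delta>" "x \<in> P" "x \<noteq> a"
  shows "reflect a x \<in> P"
proof -
  obtain b where b: "b \<in> \<Delta>" "b \<noteq> a" "0 < co b x" using pos_other_coefficient[OF assms] by blast
  then have "0 < co b (reflect a x)" using assms(1) by (simp add: reflect_cartan co_base)
  then show ?thesis
    using pos_by_co b root_reflect assms base_sub pos_root by blast
qed

text \<open>A positive product would make \<open>a - b\<close> a root, with coordinates of opposite
  signs.\<close>

lemma base_obtuse: "a \<in> \<Delta> \<Longrightarrow> b \<in> \<Delta> \<Longrightarrow> a \<noteq> b \<Longrightarrow> a \<bullet> b \<le> 0"
proof (rule ccontr)
  assume a: "a \<in> \<Delta>" "b \<in> \<Delta>" "a \<noteq> b" "\<not> a \<bullet> b \<le> 0"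
  then have "a + (- b) \<in> R"
    using root_add[OF rs, of a "- b"] base_sub root_minus by force
  moreover have "co a (a + (- b)) = 1" "co b (a + (- b)) = - 1" using a by (auto simp: co_base)
  ultimately show False
    using root_cases[of "a + - b"] co_nonneg[of "a + - b" b] co_nonneg[of "- (a + - b)" a] a
    by auto
qed

text \<open>Descent on the height: a positive root has positive product with some simple root that
  occurs in it, and this reflection lowers the height and keeps the length. So the lengths of all
  roots can be read off from the Dynkin diagram.\<close>

lemma root_norm_simple: "x \<in> R \<Longrightarrow> \<exists>a\<in>\<Delta>. x \<bullet> x = a \<bullet> a"
proof -
  have "\<exists>a\<in>\<Delta>. x \<bullet> x = a \<bullet> a" if "x \<in> P" for x
  proof (rule ccontr)
    assume "\<not> ?thesis"
    define B where "B = {x \<in> P. \<not> (\<exists>a\<in>\<Delta>. x \<bullet> x = a \<bullet> a)}"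
    have B: "finite B" "B \<noteq> {}" using pos_finite that \<open>\<not> _\<close> by (auto simp: B_def)
    then obtain y where y: "y \<in> B" "\<And>z. z \<in> B \<Longrightarrow> ht y \<le> ht z"
      using ex_is_arg_min_if_finite[OF B, of ht] unfolding is_arg_min_def by (metis not_le)
    then have yP: "y \<in> P" "y \<notin> \<Delta>" by (auto simp: B_def)
    have "0 < y \<bullet> y" using yP pos_root root_zero by auto
    also have "y \<bullet> y = (\<Sum>a\<in>\<Delta>. co a y * (a \<bullet> y))"
      using linear_expand[OF pos_root[OF yP(1)], of "\<lambda>z. z \<bullet> y"]
      by (simp add: linear_iff inner_add_left)
    finally obtain a where a: "a \<in> \<Delta>" "0 < co a y * (a \<bullet> y)"
      by (meson not_le sum_nonpos)
    then have "0 < a \<bullet> y" using co_nonneg[OF pos_nonneg[OF yP(1)] a(1)]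
      by (simp add: zero_less_mult_iff)
    moreover have "0 < a \<bullet> a" using a base_sub root_zero by auto
    ultimately have "0 < cartan_number y a" by (simp add: cartan_number_def inner_commute)
    then have "ht (reflect a y) < ht y" by (simp add: reflect_cartan ht_base a)
    moreover have "reflect a y \<in> B"
      using simple_reflect_pos[OF a(1) yP(1)] yP a y(1) by (auto simp: B_def)
    ultimately show False using y(2) by force
  qed
  then show "x \<in> R \<Longrightarrow> ?thesis" using pos_cases by (metis inner_minus_left inner_minus_right minus_minus)
qed

section \<open>Inversion sets and reduced words\<close>

abbreviation inv :: "'a list \<Rightarrow> 'a set" where "inv ws \<equiv> lambda_set P (word_map ws)"

lemma inv_finite: "finite (inv ws)" using pos_finite by (simp add: lambda_set_def)

lemma word_map_root: "set ws \<subseteq> \<Delta> \<Longrightarrow> x \<in> R \<Longrightarrow> word_map ws x \<in> R"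
  by (induction ws arbitrary: x) (use base_sub root_reflect in auto)

lemma word_map_rev_root: "set ws \<subseteq> \<Delta> \<Longrightarrow> x \<in> R \<Longrightarrow> word_map (rev ws) x \<in> R"
  using word_map_root[of "rev ws"] by simp

lemma mem_inv: "set ws \<subseteq> \<Delta> \<Longrightarrow> x \<in> inv ws \<longleftrightarrow> x \<in> P \<and> word_map ws x \<notin> P"
  using neg_iff[OF word_map_root] pos_root by (auto simp: lambda_set_def)

lemma mem_inv_ht: "set ws \<subseteq> \<Delta> \<Longrightarrow> x \<in> P \<Longrightarrow> x \<in> inv ws \<longleftrightarrow> ht (word_map ws x) < 0"
proof -
  assume a: "set ws \<subseteq> \<Delta>" "x \<in> P"
  then have r: "word_map ws x \<in> R" using word_map_root pos_root by blast
  have "ht (word_map ws x) \<noteq> 0"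
    using pos_cases[OF r] ht_pos[of "word_map ws x"] ht_pos[of "- word_map ws x"] by auto
  then show ?thesis using mem_inv[OF a(1), of x] a(2) pos_iff_ht[OF r] by (metis not_less_iff_gr_or_eq)
qed

text \<open>The last letter acts on the images of the roots, where it permutes the positive roots
  other than \<open>a\<close>. So only the root sent to +-\<open>a\<close> changes its
  status.\<close>

lemma inv_snoc:
  assumes us: "set us \<subseteq> \<Delta>" and a: "a \<in> \<Delta>"
  defines "y \<equiv> word_map (rev us) a"
  shows "y \<in> P \<Longrightarrow> inv (us @ [a]) = insert y (inv us) \<and> y \<notin> inv us"
    and "y \<notin> P \<Longrightarrow> inv (us @ [a]) = inv us - {- y} \<and> - y \<in> inv us"
proof -
  have yR: "y \<in> R" unfolding y_def using word_map_rev_root us a base_sub by blast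
  have uy: "word_map us y = a" by (simp add: y_def)
  have us': "set (us @ [a]) \<subseteq> \<Delta>" using us a by simp
  have same: "x \<in> inv (us @ [a]) \<longleftrightarrow> x \<in> inv us" if "x \<in> P" "x \<noteq> y" "x \<noteq> - y" for x
  proof -
    have v: "word_map us x \<in> R" "word_map us x \<noteq> a" "word_map us x \<noteq> - a"
      using that uy word_map_root[OF us pos_root[OF that(1)]]
      by (metis word_map_inj, metis word_map_inj, metis word_map_inj word_map_linear_simps(3))
    have "reflect a (word_map us x) \<in> P \<longleftrightarrow> word_map us x \<in> P"
    proof (cases "word_map us x \<in> P")
      case True
      then show ?thesis using simple_reflect_pos[OF a] v by blast
    next
      case False
      then have "reflect a (- word_map us x) \<in> P"
        using simple_reflect_pos[OF a, of "- word_map us x"] v neg_iff[OF v(1)]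
        by (metis minus_minus)
      then show ?thesis using False pos_not_neg by fastforce
    qed
    then show ?thesis using mem_inv[OF us] mem_inv[OF us'] that(1) by simp
  qed
  have aP: "a \<in> P" "- a \<notin> P" using base_pos[OF a] pos_not_neg by auto
  have sub: "inv vs \<subseteq> P" for vs by (auto simp: lambda_set_def)
  show "inv (us @ [a]) = insert y (inv us) \<and> y \<notin> inv us" if y: "y \<in> P"
  proof -
    have "y \<in> inv (us @ [a])" "y \<notin> inv us" "- y \<notin> P"
      using mem_inv[OF us, of y] mem_inv[OF us', of y] uy aP pos_not_neg y by auto
    then show ?thesis using same sub[of us] sub[of "us @ [a]"] by blast
  qed
  show "inv (us @ [a]) = inv us - {- y} \<and> - y \<in> inv us" if y: "y \<notin> P"
  proof -
    have "- y \<in> P" using neg_iff[OF yR] y by simp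
    moreover from this have "- y \<in> inv us" "- y \<notin> inv (us @ [a])"
      using mem_inv[OF us, of "- y"] mem_inv[OF us', of "- y"] uy aP by auto
    ultimately show ?thesis using same y sub[of us] sub[of "us @ [a]"] by blast
  qed
qed

text \<open>Reducedness is encoded by the size of the inversion set, which changes by one with every
  letter. That this is minimality of the length is \<open>reduced_iff_red\<close>, by way of the
  deletion property.\<close>

definition red :: "'a list \<Rightarrow> bool" where
  "red ws \<longleftrightarrow> set ws \<subseteq> \<Delta> \<and> card (inv ws) = length ws"

lemma inv_id [simp]: "lambda_set P id = {}"
  using pos_not_neg by (auto simp: lambda_set_def)

lemma red_Nil [simp]: "red []" by (simp add: red_def)

lemma red_set: "red ws \<Longrightarrow> set ws \<subseteq> \<Delta>" by (simp add: red_def)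

lemma card_inv_snoc:
  assumes "set us \<subseteq> \<Delta>" "a \<in> \<Delta>"
  shows "card (inv (us @ [a])) =
    (if word_map (rev us) a \<in> P then Suc (card (inv us)) else card (inv us) - 1)"
  using inv_snoc[OF assms] inv_finite by auto

lemma card_inv_le: "set ws \<subseteq> \<Delta> \<Longrightarrow> card (inv ws) \<le> length ws"
  by (induction ws rule: rev_induct) (auto simp: card_inv_snoc)

lemma red_snoc: "red (us @ [a]) \<longleftrightarrow> red us \<and> a \<in> \<Delta> \<and> word_map (rev us) a \<in> P"
proof -
  have "card (inv us) - 1 \<noteq> Suc (length us)" if "set us \<subseteq> \<Delta>"
    using card_inv_le[OF that] by simp
  then show ?thesis
    by (auto simp: red_def card_inv_snoc split: if_splits)
qed

lemma red_append1: "red (us @ vs) \<Longrightarrow> red us"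
proof (induction vs rule: rev_induct)
  case (snoc b vs)
  then show ?case using red_snoc[of "us @ vs" b] by simp
qed simp

lemma red_take: "red ws \<Longrightarrow> red (take k ws)"
  using red_append1[of "take k ws" "drop k ws"] by simp

lemma red_lambda: "red ws \<Longrightarrow> set (lambda_seq ws) = inv ws"
  by (induction ws rule: rev_induct) (auto simp: red_snoc inv_snoc red_set)

lemma red_distinct: "red ws \<Longrightarrow> distinct (lambda_seq ws)"
  by (rule card_distinct) (simp add: red_lambda, simp add: red_def)

text \<open>A word whose sequence contains only positive roots never loses an inversion. This
  certifies the explicit words for B3, C3 and D4.\<close>

lemma redI:
  assumes "set ws \<subseteq> \<Delta>" "set (lambda_seq ws) \<subseteq> P"
  shows "red ws"
  using assms by (induction ws rule: rev_induct) (auto simp: red_snoc)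

lemma deletion:
  assumes ws: "set ws \<subseteq> \<Delta>" and "\<not> red ws"
  shows "\<exists>vs. set vs \<subseteq> \<Delta> \<and> word_map vs = word_map ws \<and> length vs < length ws"
  using assms
proof (induction ws rule: rev_induct)
  case (snoc a us)
  show ?case
  proof (cases "red us")
    case False
    with snoc obtain vs where vs: "set vs \<subseteq> \<Delta>" "word_map vs = word_map us" "length vs < length us"
      by auto
    then have "word_map (vs @ [a]) = word_map (us @ [a])" by (simp add: fun_eq_iff)
    then show ?thesis using vs snoc.prems by (intro exI[of _ "vs @ [a]"]) simp
  next
    case True
    define y where "y = word_map (rev us) a"
    have us: "set us \<subseteq> \<Delta>" "a \<in> \<Delta>" using snoc.prems by auto
    have "y \<notin> P" using snoc.prems True us by (simp add: red_snoc y_def)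
    then have "- y \<in> inv us" using inv_snoc(2)[OF us] by (simp add: y_def)
    then have "- y \<in> set (lambda_seq us)" using red_lambda[OF True] by simp
    then obtain p where p: "p < length us" "lambda_seq us ! p = - y"
      by (metis in_set_conv_nth length_lambda_seq)
    define u1 b u2 where "u1 = take p us" and "b = us ! p" and "u2 = drop (Suc p) us"
    have dec: "us = u1 @ [b] @ u2" using p by (simp add: u1_def u2_def b_def id_take_nth_drop)
    have "word_map (rev u1) b = - y" using p by (simp add: lambda_seq_nth u1_def b_def)
    then have "word_map u1 (- y) = b" by (metis word_map_rev2)
    then have "word_map u2 (reflect b (word_map u1 (- y))) = - word_map u2 b" by (simp only: reflect_self word_map_linear_simps)
    moreover have "word_map us (- y) = word_map u2 (reflect b (word_map u1 (- y)))" unfolding dec by simp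
    moreover have "word_map us (- y) = - a" by (simp add: y_def)
    ultimately have "a = word_map u2 b" by simp
    then have "reflect a (word_map u2 (reflect b x)) = word_map u2 x" for x
      using reflect_conjugate[OF linear_word_map, of u2 b "reflect b x"] by simp
    then have "word_map (u1 @ u2) = word_map (us @ [a])" unfolding dec by (simp add: fun_eq_iff)
    then show ?thesis using us by (intro exI[of _ "u1 @ u2"]) (auto simp: dec)
  qed
qed simp

lemma reduced_iff_red: "reduced_decomposition \<Delta> w ws \<longleftrightarrow> red ws \<and> word_map ws = w"
proof
  assume r: "reduced_decomposition \<Delta> w ws"
  then show "red ws \<and> word_map ws = w"
    using deletion[of ws] unfolding reduced_decomposition_def by (metis not_le)
next
  assume r: "red ws \<and> word_map ws = w"
  then have "length ws = card (lambda_set P w)" by (auto simp: red_def)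
  then show "reduced_decomposition \<Delta> w ws"
    using r card_inv_le red_set unfolding reduced_decomposition_def by metis
qed

section \<open>Elements determined by their inversion sets, and the weak order\<close>

lemma reduced_word_exists:
  assumes "set ws \<subseteq> \<Delta>" shows "\<exists>vs. red vs \<and> word_map vs = word_map ws"
  using assms
proof (induction "length ws" arbitrary: ws rule: less_induct)
  case less
  then show ?case using deletion[of ws] by metis
qed

lemma inv_empty:
  assumes "set ws \<subseteq> \<Delta>" "inv ws = {}" shows "word_map ws = id"
proof -
  obtain vs where vs: "red vs" "word_map vs = word_map ws" using reduced_word_exists assms by blast
  then have "vs = []" using assms by (simp add: red_def)
  then show ?thesis using vs by simp
qed

text \<open>The word \<open>rev us @ vs\<close> represents the quotient of the two elements. A root
  inverted by it comes, up to sign, from a root inverted by exactly one of them, so it has no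
  inversions.\<close>

lemma inv_inject:
  assumes us: "set us \<subseteq> \<Delta>" and vs: "set vs \<subseteq> \<Delta>" and eq: "inv us = inv vs"
  shows "word_map us = word_map vs"
proof -
  have s: "set (rev us @ vs) \<subseteq> \<Delta>" using us vs by simp
  have "inv (rev us @ vs) = {}"
  proof (rule ccontr)
    assume "\<not> ?thesis"
    then obtain x where x: "x \<in> P" "word_map (rev us @ vs) x \<notin> P" using mem_inv[OF s] by blast
    define y where "y = word_map (rev us) x"
    have y: "y \<in> R" "word_map us y = x" "word_map vs y \<notin> P"
      using word_map_rev_root[OF us pos_root[OF x(1)]] x by (auto simp: y_def)
    show False
    proof (cases "y \<in> P")
      case True
      then show False using eq mem_inv[OF us, of y] mem_inv[OF vs, of y] y x by auto
    next
      case False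
      then have "- y \<in> P" using neg_iff[OF y(1)] by simp
      moreover have "word_map us (- y) \<notin> P" using y x pos_not_neg by simp
      ultimately have "word_map vs (- y) \<notin> P" using eq mem_inv[OF us, of "- y"] mem_inv[OF vs, of "- y"] by auto
      then show False using y(3) neg_iff[OF word_map_root[OF vs y(1)]] by simp
    qed
  qed
  then have "word_map (rev us @ vs) = id" using inv_empty[OF s] by blast
  then have "word_map vs (word_map (rev us) (word_map us x)) = word_map us x" for x
    by (metis eq_id_iff word_map_append)
  then show ?thesis by (auto simp: fun_eq_iff)
qed

text \<open>A gallery from the chamber of \<open>us\<close> to the chamber of \<open>f\<close>: as
  long as \<open>f\<close> is negative on a wall root of the current chamber, this wall is crossed,
  and each crossing adds a root on which \<open>f\<close> is negative. When no such wall is left,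
  \<open>f\<close> is nonnegative on all roots that are positive for the current chamber, and the
  target set is exhausted.\<close>

lemma red_extend:
  fixes f :: "'a \<Rightarrow> real"
  assumes f: "linear f" "\<And>x. x \<in> R \<Longrightarrow> f x \<noteq> 0"
    and us: "red us" "inv us \<subseteq> {x \<in> P. f x < 0}"
  shows "\<exists>ws. red (us @ ws) \<and> inv (us @ ws) = {x \<in> P. f x < 0}"
  using us
proof (induction "card ({x \<in> P. f x < 0} - inv us)" arbitrary: us rule: less_induct)
  case less
  define T where "T = {x \<in> P. f x < 0}"
  have finT: "finite T" using pos_finite by (simp add: T_def)
  note us = red_set[OF less.prems(1)]
  have rr: "word_map (rev us) x \<in> R" if "x \<in> R" for x using word_map_rev_root[OF us that] .
  show ?case
  proof (cases "\<exists>a\<in>\<Delta>. f (word_map (rev us) a) < 0")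
    case True
    then obtain a where a: "a \<in> \<Delta>" "f (word_map (rev us) a) < 0" by blast
    define y where "y = word_map (rev us) a"
    have yR: "y \<in> R" using rr a base_sub by (auto simp: y_def)
    \<comment> \<open>A letter that removes an inversion would remove \<open>- y\<close>, where
      \<open>f\<close> is positive, although \<open>f\<close> is negative on all inversions of
      \<open>us\<close>.\<close>
    have yP: "y \<in> P"
    proof (rule ccontr)
      assume "y \<notin> P"
      then have "- y \<in> T" using inv_snoc(2)[OF us a(1)] less.prems by (auto simp: y_def T_def)
      then show False using a linear_neg[OF f(1)] by (simp add: T_def y_def)
    qed
    then have *: "inv (us @ [a]) = insert y (inv us)" "y \<notin> inv us"
      using inv_snoc(1)[OF us a(1)] by (auto simp: y_def)
    have yT: "y \<in> T" using yP a by (simp add: T_def y_def)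
    have "card (T - inv (us @ [a])) < card (T - inv us)"
      using finT * yT by (intro psubset_card_mono) auto
    moreover have "red (us @ [a])" using less.prems(1) a yP by (simp add: red_snoc y_def)
    moreover have "inv (us @ [a]) \<subseteq> T" using * yT less.prems(2) by (simp add: T_def)
    ultimately obtain ws where "red ((us @ [a]) @ ws)" "inv ((us @ [a]) @ ws) = T"
      using less.hyps[of "us @ [a]"] unfolding T_def by blast
    then show ?thesis by (intro exI[of _ "a # ws"]) (simp add: T_def)
  next
    case False
    have "T \<subseteq> inv us"
    proof
      fix x assume x: "x \<in> T"
      then have xP: "x \<in> P" "f x < 0" by (auto simp: T_def)
      show "x \<in> inv us"
      proof (rule ccontr)
        assume "x \<notin> inv us"
        then have "word_map us x \<in> P" using mem_inv[OF us] xP by blast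
        have lin: "linear (\<lambda>z. f (word_map (rev us) z))"
          using linear_compose[OF linear_word_map f(1)] by (simp add: o_def)
        have "f x = (\<Sum>a\<in>\<Delta>. co a (word_map us x) * f (word_map (rev us) a))"
          using linear_expand[OF pos_root[OF \<open>word_map us x \<in> P\<close>] lin] by simp
        also have "0 \<le> \<dots>"
          using False co_nonneg[OF pos_nonneg[OF \<open>word_map us x \<in> P\<close>]]
          by (intro sum_nonneg mult_nonneg_nonneg) (auto simp: not_less)
        finally show False using xP by simp
      qed
    qed
    then show ?thesis using less.prems by (intro exI[of _ "[]"]) (auto simp: T_def)
  qed
qed

text \<open>The height after \<open>ts\<close> is a linear form whose negative positive roots are
  exactly the inversions of \<open>ts\<close>. Hence containment of inversion sets makes
  \<open>us\<close> a prefix of a reduced word for the larger element.\<close>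

lemma red_extend_word:
  assumes "red us" "set ts \<subseteq> \<Delta>" "inv us \<subseteq> inv ts"
  shows "\<exists>ws. red (us @ ws) \<and> word_map (us @ ws) = word_map ts"
proof -
  define f where "f x = ht (word_map ts x)" for x
  have f: "linear f" unfolding f_def using linear_compose[OF linear_word_map linear_ht] by (simp add: o_def)
  have nz: "f x \<noteq> 0" if "x \<in> R" for x
  proof -
    have r: "word_map ts x \<in> R" using word_map_root assms that by blast
    show ?thesis unfolding f_def
      using pos_cases[OF r] ht_pos[of "word_map ts x"] ht_pos[of "- word_map ts x"] by auto
  qed
  have inv: "inv ts = {x \<in> P. f x < 0}"
    using mem_inv_ht[OF assms(2)] by (auto simp: f_def lambda_set_def)
  obtain ws where "red (us @ ws)" "inv (us @ ws) = inv ts"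
    using red_extend[OF f nz assms(1)] assms(3) inv by auto
  then show ?thesis using inv_inject[OF red_set assms(2)] by blast
qed

lemma red_same_map: "red us \<Longrightarrow> set vs \<subseteq> \<Delta> \<Longrightarrow> word_map vs = word_map us \<Longrightarrow> length vs = length us \<Longrightarrow> red vs"
  by (simp add: red_def)

lemma red_length: "red us \<Longrightarrow> red vs \<Longrightarrow> word_map us = word_map vs \<Longrightarrow> length us = length vs"
  unfolding red_def by metis

lemma red_Cons: assumes "red (a # us)" shows "red us"
proof (rule ccontr)
  assume "\<not> red us"
  then obtain vs where vs: "set vs \<subseteq> \<Delta>" "word_map vs = word_map us" "length vs < length us"
    using deletion[of us] red_set[OF assms] by auto
  have "word_map (a # vs) = word_map (a # us)" using vs by (simp add: fun_eq_iff)
  then have "card (inv (a # us)) \<le> length (a # vs)"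
    using card_inv_le[of "a # vs"] vs red_set[OF assms] by simp
  then show False using assms vs by (simp add: red_def)
qed

lemma hd_in_inv: "red (a # us) \<Longrightarrow> a \<in> inv (a # us)"
  by (simp add: red_lambda[symmetric] lambda_seq_Cons)

end

section \<open>Coxeter moves and the word property\<close>

lemma set_alternating: "set (alternating a b k) \<subseteq> {a, b}"
  by (induction k arbitrary: a b) auto

lemma length_alternating [simp]: "length (alternating a b k) = k"
  by (induction k arbitrary: a b) auto

lemma braid_length_pos: "\<exists>k. braid_length a b = Suc k"
  by (simp add: braid_length_def Let_def)

text \<open>The rank two systems, computed in the coordinates of \<open>a\<close> and
  \<open>b\<close>. Here \<open>k\<close> and \<open>l\<close> are the negatives of the Cartan
  numbers, and \<open>m\<close> is the order of the product of the two reflections.\<close>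

lemma lambda_alternating:
  fixes a b :: "'a::euclidean_space"
  assumes a: "reflect a b = b + k *\<^sub>R a" and b: "reflect b a = a + l *\<^sub>R b"
    and kl: "(k, l, m) \<in> {(0,0,2), (1,1,3), (1,2,4), (2,1,4), (1,3,6), (3,1,6)}"
  shows "set (lambda_seq (alternating a b m)) = set (lambda_seq (alternating b a m))"
    and "set (lambda_seq (alternating a b m)) \<subseteq> {p *\<^sub>R a + q *\<^sub>R b |p q. 0 \<le> p \<and> 0 \<le> q \<and> 0 < p + q}"
proof -
  define c where "c p q = p *\<^sub>R a + q *\<^sub>R b" for p q :: real
  have ra: "reflect (c 1 0) (c p q) = c (k * q - p) q" and rb: "reflect (c 0 1) (c p q) = c p (l * p - q)" for p q
    using a b by (simp_all add: c_def algebra_simps)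
  have ab: "a = c 1 0" "b = c 0 1" by (simp_all add: c_def)
  define C where "C = {c p q |p q. 0 \<le> p \<and> 0 \<le> q \<and> 0 < p + q}"
  have C: "c p q \<in> C" if "0 \<le> p" "0 \<le> q" "0 < p + q" for p q using that by (auto simp: C_def)
  have "set (lambda_seq (alternating (c 1 0) (c 0 1) m)) = set (lambda_seq (alternating (c 0 1) (c 1 0) m))
    \<and> set (lambda_seq (alternating (c 1 0) (c 0 1) m)) \<subseteq> C"
    using kl
    by (elim insertE emptyE; simp add: eval_nat_numeral lambda_seq_Cons ra rb C insert_commute)
  then show "set (lambda_seq (alternating a b m)) = set (lambda_seq (alternating b a m))"
    and "set (lambda_seq (alternating a b m)) \<subseteq> {p *\<^sub>R a + q *\<^sub>R b |p q. 0 \<le> p \<and> 0 \<le> q \<and> 0 < p + q}"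
    unfolding ab(1)[symmetric] ab(2)[symmetric] unfolding C_def c_def by auto
qed

lemma coxeter_move_append: "coxeter_move D 0 n us vs \<Longrightarrow> coxeter_move D 0 n (us @ ws) (vs @ ws)"
proof (induction rule: coxeter_move.induct)
  case (1 a b us vs)
  then show ?case using coxeter_move.intros[of a D b 0 us n "vs @ ws"] by simp
qed

lemma coxeter_move_Cons: "coxeter_move D 0 n us vs \<Longrightarrow> coxeter_move D 0 (Suc n) (c # us) (c # vs)"
proof (induction rule: coxeter_move.induct)
  case (1 a b us vs)
  then show ?case using coxeter_move.intros[of a D b 0 "c # us" "Suc n" vs] by simp
qed

lemma coxeter_moves_append:
  "(coxeter_move D 0 n)\<^sup>*\<^sup>* us vs \<Longrightarrow> (coxeter_move D 0 n)\<^sup>*\<^sup>* (us @ ws) (vs @ ws)"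
  by (induction rule: rtranclp_induct) (auto intro: rtranclp.rtrancl_into_rtrancl coxeter_move_append)

lemma coxeter_moves_Cons:
  "(coxeter_move D 0 n)\<^sup>*\<^sup>* us vs \<Longrightarrow> (coxeter_move D 0 (Suc n))\<^sup>*\<^sup>* (c # us) (c # vs)"
  by (induction rule: rtranclp_induct) (auto intro: rtranclp.rtrancl_into_rtrancl coxeter_move_Cons)

context based_roots
begin

lemma base_cartan:
  assumes "a \<in> \<Delta>" "b \<in> \<Delta>" "a \<noteq> b"
  obtains k l where "reflect a b = b + k *\<^sub>R a" "reflect b a = a + l *\<^sub>R b"
    "(k, l, braid_length a b) \<in> {(0,0,2), (1,1,3), (1,2,4), (2,1,4), (1,3,6), (3,1,6)}"
proof -
  have R: "a \<in> R" "b \<in> R" using assms base_sub by auto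
  then have nz: "0 < a \<bullet> a" "0 < b \<bullet> b" using root_zero by auto
  have ab: "a \<bullet> b \<le> 0" using base_obtuse assms by blast
  have nn: "a \<noteq> - b" using base_pos assms pos_not_neg by (metis minus_minus)
  obtain p q :: int where pq: "cartan_number a b = p" "cartan_number b a = q"
    using root_cartan R by (metis Ints_cases)
  have le: "p \<le> 0" "q \<le> 0"
  proof -
    have "cartan_number a b \<le> 0" "cartan_number b a \<le> 0"
      using nz ab by (simp_all add: cartan_number_def inner_commute divide_nonpos_pos)
    then show "p \<le> 0" "q \<le> 0" unfolding pq by simp_all
  qed
  have z: "p = 0 \<longleftrightarrow> q = 0"
  proof -
    have "cartan_number a b = 0 \<longleftrightarrow> cartan_number b a = 0"
      using nz by (auto simp: cartan_number_def inner_commute)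
    then show ?thesis by (simp add: pq)
  qed
  have "p * q < 4" using cartan_product_less[OF rs R assms(3) nn] unfolding pq
    by (metis of_int_less_iff of_int_mult of_int_numeral)
  have "(p, q) \<in> {(0,0), (-1,-1), (-1,-2), (-2,-1), (-1,-3), (-3,-1)}"
  proof (cases "p = 0")
    case False
    then have n: "p \<le> -1" "q \<le> -1" using le z by auto
    have "(- p) * 1 \<le> (- p) * (- q)" "1 * (- q) \<le> (- p) * (- q)"
      using n by (intro mult_left_mono mult_right_mono; simp)+
    then have "p \<in> {-3, -2, -1}" "q \<in> {-3, -2, -1}" using \<open>p * q < 4\<close> n by auto
    then show ?thesis using \<open>p * q < 4\<close> by auto
  qed (use z in auto)
  moreover have "reflect a b = b + (- real_of_int q) *\<^sub>R a" "reflect b a = a + (- real_of_int p) *\<^sub>R b"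
    using pq by (simp_all add: reflect_cartan)
  moreover have "braid_length a b = (if p * q = 0 then 2 else if p * q = 1 then 3 else if p * q = 2 then 4 else 6)"
  proof -
    have "cartan_number a b * cartan_number b a = real_of_int (p * q)" by (simp add: pq)
    then show ?thesis unfolding braid_length_def Let_def
      by (simp only: of_int_eq_0_iff of_int_eq_1_iff of_int_eq_numeral_iff)
  qed
  ultimately show ?thesis using that[of "- real_of_int q" "- real_of_int p"] by (auto split: if_splits)
qed

lemma lambda_seq_root: "set ws \<subseteq> \<Delta> \<Longrightarrow> set (lambda_seq ws) \<subseteq> R"
  by (induction ws) (use base_sub root_reflect in \<open>auto simp: lambda_seq_Cons\<close>)

text \<open>Both alternating words are reduced words of the longest element of the rank two
  subgroup. Their inversions are nonnegative combinations of \<open>a\<close> and \<open>b\<close>,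
  so an element that inverts \<open>a\<close> and \<open>b\<close> inverts all of them.\<close>

lemma alternating_red:
  assumes "a \<in> \<Delta>" "b \<in> \<Delta>" "a \<noteq> b"
  defines "m \<equiv> braid_length a b"
  shows "red (alternating a b m)" "word_map (alternating a b m) = word_map (alternating b a m)"
    "inv (alternating a b m) \<subseteq> {p *\<^sub>R a + q *\<^sub>R b |p q. 0 \<le> p \<and> 0 \<le> q \<and> 0 < p + q}"
proof -
  obtain k l where kl: "reflect a b = b + k *\<^sub>R a" "reflect b a = a + l *\<^sub>R b"
    "(k, l, m) \<in> {(0,0,2), (1,1,3), (1,2,4), (2,1,4), (1,3,6), (3,1,6)}"
    using base_cartan[OF assms(1-3)] unfolding m_def by metis
  note L = lambda_alternating[OF kl]
  have s: "set (alternating a b m) \<subseteq> \<Delta>" "set (alternating b a m) \<subseteq> \<Delta>"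
    using set_alternating[of a b m] set_alternating[of b a m] assms by auto
  have pos: "set (lambda_seq (alternating a b m)) \<subseteq> P"
  proof
    fix x assume x: "x \<in> set (lambda_seq (alternating a b m))"
    then have xR: "x \<in> R" using lambda_seq_root[OF s(1)] by blast
    from x L(2) obtain p q where pq: "x = p *\<^sub>R a + q *\<^sub>R b" "0 \<le> p" "0 \<le> q" "0 < p + q" by blast
    then have "co a x = p" "co b x = q" using assms by (auto simp: co_base)
    then show "x \<in> P" using pos_by_co[OF xR assms(1)] pos_by_co[OF xR assms(2)] pq by linarith
  qed
  show red: "red (alternating a b m)" by (rule redI[OF s(1) pos])
  have red': "red (alternating b a m)" using pos L(1) by (intro redI[OF s(2)]) simp
  show "word_map (alternating a b m) = word_map (alternating b a m)"
    using L(1) red_lambda red red' by (intro inv_inject s) simp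
  show "inv (alternating a b m) \<subseteq> {p *\<^sub>R a + q *\<^sub>R b |p q. 0 \<le> p \<and> 0 \<le> q \<and> 0 < p + q}"
    using L(2) red_lambda[OF red] by simp
qed

text \<open>Moves confined to the first \<open>n\<close> positions also keep the element represented
  by that prefix. This is how the set of roots in the segment is known to be the same before and
  after the moves.\<close>

lemma coxeter_move_invariants:
  assumes "coxeter_move \<Delta> 0 n us vs" "set us \<subseteq> \<Delta>"
  shows "set vs \<subseteq> \<Delta>" "length vs = length us" "word_map vs = word_map us"
    "drop n vs = drop n us" "word_map (take n vs) = word_map (take n us)"
proof -
  from assms(1) obtain a b ps qs where m: "a \<in> \<Delta>" "b \<in> \<Delta>" "a \<noteq> b"
    "length ps + braid_length a b \<le> n"
    "us = ps @ alternating a b (braid_length a b) @ qs" "vs = ps @ alternating b a (braid_length a b) @ qs"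
    by (auto elim: coxeter_move.cases)
  have w: "word_map (alternating a b (braid_length a b)) = word_map (alternating b a (braid_length a b))"
    using alternating_red(2)[OF m(1-3)] .
  show "set vs \<subseteq> \<Delta>" using assms(2) set_alternating[of b a "braid_length a b"] m by auto
  show "length vs = length us" using m by simp
  show "word_map vs = word_map us" using m w by (simp add: fun_eq_iff)
  show "drop n vs = drop n us" using m by simp
  show "word_map (take n vs) = word_map (take n us)" using m w by (simp add: fun_eq_iff)
qed

lemma coxeter_moves_invariants:
  assumes "(coxeter_move \<Delta> 0 n)\<^sup>*\<^sup>* us vs" "set us \<subseteq> \<Delta>"
  shows "set vs \<subseteq> \<Delta> \<and> length vs = length us \<and> word_map vs = word_map us \<and>
    drop n vs = drop n us \<and> word_map (take n vs) = word_map (take n us)"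
  using assms
proof (induction rule: rtranclp_induct)
  case (step vs us')
  then show ?case using coxeter_move_invariants[OF step.hyps(2)] by simp
qed simp

text \<open>The Matsumoto-Tits theorem, by induction on the length. If the first letters
  \<open>a\<close> and \<open>b\<close> differ, both are inversions, hence so are all positive roots
  that they span, and the longest element of their rank two subgroup is a prefix. One braid move on
  this prefix exchanges the first letters; the passages before and after it join words with equal
  first letters.\<close>

theorem word_property:
  assumes "red us" "red vs" "word_map us = word_map vs"
  shows "(coxeter_move \<Delta> 0 (length us))\<^sup>*\<^sup>* us vs"
  using assms
proof (induction "length us" arbitrary: us vs)
  case 0
  then have "us = []" "vs = []" using red_length[OF 0(2-4)] by auto
  then show ?case by simp
next
  case (Suc n)
  have len: "length vs = Suc n" using red_length[OF Suc.prems] Suc.hyps(2) by simp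
  obtain a us' b vs' where u: "us = a # us'" and v: "vs = b # vs'"
    using Suc.hyps(2) len by (metis length_Suc_conv)
  have ab: "a \<in> \<Delta>" "b \<in> \<Delta>" using red_set Suc.prems u v by force+
  have IH: "(coxeter_move \<Delta> 0 (Suc n))\<^sup>*\<^sup>* (c # xs) (c # ys)"
    if "red (c # xs)" "red (c # ys)" "word_map (c # xs) = word_map (c # ys)" "length xs = n" for c xs ys
  proof -
    have "word_map xs = word_map ys"
    proof
      fix z
      show "word_map xs z = word_map ys z" using fun_cong[OF that(3), of "reflect c z"] by simp
    qed
    then have "(coxeter_move \<Delta> 0 n)\<^sup>*\<^sup>* xs ys"
      using Suc.hyps(1)[of xs ys] that red_Cons by simp
    then show ?thesis by (rule coxeter_moves_Cons)
  qed
  show ?case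
  proof (cases "a = b")
    case True
    have "length us' = n" using Suc.hyps(2) u by simp
    then have "(coxeter_move \<Delta> 0 (Suc n))\<^sup>*\<^sup>* us vs" unfolding u v True
      using IH[of b us' vs'] Suc.prems[unfolded u v True] by blast
    then show ?thesis using Suc.hyps(2) by simp
  next
    case False
    define m where "m = braid_length a b"
    obtain k where k: "m = Suc k" using braid_length_pos m_def by metis
    have usD: "set us \<subseteq> \<Delta>" using red_set Suc.prems by blast
    have inv_eq: "inv us = inv vs" using Suc.prems(3) by simp
    have "a \<in> inv us" "b \<in> inv us"
      using hd_in_inv Suc.prems u v inv_eq by metis+
    then have neg: "ht (word_map us a) < 0" "ht (word_map us b) < 0"
      using mem_inv_ht[OF usD] base_pos ab by auto
    have sub: "inv (alternating a b m) \<subseteq> inv us"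
    proof
      fix x assume x: "x \<in> inv (alternating a b m)"
      then obtain p q where pq: "x = p *\<^sub>R a + q *\<^sub>R b" "0 \<le> p" "0 \<le> q" "0 < p + q"
        using alternating_red(3)[OF ab False] unfolding m_def by blast
      have "ht (word_map us x) = p * ht (word_map us a) + q * ht (word_map us b)"
        by (simp add: pq(1))
      also have "\<dots> < 0"
      proof (cases "p = 0")
        case True then show ?thesis using pq neg by (simp add: mult_pos_neg)
      next
        case False
        then have "p * ht (word_map us a) < 0" using pq neg by (simp add: mult_pos_neg)
        moreover have "q * ht (word_map us b) \<le> 0" using pq neg by (simp add: mult_nonneg_nonpos)
        ultimately show ?thesis by linarith
      qed
      finally show "x \<in> inv us" using mem_inv_ht[OF usD] x by (auto simp: lambda_set_def)
    qed
    obtain ws where ws: "red (alternating a b m @ ws)" "word_map (alternating a b m @ ws) = word_map us"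
      using red_extend_word[OF alternating_red(1)[OF ab False] usD] sub unfolding m_def by blast
    have w2: "word_map (alternating b a m @ ws) = word_map us"
      using ws(2) alternating_red(2)[OF ab False] unfolding m_def by (simp add: fun_eq_iff)
    have l1: "length (alternating a b m @ ws) = Suc n" using red_length[OF ws(1) Suc.prems(1) ws(2)] Suc.hyps(2) by simp
    have "set (alternating b a m @ ws) \<subseteq> \<Delta>"
      using red_set[OF ws(1)] set_alternating[of b a m] ab by auto
    then have r2: "red (alternating b a m @ ws)"
      using red_same_map[OF ws(1)] w2 ws(2) by simp
    have c1: "alternating a b m @ ws = a # (alternating b a k @ ws)"
      and c2: "alternating b a m @ ws = b # (alternating a b k @ ws)" by (simp_all add: k)
    have s1: "(coxeter_move \<Delta> 0 (Suc n))\<^sup>*\<^sup>* us (alternating a b m @ ws)"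
    proof -
      have "length us' = n" using Suc.hyps(2) u by simp
      then show ?thesis unfolding c1 u
        using IH[of a us' "alternating b a k @ ws"] Suc.prems(1)[unfolded u] ws[unfolded c1 u] by metis
    qed
    have s2: "coxeter_move \<Delta> 0 (Suc n) (alternating a b m @ ws) (alternating b a m @ ws)"
      using coxeter_move.intros[of a \<Delta> b 0 "[]" "Suc n" ws] ab False l1 by (simp add: m_def)
    have s3: "(coxeter_move \<Delta> 0 (Suc n))\<^sup>*\<^sup>* (alternating b a m @ ws) vs"
    proof -
      have "length (alternating a b k @ ws) = n" using l1 by (simp add: k)
      moreover have "word_map (alternating b a m @ ws) = word_map vs" using w2 Suc.prems(3) by metis
      ultimately show ?thesis unfolding c2 v
        using IH[of b "alternating a b k @ ws" vs'] Suc.prems(2)[unfolded v] r2[unfolded c2]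
        by (metis c2 v)
    qed
    show ?thesis using s1 s2 s3 Suc.hyps(2) by (metis rtranclp.rtrancl_into_rtrancl rtranclp_trans)
  qed
qed

text \<open>A positive root that is not simple is a sum of at least two simple roots, so its value
  would be at least 2. The lemma is applied to heights transported by Weyl group elements.\<close>

lemma base_by_functional:
  fixes h :: "'a \<Rightarrow> real"
  assumes x: "x \<in> P" and h: "linear h" "\<And>g. g \<in> \<Delta> \<Longrightarrow> 1 \<le> h g" and le: "h x \<le> 1"
  shows "x \<in> \<Delta>"
proof -
  obtain c :: "'a \<Rightarrow> nat" where c: "x = (\<Sum>a\<in>\<Delta>. real (c a) *\<^sub>R a)" "h x = (\<Sum>a\<in>\<Delta>. real (c a) * h a)"
    using nonneg_comb_functional[OF pos_nonneg[OF x]] h(1) by metis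
  have "real (\<Sum>a\<in>\<Delta>. c a) = (\<Sum>a\<in>\<Delta>. real (c a) * 1)" by simp
  also have "\<dots> \<le> (\<Sum>a\<in>\<Delta>. real (c a) * h a)" using h(2) by (intro sum_mono mult_left_mono) auto
  also have "\<dots> \<le> 1" using c(2) le by simp
  finally have le1: "(\<Sum>a\<in>\<Delta>. c a) \<le> 1" by linarith
  obtain a where a: "a \<in> \<Delta>" "c a \<noteq> 0"
  proof (rule ccontr)
    assume "\<not> thesis"
    then have "\<forall>a\<in>\<Delta>. c a = 0" using that by blast
    then have "x = 0" using c(1) by simp
    then show False using x pos_root root_zero by blast
  qed
  then have s: "(\<Sum>a\<in>\<Delta>. c a) = c a + (\<Sum>a\<in>\<Delta>-{a}. c a)" using base_finite by (simp add: sum.remove)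
  then have "c a = 1" "(\<Sum>a\<in>\<Delta>-{a}. c a) = 0" using le1 a by auto
  then have "\<forall>b\<in>\<Delta>-{a}. c b = 0" using base_finite by simp
  then have "x = a" using c(1) a base_finite \<open>c a = 1\<close> by (simp add: sum.remove)
  then show ?thesis using a by simp
qed

text \<open>A gallery of \<open>R\<close> induces a gallery of \<open>S\<close>: the chamber of
  \<open>us\<close> is the chamber of \<open>S\<close> that contains the chamber of
  \<open>ws\<close>. Crossing a wall of \<open>S\<close> appends a letter, and crossing any other
  wall leaves \<open>us\<close> as it is.\<close>

lemma lambda_seq_filter:
  assumes "red ws" and sub: "based_roots S \<Gamma>" "S \<subseteq> R" "pos_roots S \<Gamma> = S \<inter> P"
  shows "\<exists>us. based_roots.red S \<Gamma> us \<and> lambda_seq us = filter (\<lambda>x. x \<in> S \<inter> P) (lambda_seq ws)"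
  using assms(1)
proof (induction ws rule: rev_induct)
  case Nil
  interpret S: based_roots S \<Gamma> by fact
  show ?case by (intro exI[of _ "[]"]) simp
next
  case (snoc a ws)
  interpret S: based_roots S \<Gamma> by fact
  have ws: "red ws" "a \<in> \<Delta>" "word_map (rev ws) a \<in> P" using snoc.prems red_snoc by auto
  obtain us where us: "S.red us" "lambda_seq us = filter (\<lambda>x. x \<in> S \<inter> P) (lambda_seq ws)"
    using snoc.IH ws by blast
  define x where "x = word_map (rev ws) a"
  have wx: "word_map ws x = a" by (simp add: x_def)
  note wsD = red_set[OF ws(1)] and usD = S.red_set[OF us(1)]
  show ?case
  proof (cases "x \<in> S")
    case False
    then show ?thesis using us by (intro exI[of _ us]) (simp add: x_def)
  next
    case True
    have invs: "S.inv us = inv ws \<inter> S"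
      using S.red_lambda[OF us(1)] red_lambda[OF ws(1)] us(2) by (auto simp: lambda_set_def)
    have xP: "x \<in> P" "x \<in> S.P" using ws True sub by (auto simp: x_def)
    have "x \<notin> inv ws" using mem_inv[OF wsD] wx base_pos ws by auto
    then have uxP: "word_map us x \<in> S.P" using S.mem_inv[OF usD, of x] invs xP by auto
    \<comment> \<open>The height of \<open>R\<close> after \<open>ws\<close>, seen from the chamber
      of \<open>us\<close>. It is at least 1 on the base of \<open>S\<close>, and it is 1 at the new
      root because \<open>ws\<close> sends this root to the simple root \<open>a\<close>.\<close>
    define h where "h z = ht (word_map ws (word_map (rev us) z))" for z
    have h: "linear h" unfolding h_def
      using linear_compose[OF linear_compose[OF linear_word_map linear_word_map] linear_ht]
      by (simp add: o_def)
    have "1 \<le> h g" if g: "g \<in> \<Gamma>" for g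
    proof -
      define y where "y = word_map (rev us) g"
      have y: "y \<in> S" "y \<in> R" "word_map us y = g" using S.word_map_rev_root[OF usD] g S.base_sub sub(2) by (auto simp: y_def)
      have "word_map ws y \<in> P"
      proof (cases "y \<in> S.P")
        case True
        then have "y \<notin> S.inv us" using y S.mem_inv[OF usD, of y] S.base_pos[OF g] by simp
        then show ?thesis using invs y True mem_inv[OF wsD, of y] sub by auto
      next
        case False
        then have my: "- y \<in> S.P" using S.neg_iff y by simp
        then have "- y \<in> S.inv us" using S.mem_inv[OF usD, of "- y"] y S.pos_not_neg[OF S.base_pos[OF g]] by simp
        then have "- y \<in> inv ws" using invs by blast
        then have "- word_map ws y \<notin> P" using mem_inv[OF wsD, of "- y"] by simp
        then show ?thesis using neg_iff[OF word_map_root[OF wsD y(2)]] by blast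
      qed
      then show ?thesis using ht_pos by (simp add: h_def y_def)
    qed
    moreover have "h (word_map us x) = 1" by (simp add: h_def wx ht_base ws)
    ultimately have "word_map us x \<in> \<Gamma>" using S.base_by_functional[OF uxP h] by simp
    then have "S.red (us @ [word_map us x])" using us(1) xP by (simp add: S.red_snoc)
    moreover have "lambda_seq (us @ [word_map us x]) = filter (\<lambda>x. x \<in> S \<inter> P) (lambda_seq (ws @ [a]))"
      using us(2) True xP by (simp add: x_def[symmetric])
    ultimately show ?thesis by blast
  qed
qed

lemma base_in_sub:
  assumes "based_roots S \<Gamma>" "pos_roots S \<Gamma> = S \<inter> P" "a \<in> \<Delta>" "a \<in> S"
  shows "a \<in> \<Gamma>"
proof -
  interpret S: based_roots S \<Gamma> by fact
  have "1 \<le> ht g" if "g \<in> \<Gamma>" for g using S.base_pos[OF that] assms(2) ht_pos by auto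
  then show ?thesis using S.base_by_functional[of a ht] linear_ht assms base_pos ht_base by auto
qed

end

section \<open>Relations in the span of a triple\<close>

lemma inner_sum_mset: "\<Sum>\<^sub># X \<bullet> y = (\<Sum>x\<in>#X. x \<bullet> y)"
  by (induction X) (auto simp: inner_add_left)

lemma linear_sum_mset:
  fixes f :: "'a::real_vector \<Rightarrow> 'b::real_vector"
  assumes "linear f" shows "f (\<Sum>\<^sub># X) = (\<Sum>x\<in>#X. f x)"
  by (induction X) (auto simp: linear_0[OF assms] linear_add[OF assms])

lemma sum_mset_filter_ge:
  fixes g :: "'b \<Rightarrow> real"
  assumes "\<And>y. y \<in># Y \<Longrightarrow> 0 \<le> g y" "\<And>y. y \<in># Y \<Longrightarrow> p y \<Longrightarrow> k \<le> g y"
  shows "k * real (size (filter_mset p Y)) \<le> (\<Sum>y\<in>#Y. g y)"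
  using assms
proof (induction Y)
  case (add x Y)
  have "k * real (size (filter_mset p Y)) \<le> (\<Sum>y\<in>#Y. g y)" using add by simp
  moreover have "0 \<le> g x" "p x \<Longrightarrow> k \<le> g x" using add.prems by auto
  ultimately show ?case by (auto simp: algebra_simps)
qed simp

lemma sum_mset_pos:
  fixes g :: "'b \<Rightarrow> real"
  assumes "Y \<noteq> {#}" "\<And>y. y \<in># Y \<Longrightarrow> 0 < g y"
  shows "0 < (\<Sum>y\<in>#Y. g y)"
  using assms
proof (induction Y)
  case (add x Y)
  then show ?case by (cases "Y = {#}") (auto intro: add_pos_pos)
qed simp

lemma span_pairD:
  fixes a b :: "'a::real_vector"
  assumes "v \<in> span {a, b}" obtains s t where "v = s *\<^sub>R a + t *\<^sub>R b"
proof -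
  from assms obtain s where "v - s *\<^sub>R a \<in> span {b}" by (auto simp: span_insert)
  then obtain t where "v - s *\<^sub>R a = t *\<^sub>R b" by (auto simp: span_singleton)
  then have "v = s *\<^sub>R a + t *\<^sub>R b" by (simp add: algebra_simps)
  then show ?thesis using that by blast
qed

lemma span_pairI: "s *\<^sub>R a + t *\<^sub>R b \<in> span {a, b}"
  by (intro span_add span_scale span_base) auto

text \<open>\<open>f\<^sub>1\<close> and \<open>f\<^sub>2\<close> describe two positive systems, degenerated to the walls of their simple roots
  \<open>\<alpha>\<close> and \<open>-\<beta>\<close>. The roots positive for both are the roots outside the inversion set.\<close>

locale triple_core =
  fixes Q :: "'a::euclidean_space set" and \<alpha> \<beta> :: 'a and \<kappa> :: real and f1 f2 :: "'a \<Rightarrow> real"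
  assumes rsQ: "root_system Q"
    and norms: "\<And>x. x \<in> Q \<Longrightarrow> x \<bullet> x = \<kappa> \<or> x \<bullet> x = 2 * \<kappa>"
    and alQ: "\<alpha> \<in> Q" and beQ: "\<beta> \<in> Q" and gaQ: "\<alpha> + \<beta> \<in> Q"
    and aln: "\<alpha> \<bullet> \<alpha> = 2 * \<kappa>" and ben: "\<beta> \<bullet> \<beta> = 2 * \<kappa>" and gan: "(\<alpha> + \<beta>) \<bullet> (\<alpha> + \<beta>) = 2 * \<kappa>"
    and lin1: "linear f1" and lin2: "linear f2"
    and z1: "\<And>x. x \<in> Q \<Longrightarrow> f1 x = 0 \<Longrightarrow> x = \<alpha> \<or> x = - \<alpha>"
    and z2: "\<And>x. x \<in> Q \<Longrightarrow> f2 x = 0 \<Longrightarrow> x = \<beta> \<or> x = - \<beta>"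
    and f1a: "f1 \<alpha> = 0" and f2b: "f2 \<beta> = 0" and f1b: "0 < f1 \<beta>" and f2a: "f2 \<alpha> < 0"
begin

lemmas f_simps [simp] = linear_add[OF lin1] linear_diff[OF lin1] linear_neg[OF lin1] linear_scale[OF lin1]
  linear_add[OF lin2] linear_diff[OF lin2] linear_neg[OF lin2] linear_scale[OF lin2] f1a f2b

text \<open>The symmetry that exchanges the two positive systems. It keeps \<open>M\<close> and the
  type \<open>tA\<close> and exchanges \<open>tB\<close> with \<open>tC\<close>, so that each
  statement about \<open>tB\<close> also serves for \<open>tC\<close>.\<close>

lemma swap: "triple_core Q (- \<beta>) (- \<alpha>) \<kappa> f2 f1"
proof
  have "- (\<alpha> + \<beta>) \<in> Q" using root_systemD(6)[OF rsQ] gaQ by blast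
  moreover have "- \<beta> + - \<alpha> = - (\<alpha> + \<beta>)" by simp
  ultimately show "- \<beta> + - \<alpha> \<in> Q" by metis
  have "- \<beta> + - \<alpha> = - (\<alpha> + \<beta>)" by simp
  then show "(- \<beta> + - \<alpha>) \<bullet> (- \<beta> + - \<alpha>) = 2 * \<kappa>" using gan by (metis inner_minus_left inner_minus_right minus_minus)
  show "\<And>x. x \<in> Q \<Longrightarrow> f2 x = 0 \<Longrightarrow> x = - \<beta> \<or> x = - (- \<beta>)" using z2 by auto
  show "\<And>x. x \<in> Q \<Longrightarrow> f1 x = 0 \<Longrightarrow> x = - \<alpha> \<or> x = - (- \<alpha>)" using z1 by auto
qed (use rsQ norms root_systemD(6)[OF rsQ] alQ beQ aln ben lin1 lin2 f1b f2a in auto)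

lemma kpos: "0 < \<kappa>"
  using aln alQ root_systemD(2)[OF rsQ] inner_gt_zero_iff[of \<alpha>] by force

lemma ab: "\<alpha> \<bullet> \<beta> = - \<kappa>" "\<beta> \<bullet> \<alpha> = - \<kappa>"
  using gan aln ben by (auto simp: inner_add_left inner_add_right inner_commute)

lemma norm_bounds: "x \<in> Q \<Longrightarrow> \<kappa> \<le> x \<bullet> x" "x \<in> Q \<Longrightarrow> x \<bullet> x \<le> 2 * \<kappa>"
  using norms[of x] kpos by auto

text \<open>The products of \<open>x\<close> with \<alpha> and \<beta> are \<open>m\<close> and
  \<open>n\<close> times \<open>\<kappa>\<close>, and its projection to their plane has squared
  length 2/3 (m^2 + m n + n^2) \<open>\<kappa>\<close>. As no root is longer than \<alpha>, the
  quadratic form is at most 3, and 3 is attained only in the plane itself. Otherwise the projection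
  is 0 or a shortest weight of the A2 system.\<close>

lemma plane_types:
  assumes x: "x \<in> Q"
  shows "x \<in> {\<alpha>, - \<alpha>, \<beta>, - \<beta>, \<alpha> + \<beta>, - (\<alpha> + \<beta>)} \<or>
    (x \<bullet> \<alpha>, x \<bullet> \<beta>) \<in> {(0,0), (\<kappa>,0), (0,\<kappa>), (-\<kappa>,0), (0,-\<kappa>), (\<kappa>,-\<kappa>), (-\<kappa>,\<kappa>)}"
proof -
  obtain m n :: int where mn: "x \<bullet> \<alpha> = m * \<kappa>" "x \<bullet> \<beta> = n * \<kappa>"
  proof -
    have "cartan_number x \<alpha> \<in> \<int>" "cartan_number x \<beta> \<in> \<int>"
      using root_systemD(4)[OF rsQ] x alQ beQ by auto
    then obtain m n :: int where "cartan_number x \<alpha> = m" "cartan_number x \<beta> = n" by (metis Ints_cases)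
    then show ?thesis using that kpos by (auto simp: cartan_number_def aln ben field_simps)
  qed
  have mn': "\<alpha> \<bullet> x = m * \<kappa>" "\<beta> \<bullet> x = n * \<kappa>" using mn by (simp_all add: inner_commute)
  \<comment> \<open>Coefficients of the projection, from the inverse Gram matrix of \<alpha> and
    \<beta>; \<open>w\<close> is the component orthogonal to the plane.\<close>
  define p q :: real where "p = (2 * m + n) / 3" and "q = (m + 2 * n) / 3"
  define w where "w = x - (p *\<^sub>R \<alpha> + q *\<^sub>R \<beta>)"
  have "w \<bullet> w = x \<bullet> x - 2 * (p * (m * \<kappa>) + q * (n * \<kappa>)) + (p * p * (2 * \<kappa>) - 2 * p * q * \<kappa> + q * q * (2 * \<kappa>))"
    unfolding w_def inner_diff_left inner_diff_right inner_add_left inner_add_right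
      inner_scaleR_left inner_scaleR_right mn mn' aln ben ab by (simp add: algebra_simps)
  also have "\<dots> = x \<bullet> x - 2 / 3 * (m * m + m * n + n * n) * \<kappa>"
    unfolding p_def q_def by (simp add: field_simps)
  finally have w: "w \<bullet> w = x \<bullet> x - 2 / 3 * (m * m + m * n + n * n) * \<kappa>" .
  have "2 / 3 * (m * m + m * n + n * n) * \<kappa> \<le> 2 * \<kappa>"
    using w inner_ge_zero[of w] norm_bounds(2)[OF x] by linarith
  moreover define T where "T = real_of_int (m * m + m * n + n * n)"
  ultimately have "2 / 3 * T * \<kappa> \<le> 2 * \<kappa>" by (simp only:)
  then have "\<kappa> * T \<le> \<kappa> * 3" by (simp add: mult.commute[of T])
  then have "T \<le> 3" using kpos by (rule mult_left_le_imp_le)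
  then have "real_of_int (m * m + m * n + n * n) \<le> 3" by (simp only: T_def)
  then have le3: "m * m + m * n + n * n \<le> 3" by linarith
  \<comment> \<open>Completing the square in one variable bounds the other one.\<close>
  have sq: "4 * (m * m + m * n + n * n) = (2 * m + n) * (2 * m + n) + 3 * (n * n)"
    "4 * (m * m + m * n + n * n) = (2 * n + m) * (2 * n + m) + 3 * (m * m)" by algebra+
  have b: "k * k \<le> 4 \<Longrightarrow> k \<in> {-2, -1, 0, 1, 2}" for k :: int
  proof -
    assume "k * k \<le> 4"
    then have "\<bar>k\<bar> \<le> 2" using abs_le_square_iff[of k 2] by (simp add: power2_eq_square)
    then show ?thesis by auto
  qed
  define A B where "A = (2 * m + n) * (2 * m + n)" and "B = (2 * n + m) * (2 * n + m)"
  have "0 \<le> A" "0 \<le> B" by (simp_all add: A_def B_def)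
  moreover define S where "S = m * m + m * n + n * n"
  ultimately have "m * m \<le> 4" "n * n \<le> 4"
    using le3[folded S_def] sq[folded A_def B_def S_def] by simp_all
  then have "m \<in> {-2, -1, 0, 1, 2}" "n \<in> {-2, -1, 0, 1, 2}" using b by blast+
  then have cases: "(m, n) \<in> {(1,1), (-1,-1), (2,-1), (-2,1), (1,-2), (-1,2)} \<or>
      (m, n) \<in> {(0,0), (1,0), (0,1), (-1,0), (0,-1), (1,-1), (-1,1)}"
    using le3 by (elim insertE emptyE) simp_all
  then show ?thesis
  proof
    assume mn6: "(m, n) \<in> {(1,1), (-1,-1), (2,-1), (-2,1), (1,-2), (-1,2)}"
    then have "m * m + m * n + n * n = 3" by auto
    then have "real_of_int m * m + m * n + n * n = 3" by (metis of_int_add of_int_mult of_int_numeral)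
    then have "w \<bullet> w \<le> 0" using w norm_bounds(2)[OF x] by simp
    then have "w = 0" by (metis inner_ge_zero inner_eq_zero_iff order_antisym)
    then have x: "x = p *\<^sub>R \<alpha> + q *\<^sub>R \<beta>" unfolding w_def by (rule iffD1[OF right_minus_eq])
    have "(p, q) \<in> {(1,1), (-1,-1), (1,0), (-1,0), (0,-1), (0,1)}"
      using mn6 unfolding p_def q_def by (elim insertE emptyE) simp_all
    then have "x \<in> {\<alpha>, - \<alpha>, \<beta>, - \<beta>, \<alpha> + \<beta>, - (\<alpha> + \<beta>)}"
      unfolding x by (elim insertE emptyE) simp_all
    then show ?thesis by blast
  next
    assume "(m, n) \<in> {(0,0), (1,0), (0,1), (-1,0), (0,-1), (1,-1), (-1,1)}"
    then show ?thesis using mn by auto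
  qed
qed

section \<open>Pairs of roots outside the segment\<close>

definition M where "M = {x \<in> Q. 0 < f1 x \<and> 0 < f2 x}"

lemma M_types:
  assumes "x \<in> M"
  shows "(x \<bullet> \<alpha>, x \<bullet> \<beta>) \<in> {(0,0), (\<kappa>,0), (0,\<kappa>), (-\<kappa>,0), (0,-\<kappa>), (\<kappa>,-\<kappa>), (-\<kappa>,\<kappa>)}"
proof -
  have x: "x \<in> Q" "0 < f1 x" "0 < f2 x" using assms by (auto simp: M_def)
  then have "x \<notin> {\<alpha>, - \<alpha>, \<beta>, - \<beta>, \<alpha> + \<beta>, - (\<alpha> + \<beta>)}" using f1b f2a by auto
  then show ?thesis using plane_types[OF x(1)] by blast
qed

lemma M_add: "x \<in> M \<Longrightarrow> y \<in> M \<Longrightarrow> x \<bullet> y < 0 \<Longrightarrow> x + y \<in> M"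
proof -
  assume a: "x \<in> M" "y \<in> M" "x \<bullet> y < 0"
  then have "x \<noteq> - y" by (auto simp: M_def)
  then show ?thesis using root_add[OF rsQ] a by (auto simp: M_def)
qed

text \<open>The nonzero planar parts with nonpositive product with \<alpha> and nonnegative product
  with \<beta>. Every root of \<open>M\<close> can be moved to one of them or to the orthogonal
  complement of the plane.\<close>

definition tA where "tA x \<longleftrightarrow> x \<bullet> \<alpha> = - \<kappa> \<and> x \<bullet> \<beta> = \<kappa>"
definition tB where "tB x \<longleftrightarrow> x \<bullet> \<alpha> = - \<kappa> \<and> x \<bullet> \<beta> = 0"
definition tC where "tC x \<longleftrightarrow> x \<bullet> \<alpha> = 0 \<and> x \<bullet> \<beta> = \<kappa>"

text \<open>The roots \<open>x + \<alpha>\<close> and \<open>y - \<beta>\<close> have negative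
  product, so their sum is a root, and so is its negative
  \<open>z = \<beta> - \<alpha> - x - y\<close>. If \<open>z\<close> were not in \<open>M\<close>,
  one of \<open>- z\<close>, \<open>\<beta> - z\<close>, \<open>- \<alpha> - z\<close> would be a
  root of \<open>M\<close> that can replace \<open>x\<close> and \<open>y\<close> in a
  relation.\<close>

lemma A_bad:
  assumes xy: "x \<in> M" "y \<in> M" "tA x" "tA y" "x \<bullet> y < \<kappa>"
    and ns: "\<And>z. z \<in> M \<Longrightarrow> x + y - z \<notin> span {\<alpha>, \<beta>}"
  shows "\<beta> - \<alpha> - x - y \<in> M"
proof -
  have xyQ: "x \<in> Q" "y \<in> Q" and fp: "0 < f1 x" "0 < f2 x" "0 < f1 y" "0 < f2 y" using xy by (auto simp: M_def)
  have xa: "x \<bullet> \<alpha> = - \<kappa>" "x \<bullet> \<beta> = \<kappa>" "y \<bullet> \<alpha> = - \<kappa>" "y \<bullet> \<beta> = \<kappa>"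
    "\<alpha> \<bullet> x = - \<kappa>" "\<beta> \<bullet> x = \<kappa>" "\<alpha> \<bullet> y = - \<kappa>" "\<beta> \<bullet> y = \<kappa>"
    using xy by (auto simp: tA_def inner_commute)
  have "x \<noteq> - \<alpha>" "y \<noteq> \<beta>" using fp by auto
  then have "x + \<alpha> \<in> Q" "y + - \<beta> \<in> Q"
    using root_add[OF rsQ] xa xyQ alQ beQ kpos root_systemD(6)[OF rsQ] by force+
  moreover have "(x + \<alpha>) \<bullet> (y + - \<beta>) < 0"
    using xy(5) by (simp add: inner_add_left inner_add_right inner_diff_right ab xa)
  moreover have "x + \<alpha> \<noteq> - (y + - \<beta>)"
  proof
    assume "x + \<alpha> = - (y + - \<beta>)"
    then have "(x + \<alpha>) \<bullet> \<alpha> = (- (y + - \<beta>)) \<bullet> \<alpha>" by simp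
    then show False using kpos by (simp add: inner_add_left inner_diff_left xa ab aln)
  qed
  ultimately have "(x + \<alpha>) + (y + - \<beta>) \<in> Q" using root_add[OF rsQ] by blast
  then have mQ: "- ((x + \<alpha>) + (y + - \<beta>)) \<in> Q" using root_systemD(6)[OF rsQ] by blast
  define z where "z = \<beta> - \<alpha> - x - y"
  have "- ((x + \<alpha>) + (y + - \<beta>)) = z" by (simp add: z_def)
  then have zQ: "z \<in> Q" using mQ by metis
  have za: "z \<bullet> \<alpha> = - \<kappa>" "z \<bullet> \<beta> = \<kappa>"
    by (auto simp: z_def inner_diff_left xa ab aln ben)
  have mz: "z \<in> Q \<Longrightarrow> - z \<in> Q" by (rule root_systemD(6)[OF rsQ])
  have "z \<noteq> \<alpha>" "z \<noteq> - \<alpha>" "z \<noteq> \<beta>" "z \<noteq> - \<beta>"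
  proof -
    have "z \<bullet> \<alpha> \<noteq> \<alpha> \<bullet> \<alpha>" "z \<bullet> \<alpha> \<noteq> (- \<alpha>) \<bullet> \<alpha>" "z \<bullet> \<beta> \<noteq> \<beta> \<bullet> \<beta>" "z \<bullet> \<beta> \<noteq> (- \<beta>) \<bullet> \<beta>"
      unfolding za inner_minus_left aln ben using kpos by linarith+
    then show "z \<noteq> \<alpha>" "z \<noteq> - \<alpha>" "z \<noteq> \<beta>" "z \<noteq> - \<beta>" by metis+
  qed
  then have f1z: "f1 z \<noteq> 0" and f2z: "f2 z \<noteq> 0"
    using z1[OF zQ] z2[OF zQ] by blast+
  have zz: "f1 z = f1 \<beta> - f1 x - f1 y" "f2 z = - f2 \<alpha> - f2 x - f2 y"
    by (simp_all add: z_def)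
  have R1: "\<beta> - z \<in> Q" "- \<alpha> - z \<in> Q"
  proof -
    show "\<beta> - z \<in> Q" "- \<alpha> - z \<in> Q"
      using root_add[OF rsQ, of \<beta> "- z"] root_add[OF rsQ, of "- \<alpha>" "- z"] za kpos mz zQ alQ beQ
        root_systemD(6)[OF rsQ] \<open>z \<noteq> \<beta>\<close> \<open>z \<noteq> - \<alpha>\<close> by (auto simp: inner_commute)
  qed
  have S: "x + y - (- z) \<in> span {\<alpha>, \<beta>}" "x + y - (\<beta> - z) \<in> span {\<alpha>, \<beta>}" "x + y - (- \<alpha> - z) \<in> span {\<alpha>, \<beta>}"
    using span_pairI[of "-1" \<alpha> 1 \<beta>] span_pairI[of "-1" \<alpha> 0 \<beta>] span_pairI[of 0 \<alpha> 1 \<beta>]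
    by (auto simp: z_def)
  have "0 < f1 z \<and> 0 < f2 z"
  proof (rule ccontr)
    assume "\<not> ?thesis"
    \<comment> \<open>Starting from \<open>- z\<close>, the summand \<open>- \<alpha>\<close>
      repairs \<open>f2\<close> without touching \<open>f1\<close>, and the summand \<beta> repairs
      \<open>f1\<close> without touching \<open>f2\<close>.\<close>
    then consider "f1 z < 0" "f2 z < 0" | "f1 z < 0" "0 < f2 z" | "0 < f1 z" "f2 z < 0"
      using f1z f2z by linarith
    then show False
    proof cases
      case 1 then show False using ns[of "- z"] mz zQ S by (auto simp: M_def)
    next
      case 2 then show False using ns[of "- \<alpha> - z"] zQ R1 S zz fp by (auto simp: M_def)
    next
      case 3 then show False using ns[of "\<beta> - z"] zQ R1 S zz fp by (auto simp: M_def)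
    qed
  qed
  then show ?thesis using zQ by (simp add: M_def z_def)
qed

text \<open>Adding \<open>\<alpha> + \<beta>\<close> to \<open>x\<close> and then \<open>y\<close>
  meets a negative product each time, so the total is a root. It is congruent to
  \<open>x + y\<close> and positive for \<open>f1\<close>, so \<open>ns\<close> forbids that it is
  positive for \<open>f2\<close>. This alone is no contradiction; that arises with a mirror pair of
  type \<open>tC\<close>.\<close>

lemma B_bad:
  assumes xy: "x \<in> M" "y \<in> M" "tB x" "tB y" "x \<bullet> y < \<kappa>"
    and ns: "\<And>z. z \<in> M \<Longrightarrow> x + y - z \<notin> span {\<alpha>, \<beta>}"
  shows "x + y + (\<alpha> + \<beta>) \<in> Q" "0 < f1 (x + y + (\<alpha> + \<beta>))" "f2 (x + y + (\<alpha> + \<beta>)) \<le> 0"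
proof -
  have xyQ: "x \<in> Q" "y \<in> Q" and fp: "0 < f1 x" "0 < f2 x" "0 < f1 y" "0 < f2 y" using xy by (auto simp: M_def)
  have xa: "x \<bullet> \<alpha> = - \<kappa>" "x \<bullet> \<beta> = 0" "y \<bullet> \<alpha> = - \<kappa>" "y \<bullet> \<beta> = 0"
    "\<alpha> \<bullet> x = - \<kappa>" "\<beta> \<bullet> x = 0" "\<alpha> \<bullet> y = - \<kappa>" "\<beta> \<bullet> y = 0"
    using xy by (auto simp: tB_def inner_commute)
  have "x \<noteq> - (\<alpha> + \<beta>)" using fp f1b by auto
  then have "x + (\<alpha> + \<beta>) \<in> Q"
    using root_add[OF rsQ xyQ(1) gaQ] xa kpos by (simp add: inner_add_right)
  moreover have "(x + (\<alpha> + \<beta>)) \<bullet> y < 0"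
    using xy(5) by (simp add: inner_add_left inner_add_right ab xa)
  moreover have "x + (\<alpha> + \<beta>) \<noteq> - y"
  proof
    assume "x + (\<alpha> + \<beta>) = - y"
    then have "(x + (\<alpha> + \<beta>)) \<bullet> \<alpha> = (- y) \<bullet> \<alpha>" by simp
    then show False using kpos by (simp add: inner_add_left xa ab aln)
  qed
  ultimately have "(x + (\<alpha> + \<beta>)) + y \<in> Q" using root_add[OF rsQ] xyQ by blast
  then show Q: "x + y + (\<alpha> + \<beta>) \<in> Q" by (simp add: algebra_simps)
  show f1: "0 < f1 (x + y + (\<alpha> + \<beta>))" using fp f1b by simp
  show "f2 (x + y + (\<alpha> + \<beta>)) \<le> 0"
  proof (rule ccontr)
    assume "\<not> ?thesis"
    then have "x + y + (\<alpha> + \<beta>) \<in> M" using Q f1 by (simp add: M_def)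
    moreover have "x + y - (x + y + (\<alpha> + \<beta>)) = (-1) *\<^sub>R \<alpha> + (-1) *\<^sub>R \<beta>" by simp
    ultimately show False using ns span_pairI[of "-1" \<alpha> "-1" \<beta>] by metis
  qed
qed

text \<open>What the counting uses of a shortest relation after normalisation. The inclusion of
  \<open>{#x, y#}\<close> compares a repeated root with itself, but not a single occurrence.\<close>

definition typed where "typed X \<longleftrightarrow> X \<noteq> {#} \<and> \<Sum>\<^sub># X \<in> span {\<alpha>, \<beta>} \<and>
  (\<forall>x\<in>#X. x \<in> M \<and> (x \<bullet> \<alpha> = 0 \<and> x \<bullet> \<beta> = 0 \<or> tA x \<or> tB x \<or> tC x)) \<and>
  (\<forall>x y. {#x, y#} \<subseteq># X \<longrightarrow> 0 \<le> x \<bullet> y)"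

definition nA where "nA X = real (size (filter_mset tA X))"
definition nB where "nB X = real (size (filter_mset tB X))"
definition nC where "nC X = real (size (filter_mset tC X))"

lemma type_distinct: "tA x \<Longrightarrow> \<not> tB x \<and> \<not> tC x" "tB x \<Longrightarrow> \<not> tC x"
  using kpos by (auto simp: tA_def tB_def tC_def)

text \<open>Positivity of \<open>f1\<close> and \<open>f2\<close> on the sum fixes the signs of its
  two coefficients. The products of the sum with \<alpha> and \<beta> count the types, and solving
  these two equations gives the values of \<open>3 * a\<close> and \<open>3 * b\<close>.\<close>

lemma typed_sum:
  assumes "typed X"
  obtains a b where "\<Sum>\<^sub># X = b *\<^sub>R \<beta> - a *\<^sub>R \<alpha>" "0 < a" "0 < b"
    "3 * a = 2 * nB X - nC X + nA X" "3 * b = 2 * nC X - nB X + nA X"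
proof -
  have X: "X \<noteq> {#}" "\<Sum>\<^sub># X \<in> span {\<alpha>, \<beta>}"
    "\<And>x. x \<in># X \<Longrightarrow> x \<in> M \<and> (x \<bullet> \<alpha> = 0 \<and> x \<bullet> \<beta> = 0 \<or> tA x \<or> tB x \<or> tC x)"
    using assms by (auto simp: typed_def)
  obtain s t where st: "\<Sum>\<^sub># X = s *\<^sub>R \<alpha> + t *\<^sub>R \<beta>" using span_pairD[OF X(2)] by blast
  have "0 < (\<Sum>x\<in>#X. f1 x)" "0 < (\<Sum>x\<in>#X. f2 x)"
    using X by (auto intro!: sum_mset_pos simp: M_def)
  then have "0 < t * f1 \<beta>" "0 < s * f2 \<alpha>"
    using linear_sum_mset[OF lin1, of X] linear_sum_mset[OF lin2, of X] by (auto simp: st)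
  then have pos: "0 < t" "s < 0" using f1b f2a by (auto simp: zero_less_mult_iff)
  have tt: "\<And>x. x \<in># X \<Longrightarrow> x \<bullet> \<alpha> = 0 \<and> x \<bullet> \<beta> = 0 \<or> tA x \<or> tB x \<or> tC x" using X(3) by blast
  then have "(\<Sum>x\<in>#X. x \<bullet> \<alpha>) = - \<kappa> * (nA X + nB X) \<and> (\<Sum>x\<in>#X. x \<bullet> \<beta>) = \<kappa> * (nA X + nC X)"
  proof (induction X)
    case empty
    then show ?case by (simp add: nA_def nB_def nC_def)
  next
    case (add x X)
    then have IH: "(\<Sum>x\<in>#X. x \<bullet> \<alpha>) = - \<kappa> * (nA X + nB X)" "(\<Sum>x\<in>#X. x \<bullet> \<beta>) = \<kappa> * (nA X + nC X)"
      by auto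
    consider "x \<bullet> \<alpha> = 0" "x \<bullet> \<beta> = 0" | "tA x" | "tB x" | "tC x" using add.prems[of x] by auto
    then show ?case
    proof cases
      case 1
      then have "\<not> tA x" "\<not> tB x" "\<not> tC x" using kpos by (auto simp: tA_def tB_def tC_def)
      then show ?thesis using 1 IH by (simp add: nA_def nB_def nC_def)
    next
      case 2
      then have "\<not> tB x" "\<not> tC x" using type_distinct by auto
      then show ?thesis using 2 IH by (simp add: nA_def nB_def nC_def tA_def algebra_simps)
    next
      case 3
      then have "\<not> tA x" "\<not> tC x" using type_distinct by auto
      then show ?thesis using 3 IH by (simp add: nA_def nB_def nC_def tB_def algebra_simps)
    next
      case 4
      then have "\<not> tA x" "\<not> tB x" using type_distinct by auto
      then show ?thesis using 4 IH by (simp add: nA_def nB_def nC_def tC_def algebra_simps)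
    qed
  qed
  then have "\<Sum>\<^sub># X \<bullet> \<alpha> = - \<kappa> * (nA X + nB X)" "\<Sum>\<^sub># X \<bullet> \<beta> = \<kappa> * (nA X + nC X)"
    by (simp_all add: inner_sum_mset)
  then have "\<kappa> * (2 * s - t) = \<kappa> * (- (nA X + nB X))" "\<kappa> * (2 * t - s) = \<kappa> * (nA X + nC X)"
    by (simp_all add: st inner_add_left aln ben ab algebra_simps)
  then have "2 * s - t = - (nA X + nB X)" "2 * t - s = nA X + nC X"
    using kpos by (metis less_irrefl mult_left_cancel)+
  then show ?thesis using pos by (intro that[of t "- s"]) (auto simp: st)
qed

lemma typed_inner_ge:
  assumes X: "X = add_mset x Y" and nn: "\<And>y. y \<in># Y \<Longrightarrow> 0 \<le> y \<bullet> x"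
    and k: "\<And>y. y \<in># Y \<Longrightarrow> p y \<Longrightarrow> \<kappa> \<le> y \<bullet> x"
  shows "x \<bullet> x + \<kappa> * real (size (filter_mset p Y)) \<le> \<Sum>\<^sub># X \<bullet> x"
  using sum_mset_filter_ge[of Y "\<lambda>y. y \<bullet> x" p \<kappa>] nn k
  by (simp add: X inner_add_left inner_sum_mset)

lemma typed_pairs:
  assumes "typed X" "X = add_mset x Y" "y \<in># Y"
  shows "0 \<le> y \<bullet> x" "{#y, x#} \<subseteq># X"
proof -
  show "{#y, x#} \<subseteq># X" using assms by (simp add: add_mset_commute[of y])
  then show "0 \<le> y \<bullet> x" using assms(1) unfolding typed_def by blast
qed

text \<open>A pair that violates this is one to which \<open>A_bad\<close> applies, provided that
  the relation cannot be shortened; likewise for \<open>okB\<close> and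
  \<open>B_bad\<close>.\<close>

definition okA where "okA X \<longleftrightarrow> (\<forall>x y. {#x, y#} \<subseteq># X \<longrightarrow> tA x \<longrightarrow> tA y \<longrightarrow> \<kappa> \<le> x \<bullet> y)"
definition okB where "okB X \<longleftrightarrow> (\<forall>x y. {#x, y#} \<subseteq># X \<longrightarrow> tB x \<longrightarrow> tB y \<longrightarrow> \<kappa> \<le> x \<bullet> y)"

section \<open>Counting the types in a normalised relation\<close>

lemma size_filter_pos: "0 < real (size (filter_mset p X)) \<longleftrightarrow> (\<exists>x. x \<in># X \<and> p x)"
  by (induction X) auto

text \<open>The sum is paired with one summand of type \<open>tA\<close>: the other summands of this
  type contribute at least \<open>\<kappa>\<close> each and the rest is nonnegative, so
  \<open>nA X \<le> a + b\<close>.\<close>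

lemma A_count:
  assumes T: "typed X" and ok: "okA X" and n: "0 < nA X"
  shows "nA X \<le> nB X + nC X"
proof -
  obtain x where x: "x \<in># X" "tA x" using n unfolding nA_def size_filter_pos by blast
  obtain Y where Y: "X = add_mset x Y" using x(1) by (metis insert_DiffM)
  have xQ: "x \<in> Q" using T x unfolding typed_def M_def by blast
  obtain a b where v: "\<Sum>\<^sub># X = b *\<^sub>R \<beta> - a *\<^sub>R \<alpha>"
    "3 * a = 2 * nB X - nC X + nA X" "3 * b = 2 * nC X - nB X + nA X" using typed_sum[OF T] by metis
  have "x \<bullet> x + \<kappa> * real (size (filter_mset tA Y)) \<le> \<Sum>\<^sub># X \<bullet> x"
    by (rule typed_inner_ge[OF Y]) (use typed_pairs[OF T Y] ok x in \<open>auto simp: okA_def\<close>)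
  moreover have "\<Sum>\<^sub># X \<bullet> x = \<kappa> * (a + b)"
    using x by (simp add: v(1) inner_diff_left tA_def inner_commute algebra_simps)
  moreover have "nA X = 1 + real (size (filter_mset tA Y))" using x by (simp add: nA_def Y)
  ultimately have "\<kappa> * nA X \<le> \<kappa> * (a + b)" using norm_bounds(1)[OF xQ] by (simp add: algebra_simps)
  then have "nA X \<le> a + b" using kpos by simp
  then show ?thesis using v by linarith
qed

text \<open>Pairing the sum with a summand of type \<open>tB\<close> forces equality in
  \<open>A_count\<close>. Then a summand \<open>x\<close> of type \<open>tA\<close> and a summand
  \<open>y\<close> of type \<open>tB\<close> exhaust both estimates, so that
  \<open>x + y + \<alpha>\<close> has nonpositive squared length, although \<open>f1\<close> is
  positive on it.\<close>

lemma B_count: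
  assumes T: "typed X" and ok: "okA X" "okB X"
  shows "nB X = 0"
proof (rule ccontr)
  assume "nB X \<noteq> 0"
  moreover have "0 \<le> nB X" by (simp add: nB_def)
  ultimately have n: "0 < nB X" by linarith
  obtain y where y: "y \<in># X" "tB y" using n unfolding nB_def size_filter_pos by blast
  obtain Y where Y: "X = add_mset y Y" using y(1) by (metis insert_DiffM)
  have yQ: "y \<in> Q" "y \<in> M" using T y unfolding typed_def M_def by blast+
  obtain a b where v: "\<Sum>\<^sub># X = b *\<^sub>R \<beta> - a *\<^sub>R \<alpha>"
    "3 * a = 2 * nB X - nC X + nA X" "3 * b = 2 * nC X - nB X + nA X" using typed_sum[OF T] by metis
  have vy: "\<Sum>\<^sub># X \<bullet> y = \<kappa> * a"
    using y by (simp add: v(1) inner_diff_left tB_def inner_commute algebra_simps)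
  have nBY: "nB X = 1 + real (size (filter_mset tB Y))" using y by (simp add: nB_def Y)
  have "y \<bullet> y + \<kappa> * real (size (filter_mset tB Y)) \<le> \<Sum>\<^sub># X \<bullet> y"
    by (rule typed_inner_ge[OF Y]) (use typed_pairs[OF T Y] ok y in \<open>auto simp: okB_def\<close>)
  then have "\<kappa> * nB X \<le> \<kappa> * a" using norm_bounds(1)[OF yQ(1)] vy nBY by (simp add: algebra_simps)
  then have "nB X \<le> a" using kpos by simp
  moreover have "0 \<le> nC X" by (simp add: nC_def)
  ultimately have nA: "0 < nA X" "nB X + nC X \<le> nA X" using v n by linarith+
  then have eq: "nA X = nB X + nC X" using A_count[OF T ok(1)] by simp
  obtain x where x: "x \<in># X" "tA x" using nA unfolding nA_def size_filter_pos by blast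
  have xy: "x \<noteq> y" using x y type_distinct by blast
  then obtain Z where Z: "Y = add_mset x Z" using x(1) by (metis Y insert_DiffM insert_noteq_member)
  have X2: "X = add_mset x (add_mset y Z)" by (simp add: Y Z)
  have xQ: "x \<in> Q" "x \<in> M" using T x unfolding typed_def M_def by blast+
  have nt: "\<not> tB x" "\<not> tA y" using x y type_distinct by blast+
  have nn: "0 \<le> z \<bullet> x" "0 \<le> z \<bullet> y" "tA z \<Longrightarrow> \<kappa> \<le> z \<bullet> x" "tB z \<Longrightarrow> \<kappa> \<le> z \<bullet> y" if "z \<in># Z" for z
    using typed_pairs[OF T Y, of z] typed_pairs[OF T X2, of z] that ok x y
    by (auto simp: Z okA_def okB_def)
  have g1: "x \<bullet> x + x \<bullet> y + \<kappa> * real (size (filter_mset tA Z)) \<le> \<Sum>\<^sub># X \<bullet> x"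
    using sum_mset_filter_ge[of Z "\<lambda>z. z \<bullet> x" tA \<kappa>] nn
    by (simp add: X2 inner_add_left inner_sum_mset inner_commute[of y x])
  have g2: "y \<bullet> y + x \<bullet> y + \<kappa> * real (size (filter_mset tB Z)) \<le> \<Sum>\<^sub># X \<bullet> y"
    using sum_mset_filter_ge[of Z "\<lambda>z. z \<bullet> y" tB \<kappa>] nn
    by (simp add: X2 inner_add_left inner_sum_mset)
  have vx: "\<Sum>\<^sub># X \<bullet> x = \<kappa> * (a + b)"
    using x by (simp add: v(1) inner_diff_left tA_def inner_commute algebra_simps)
  have s: "nA X = 1 + real (size (filter_mset tA Z))" "nB X = 1 + real (size (filter_mset tB Z))"
    using x y nt by (simp_all add: X2 nA_def nB_def)
  have "a + b = nA X" "a = nB X" using v eq by linarith+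
  then have h: "x \<bullet> x + x \<bullet> y \<le> \<kappa>" "y \<bullet> y + x \<bullet> y \<le> \<kappa>"
    using g1 g2 vx vy s by (simp_all add: algebra_simps)
  have "(x + y + \<alpha>) \<bullet> (x + y + \<alpha>) = x \<bullet> x + y \<bullet> y + 2 * (x \<bullet> y) + \<alpha> \<bullet> \<alpha> + 2 * (x \<bullet> \<alpha>) + 2 * (y \<bullet> \<alpha>)"
    by (simp add: inner_add_left inner_add_right inner_commute)
  also have "\<dots> = x \<bullet> x + y \<bullet> y + 2 * (x \<bullet> y) - 2 * \<kappa>" using x y aln by (simp add: tA_def tB_def)
  also have "\<dots> \<le> 0" using h by linarith
  finally have "x + y + \<alpha> = 0" by (metis inner_eq_zero_iff inner_ge_zero order_antisym)
  then have "f1 (x + y + \<alpha>) = 0" using linear_0[OF lin1] by simp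
  then show False using xQ yQ by (simp add: M_def)
qed

section \<open>From a relation of any length to a relation of three roots\<close>

definition relation where
  "relation X \<longleftrightarrow> X \<noteq> {#} \<and> set_mset X \<subseteq> M \<and> \<Sum>\<^sub># X \<in> span {\<alpha>, \<beta>}"

text \<open>Subtracting \<alpha> keeps \<open>f1\<close> and raises \<open>f2\<close>; adding
  \<beta> keeps \<open>f2\<close> and raises \<open>f1\<close>. So a root of \<open>M\<close> with a
  product of the wrong sign can be corrected inside \<open>M\<close>.\<close>

lemma normalize_type:
  assumes "x \<in> M"
  obtains y where "y \<in> M" "y - x \<in> span {\<alpha>, \<beta>}" "y \<bullet> \<alpha> = 0 \<and> y \<bullet> \<beta> = 0 \<or> tA y \<or> tB y \<or> tC y"
proof -
  have x: "x \<in> Q" "0 < f1 x" "0 < f2 x" using assms by (auto simp: M_def)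
  note T = M_types[OF assms]
  have m: "- \<alpha> \<in> Q" using root_systemD(6)[OF rsQ] alQ by blast
  consider "x \<bullet> \<alpha> = \<kappa>" "x \<bullet> \<beta> = 0 \<or> x \<bullet> \<beta> = - \<kappa>" | "x \<bullet> \<alpha> = 0" "x \<bullet> \<beta> = - \<kappa>"
    | "x \<bullet> \<alpha> = 0 \<and> x \<bullet> \<beta> = 0 \<or> tA x \<or> tB x \<or> tC x"
    using T by (auto simp: tA_def tB_def tC_def)
  then show ?thesis
  proof cases
    case 1
    have "x \<noteq> \<alpha>" using x by auto
    then have "x + - \<alpha> \<in> Q" using root_add[OF rsQ x(1) m] 1 kpos by simp
    then have "x + - \<alpha> \<in> M" using x f2a by (simp add: M_def)
    moreover have "x + - \<alpha> - x \<in> span {\<alpha>, \<beta>}" using span_pairI[of "-1" \<alpha> 0 \<beta>] by simp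
    moreover have "tA (x + - \<alpha>) \<or> tB (x + - \<alpha>)"
      using 1 by (auto simp: tA_def tB_def inner_diff_left aln ab)
    ultimately show ?thesis using that by blast
  next
    case 2
    have "x \<noteq> - \<beta>" using x by auto
    then have "x + \<beta> \<in> Q" using root_add[OF rsQ x(1) beQ] 2 kpos by simp
    then have "x + \<beta> \<in> M" using x f1b by (simp add: M_def)
    moreover have "x + \<beta> - x \<in> span {\<alpha>, \<beta>}" using span_pairI[of 0 \<alpha> 1 \<beta>] by simp
    moreover have "tA (x + \<beta>)" using 2 by (auto simp: tA_def inner_add_left ben ab)
    ultimately show ?thesis using that by blast
  next
    case 3
    then show ?thesis using that[of x] assms span_zero by auto
  qed
qed

lemma pair_subset: "x \<in># X \<Longrightarrow> y \<in># X \<Longrightarrow> x \<noteq> y \<Longrightarrow> {#x, y#} \<subseteq># X"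
  by (metis insert_DiffM insert_noteq_member mset_subset_eq_add_mset_cancel mset_subset_eq_single)

text \<open>In a shortest relation a pair that violates \<open>okA\<close> yields the three roots by
  \<open>A_bad\<close>. If there is no such pair, the counts force a bad pair of type
  \<open>tB\<close> and one of type \<open>tC\<close>. The roots that \<open>B_bad\<close> and its
  mirror image attach to these pairs turn out to be equal, but only one of them is positive for
  \<open>f1\<close>.\<close>

theorem relation_triple:
  assumes "relation X0"
  shows "\<exists>x y z. {x, y, z} \<subseteq> M \<and> tA x \<and> tA y \<and> tA z \<and> x + y + z = \<beta> - \<alpha>"
proof (rule ccontr)
  assume no: "\<not> ?thesis"
  obtain X1 where X1: "relation X1" "\<And>Y. relation Y \<Longrightarrow> size X1 \<le> size Y"
    using ex_has_least_nat[of relation X0 size] assms by blast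
  have "\<forall>x. \<exists>y. x \<in> M \<longrightarrow> y \<in> M \<and> y - x \<in> span {\<alpha>, \<beta>} \<and> (y \<bullet> \<alpha> = 0 \<and> y \<bullet> \<beta> = 0 \<or> tA y \<or> tB y \<or> tC y)"
    using normalize_type by metis
  then obtain \<phi> where \<phi>: "\<And>x. x \<in> M \<Longrightarrow> \<phi> x \<in> M \<and> \<phi> x - x \<in> span {\<alpha>, \<beta>} \<and>
      (\<phi> x \<bullet> \<alpha> = 0 \<and> \<phi> x \<bullet> \<beta> = 0 \<or> tA (\<phi> x) \<or> tB (\<phi> x) \<or> tC (\<phi> x))" by metis
  define X where "X = image_mset \<phi> X1"
  have "set_mset Z \<subseteq> M \<Longrightarrow> \<Sum>\<^sub># (image_mset \<phi> Z) - \<Sum>\<^sub># Z \<in> span {\<alpha>, \<beta>}" for Z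
  proof (induction Z)
    case (add x Z)
    have "(\<phi> x - x) + (\<Sum>\<^sub># (image_mset \<phi> Z) - \<Sum>\<^sub># Z) \<in> span {\<alpha>, \<beta>}"
      using add \<phi> by (intro span_add) auto
    then show ?case by (simp add: algebra_simps)
  qed (simp add: span_zero)
  then have "\<Sum>\<^sub># X - \<Sum>\<^sub># X1 \<in> span {\<alpha>, \<beta>}" using X1(1) by (simp add: X_def relation_def)
  then have "(\<Sum>\<^sub># X - \<Sum>\<^sub># X1) + \<Sum>\<^sub># X1 \<in> span {\<alpha>, \<beta>}"
    using X1(1) unfolding relation_def by (intro span_add) auto
  then have X: "relation X" using X1(1) \<phi> by (auto simp: relation_def X_def)
  have min: "size X \<le> size Y" if "relation Y" for Y using X1(2)[OF that] by (simp add: X_def)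
  \<comment> \<open>Minimality in the form that is used: no two summands can be traded for one root
    of \<open>M\<close> congruent to their sum modulo the plane.\<close>
  have shrink: "x + y - z \<notin> span {\<alpha>, \<beta>}" if "{#x, y#} \<subseteq># X" "z \<in> M" for x y z
  proof
    assume s: "x + y - z \<in> span {\<alpha>, \<beta>}"
    define Y where "Y = X - {#x, y#}"
    have XY: "X = add_mset x (add_mset y Y)" using that(1) using subset_mset.add_diff_inverse[OF that(1)] by (simp add: Y_def)
    have "\<Sum>\<^sub># X - (x + y - z) \<in> span {\<alpha>, \<beta>}" by (rule span_diff) (use s X in \<open>simp_all add: relation_def\<close>)
    then have "relation (add_mset z Y)" using X that(2) by (auto simp: relation_def XY algebra_simps)
    from min[OF this] show False by (simp add: XY)
  qed
  have XM: "x \<in> M" if "x \<in># X" for x using X that by (auto simp: relation_def)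
  have pairM: "x \<in> M" "y \<in> M" if "{#x, y#} \<subseteq># X" for x y
    using mset_subset_eqD[OF that] XM by auto
  have pairs: "0 \<le> x \<bullet> y" if "{#x, y#} \<subseteq># X" for x y
  proof (rule ccontr)
    assume "\<not> ?thesis"
    then have "x + y \<in> M" using M_add pairM[OF that] by simp
    then show False using shrink[OF that, of "x + y"] span_zero by auto
  qed
  have "x \<bullet> \<alpha> = 0 \<and> x \<bullet> \<beta> = 0 \<or> tA x \<or> tB x \<or> tC x" if x: "x \<in># X" for x
  proof -
    obtain x1 where "x1 \<in># X1" "x = \<phi> x1" using x by (auto simp: X_def)
    then show ?thesis using \<phi>[of x1] X1(1) unfolding relation_def by blast
  qed
  then have T: "typed X"
    using X pairs XM unfolding typed_def relation_def by blast
  have ok: "okA X"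
    unfolding okA_def
  proof (intro allI impI, rule ccontr)
    fix x y assume a: "{#x, y#} \<subseteq># X" "tA x" "tA y" "\<not> \<kappa> \<le> x \<bullet> y"
    have "\<beta> - \<alpha> - x - y \<in> M"
      using A_bad[of x y] shrink[OF a(1)] pairM[OF a(1)] a by auto
    moreover have "tA (\<beta> - \<alpha> - x - y)"
      using a(2,3) by (simp add: tA_def inner_diff_left aln ben ab)
    moreover have "x + y + (\<beta> - \<alpha> - x - y) = \<beta> - \<alpha>" by simp
    ultimately show False using no pairM[OF a(1)] a(2,3) by blast
  qed
  interpret s: triple_core Q "- \<beta>" "- \<alpha>" \<kappa> f2 f1 by (rule swap)
  have sspan: "span {- \<beta>, - \<alpha>} = span {\<alpha>, \<beta>}"
  proof (rule span_eq[THEN iffD2], intro conjI)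
    show "{- \<beta>, - \<alpha>} \<subseteq> span {\<alpha>, \<beta>}"
      using span_pairI[of "-1" \<alpha> 0 \<beta>] span_pairI[of 0 \<alpha> "-1" \<beta>] by auto
    show "{\<alpha>, \<beta>} \<subseteq> span {- \<beta>, - \<alpha>}"
      using span_pairI[of "-1" "- \<beta>" 0 "- \<alpha>"] span_pairI[of 0 "- \<beta>" "-1" "- \<alpha>"] by auto
  qed
  have sM: "s.M = M" by (auto simp: s.M_def M_def)
  have st: "s.tA = tA" "s.tB = tC" "s.tC = tB"
    by (auto simp: fun_eq_iff s.tA_def tA_def s.tB_def tB_def s.tC_def tC_def)
  have sT: "s.typed X" using T by (auto simp: s.typed_def typed_def sM st sspan)
  have sok: "s.okA X" using ok by (simp add: s.okA_def okA_def st)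
  obtain a b where ab': "0 < a" "0 < b" "3 * a = 2 * nB X - nC X + nA X" "3 * b = 2 * nC X - nB X + nA X"
    using typed_sum[OF T] by metis
  have nn: "0 \<le> nA X" "0 \<le> nB X" "0 \<le> nC X" by (simp_all add: nA_def nB_def nC_def)
  have "\<not> okB X"
  proof
    assume "okB X"
    then have "nB X = 0" using B_count[OF T ok] by simp
    then show False using A_count[OF T ok] ab' nn by linarith
  qed
  then obtain x y where xy: "{#x, y#} \<subseteq># X" "tB x" "tB y" "x \<bullet> y < \<kappa>"
    unfolding okB_def by (auto simp: not_le)
  have "\<not> s.okB X"
  proof
    assume "s.okB X"
    then have "nC X = 0" using s.B_count[OF sT sok] by (simp add: s.nB_def nC_def st)
    then show False using A_count[OF T ok] ab' nn by linarith
  qed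
  then obtain x' y' where xy': "{#x', y'#} \<subseteq># X" "tC x'" "tC y'" "x' \<bullet> y' < \<kappa>"
    unfolding s.okB_def st by (auto simp: not_le)
  define u where "u = x + y + (\<alpha> + \<beta>)"
  define u' where "u' = x' + y' - (\<alpha> + \<beta>)"
  have u: "u \<in> Q" "0 < f1 u" "f2 u \<le> 0"
    using B_bad[of x y] shrink[OF xy(1)] pairM[OF xy(1)] xy by (auto simp: u_def)
  have e: "x' + y' + (- \<beta> + - \<alpha>) = u'" by (simp add: u'_def)
  have u': "u' \<in> Q" "0 < f2 u'" "f1 u' \<le> 0"
    using s.B_bad[of x' y', unfolded sM st sspan e] shrink[OF xy'(1)] pairM[OF xy'(1)] xy' by auto
  have el: "x \<in># X" "y \<in># X" "x' \<in># X" "y' \<in># X"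
    using mset_subset_eqD[OF xy(1)] mset_subset_eqD[OF xy'(1)] by auto
  have ne: "x \<noteq> x'" "x \<noteq> y'" "y \<noteq> x'" "y \<noteq> y'" using xy(2,3) xy'(2,3) type_distinct(2) by metis+
  have c: "0 \<le> x \<bullet> x'" "0 \<le> x \<bullet> y'" "0 \<le> y \<bullet> x'" "0 \<le> y \<bullet> y'"
    using pairs[OF pair_subset[OF el(1) el(3) ne(1)]] pairs[OF pair_subset[OF el(1) el(4) ne(2)]]
      pairs[OF pair_subset[OF el(2) el(3) ne(3)]] pairs[OF pair_subset[OF el(2) el(4) ne(4)]] by simp_all
  have i: "x \<bullet> \<alpha> = - \<kappa>" "y \<bullet> \<alpha> = - \<kappa>" "x \<bullet> \<beta> = 0" "y \<bullet> \<beta> = 0"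
    "\<alpha> \<bullet> x' = 0" "\<alpha> \<bullet> y' = 0" "\<beta> \<bullet> x' = \<kappa>" "\<beta> \<bullet> y' = \<kappa>"
    using xy xy' by (auto simp: tB_def tC_def inner_commute)
  \<comment> \<open>The terms with \<open>\<alpha> + \<beta>\<close> contribute
    \<open>2 * \<kappa>\<close> and the four mixed products are nonnegative, while no root has
    squared length above \<open>2 * \<kappa>\<close>. Hence \<open>u = u'\<close>.\<close>
  have "u \<bullet> u' = x \<bullet> x' + x \<bullet> y' + y \<bullet> x' + y \<bullet> y' + 2 * \<kappa>"
    unfolding u_def u'_def inner_add_left inner_add_right inner_diff_right i aln ben ab by simp
  then have "2 * \<kappa> \<le> u \<bullet> u'" using c by linarith
  moreover have "(u - u') \<bullet> (u - u') = u \<bullet> u + u' \<bullet> u' - 2 * (u \<bullet> u')"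
    by (simp add: inner_diff_left inner_diff_right inner_commute)
  ultimately have "(u - u') \<bullet> (u - u') \<le> 0"
    using norm_bounds(2)[OF u(1)] norm_bounds(2)[OF u'(1)] by linarith
  then have "u - u' = 0" by (metis inner_eq_zero_iff inner_ge_zero order_antisym)
  then show False using u(2) u'(3) by simp
qed

section \<open>The alternative between a separating point and an integral relation\<close>

lemma sum_mset_replicate:
  fixes n :: nat
  shows "\<Sum>\<^sub># (\<Sum>i<n. replicate_mset (k i) (e i)) = (\<Sum>i<n. real (k i) *\<^sub>R (e i :: 'a))"
proof (induction n)
  case (Suc n)
  have "\<Sum>\<^sub># (replicate_mset m x) = real m *\<^sub>R x" for m and x :: 'a
    by (induction m) (auto simp: scaleR_left_distrib)
  then show ?case using Suc by simp
qed simp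

text \<open>Simultaneous Diophantine approximation turns a real relation into an integral one: the
  coordinates of the relation modulo the plane are integers of absolute value less than 1.\<close>

lemma separation_or_relation:
  "(\<exists>x. x \<bullet> \<alpha> = 0 \<and> x \<bullet> \<beta> = 0 \<and> (\<forall>d\<in>M. 0 < x \<bullet> d)) \<or> (\<exists>X. relation X)"
proof -
  have finQ: "finite Q" and finM: "finite M" using root_systemD(1)[OF rsQ] by (auto simp: M_def)
  \<comment> \<open>\<open>3 * \<kappa>\<close> times the projection to the orthogonal complement of
    the plane; the factor clears the denominators of the inverse Gram matrix.\<close>
  define p where "p y = (3 * \<kappa>) *\<^sub>R y - ((2 * (y \<bullet> \<alpha>) + y \<bullet> \<beta>) *\<^sub>R \<alpha> + (y \<bullet> \<alpha> + 2 * (y \<bullet> \<beta>)) *\<^sub>R \<beta>)" for y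
  have lp: "linear p" by (rule linearI) (simp_all add: p_def inner_add_left algebra_simps)
  have pp: "p y \<bullet> \<alpha> = 0" "p y \<bullet> \<beta> = 0" for y
    unfolding p_def inner_diff_left inner_add_left inner_scaleR_left aln ben ab by algebra+
  have ortho: "x \<bullet> p y = 3 * \<kappa> * (x \<bullet> y)" if "x \<bullet> \<alpha> = 0" "x \<bullet> \<beta> = 0" for x y
    by (simp add: p_def inner_diff_right inner_add_right that)
  define K where "K = convex hull (p ` M)"
  have K: "convex K" "compact K" using finM by (simp_all add: K_def finite_imp_compact_convex_hull)
  have Kp: "K = p ` (convex hull M)" by (simp add: K_def convex_hull_linear_image[OF lp])
  show ?thesis
  proof (cases "0 \<in> K")
    case False
    show ?thesis
    proof (cases "M = {}")
      case True
      then show ?thesis by (intro disjI1 exI[of _ 0]) auto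
    next
      case ne: False
      then have Kne: "K \<noteq> {}" by (simp add: K_def)
      \<comment> \<open>The point of the hull nearest to 0 has positive product with all of
        \<open>K\<close>, and as a point of \<open>K\<close> it is already orthogonal to the
        plane.\<close>
      define x where "x = closest_point K 0"
      have x: "x \<in> K" "\<And>y. y \<in> K \<Longrightarrow> dist 0 x \<le> dist 0 y"
        using closest_point_exists[OF compact_imp_closed[OF K(2)] Kne, of 0] by (auto simp: x_def)
      have "x \<noteq> 0" using x(1) False by auto
      have xo: "x \<bullet> \<alpha> = 0" "x \<bullet> \<beta> = 0" using x(1) pp unfolding Kp by auto
      have "0 < x \<bullet> d" if "d \<in> M" for d
      proof -
        have "p d \<in> K" using that hull_subset[of "p ` M" convex] by (auto simp: K_def)
        then have "(0 - x) \<bullet> (p d - x) \<le> 0"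
          using any_closest_point_dot[OF K(1) compact_imp_closed[OF K(2)] x(1)] x(2) by blast
        then have "x \<bullet> x \<le> x \<bullet> p d" by (simp add: inner_diff_right)
        moreover have "0 < x \<bullet> x" using \<open>x \<noteq> 0\<close> by simp
        ultimately have "0 < x \<bullet> p d" by linarith
        then have "0 < 3 * \<kappa> * (x \<bullet> d)" unfolding ortho[OF xo] .
        then show ?thesis using kpos by (simp add: zero_less_mult_iff)
      qed
      then show ?thesis using xo by blast
    qed
  next
    case True
    then obtain y0 where y0: "y0 \<in> convex hull M" "p y0 = 0" unfolding Kp by auto
    then obtain u where u: "\<And>d. d \<in> M \<Longrightarrow> 0 \<le> u d" "sum u M = 1" "(\<Sum>d\<in>M. u d *\<^sub>R d) = y0"
      unfolding convex_hull_finite[OF finM] by auto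
    obtain e where e: "bij_betw e {..<card M} M" using ex_bij_betw_nat_finite[OF finM] by (auto simp: lessThan_atLeast0)
    define n where "n = card M"
    define \<theta> where "\<theta> i = u (e i)" for i
    have eM: "e i \<in> M" if "i < n" for i using e that by (auto simp: bij_betw_def n_def)
    have th: "0 \<le> \<theta> i" if "i < n" for i using u(1)[OF eM[OF that]] by (simp add: \<theta>_def)
    have sum1: "(\<Sum>i<n. \<theta> i) = 1"
      using sum.reindex_bij_betw[OF e, of u] u(2) by (simp add: \<theta>_def n_def)
    have sumy: "(\<Sum>i<n. \<theta> i *\<^sub>R e i) = y0"
      using sum.reindex_bij_betw[OF e, of "\<lambda>d. u d *\<^sub>R d"] u(3) by (simp add: \<theta>_def n_def)
    define c where "c = (cartan_number :: 'a \<Rightarrow> 'a \<Rightarrow> real)"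
    \<comment> \<open>A Cartan number of the projected vector, scaled so as to be an integral
      polynomial in Cartan numbers of roots. So a value of absolute value below 1 must
      vanish.\<close>
    define Z where "Z x y = 2 * (p x \<bullet> y) / (\<kappa> * (y \<bullet> y))" for x y
    have Zlin: "linear (\<lambda>x. Z x y)" for y
      by (rule linearI) (simp_all add: Z_def linear_add[OF lp] linear_scale[OF lp] inner_add_left add_divide_distrib algebra_simps)
    have Zint: "Z x y \<in> \<int>" if "x \<in> Q" "y \<in> Q" for x y
    proof -
      have I: "c v w \<in> \<int>" if "v \<in> Q" "w \<in> Q" for v w using root_systemD(4)[OF rsQ] that by (simp add: c_def)
      have ca: "c x \<alpha> = (x \<bullet> \<alpha>) / \<kappa>" "c x \<beta> = (x \<bullet> \<beta>) / \<kappa>" by (simp_all add: c_def cartan_number_def aln ben)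
      have yy: "y \<bullet> y \<noteq> 0" using that root_systemD(2)[OF rsQ] by auto
      have "Z x y = 3 * c x y - ((2 * c x \<alpha> + c x \<beta>) * c \<alpha> y + (c x \<alpha> + 2 * c x \<beta>) * c \<beta> y)"
        using kpos yy unfolding ca by (simp add: Z_def p_def c_def cartan_number_def inner_diff_left inner_add_left field_simps)
      also have "\<dots> \<in> \<int>" using I that alQ beQ by (intro Ints_diff Ints_add Ints_mult) auto
      finally show ?thesis .
    qed
    define B where "B = (\<Sum>y\<in>Q. \<Sum>i<n. \<bar>Z (e i) y\<bar>)"
    obtain N where N: "real N > B" using reals_Archimedean2 by blast
    \<comment> \<open>The summand \<open>N\<close> makes the error in every \<open>Z\<close> smaller
      than 1. The summand \<open>n\<close> ensures that some \<open>k i\<close> is nonzero: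
      otherwise \<open>q\<close> would be a sum of \<open>n\<close> errors, hence below 1.\<close>
    define N' where "N' = N + n + 1"
    have B0: "0 \<le> B" by (simp add: B_def sum_nonneg)
    have N'pos: "0 < N'" by (simp add: N'_def)
    obtain q k where qk: "0 < q" "\<And>i. i < n \<Longrightarrow> \<bar>of_int q * \<theta> i - of_int (k i)\<bar> < 1 / real N'"
      using Dirichlet_approx_simult[OF N'pos, of n \<theta>] by metis
    have inv_le: "1 / real N' \<le> 1" using N'pos by (simp add: divide_le_eq)
    have k0: "0 \<le> k i" if "i < n" for i
    proof -
      have "0 \<le> of_int q * \<theta> i" using qk(1) th[OF that] by simp
      then have "- 1 < real_of_int (k i)" using qk(2)[OF that] inv_le by linarith
      then show ?thesis by linarith
    qed
    have "\<exists>i<n. 0 < k i"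
    proof (rule ccontr)
      assume "\<not> ?thesis"
      then have z: "k i = 0" if "i < n" for i using k0[OF that] that by force
      have "of_int q * 1 = (\<Sum>i<n. of_int q * \<theta> i)" by (simp add: sum1 flip: sum_distrib_left)
      also have "\<dots> \<le> (\<Sum>i<n. 1 / real N')" using qk(2) z by (intro sum_mono) force
      also have "\<dots> = real n / real N'" by simp
      also have "\<dots> < 1" using N'pos by (simp add: N'_def)
      finally show False using qk(1) by simp
    qed
    then obtain i0 where i0: "i0 < n" "0 < k i0" by blast
    define v where "v = (\<Sum>i<n. of_int (k i) *\<^sub>R e i)"
    have Zv: "Z v y = 0" if y: "y \<in> Q" for y
    proof -
      have s1: "Z v y = (\<Sum>i<n. of_int (k i) * Z (e i) y)"
        unfolding v_def by (simp add: linear_sum[OF Zlin] linear_scale[OF Zlin])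
      have "Z y0 y = (\<Sum>i<n. \<theta> i * Z (e i) y)"
        unfolding sumy[symmetric] by (simp add: linear_sum[OF Zlin] linear_scale[OF Zlin])
      moreover have "Z y0 y = 0" by (simp add: Z_def y0)
      ultimately have s2: "(\<Sum>i<n. of_int q * \<theta> i * Z (e i) y) = 0"
        by (simp add: mult.assoc flip: sum_distrib_left)
      have "\<bar>Z v y\<bar> = \<bar>\<Sum>i<n. (of_int q * \<theta> i - of_int (k i)) * Z (e i) y\<bar>"
        unfolding left_diff_distrib sum_subtractf s1 s2 by simp
      also have "\<dots> \<le> (\<Sum>i<n. (1 / real N') * \<bar>Z (e i) y\<bar>)"
        unfolding abs_mult using qk(2)
        by (intro order_trans[OF sum_abs] sum_mono) (simp only: abs_mult lessThan_iff, rule mult_right_mono, simp_all add: less_imp_le)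
      also have "\<dots> = (\<Sum>i<n. \<bar>Z (e i) y\<bar>) / real N'" by (simp add: sum_distrib_left[symmetric] sum_divide_distrib)
      also have "\<dots> \<le> B / real N'"
        unfolding B_def using y finQ by (intro divide_right_mono member_le_sum) (auto intro: sum_nonneg)
      also have "\<dots> < 1" using N N'pos by (simp add: N'_def)
      finally have "\<bar>Z v y\<bar> < 1" .
      moreover have "Z v y \<in> \<int>" unfolding s1
        using Zint eM y by (intro Ints_sum Ints_mult) (auto simp: M_def)
      ultimately show ?thesis using Ints_nonzero_abs_ge1 by force
    qed
    have "p v = 0"
    proof -
      have zy: "p v \<bullet> y = 0" if "y \<in> Q" for y
        using Zv[OF that] kpos that root_systemD(2)[OF rsQ] by (auto simp: Z_def)
      have "e i \<in> span Q" if "i < n" for i using eM[OF that] by (auto simp: M_def intro: span_base)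
      then have "v \<in> span Q" unfolding v_def by (intro span_sum span_scale) auto
      then have "p v \<in> span Q" unfolding p_def using alQ beQ
        by (intro span_diff span_add span_scale) (auto intro: span_base)
      moreover have "orthogonal (p v) w" if "w \<in> span Q" for w
        by (rule orthogonal_to_span[OF that]) (use zy in \<open>auto simp: orthogonal_def\<close>)
      ultimately have "orthogonal (p v) (p v)" by blast
      then show ?thesis by (simp add: orthogonal_self)
    qed
    then have "(3 * \<kappa>) *\<^sub>R v = (2 * (v \<bullet> \<alpha>) + v \<bullet> \<beta>) *\<^sub>R \<alpha> + (v \<bullet> \<alpha> + 2 * (v \<bullet> \<beta>)) *\<^sub>R \<beta>"
      by (simp add: p_def)
    then have "(3 * \<kappa>) *\<^sub>R v \<in> span {\<alpha>, \<beta>}" using span_pairI by metis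
    then have "(1 / (3 * \<kappa>)) *\<^sub>R (3 * \<kappa>) *\<^sub>R v \<in> span {\<alpha>, \<beta>}" by (rule span_scale)
    then have vs: "v \<in> span {\<alpha>, \<beta>}" using kpos by simp
    define X where "X = (\<Sum>i<n. replicate_mset (nat (k i)) (e i))"
    have "\<Sum>\<^sub># X = v"
      unfolding X_def sum_mset_replicate v_def using k0 by (intro sum.cong) auto
    moreover have "set_mset X = {e i |i. i < n \<and> 0 < nat (k i)}"
      by (auto simp: X_def set_mset_sum split: if_splits)
    moreover from this have "e i0 \<in># X" using i0 by auto
    ultimately have "relation X" using vs eM by (auto simp: relation_def)
    then show ?thesis by blast
  qed
qed

end

section \<open>Gatherability and separation\<close>

text \<open>The threshold for perturbations: on a finite set a large multiple of \<open>f\<close>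
  dominates \<open>h\<close> wherever \<open>f\<close> is positive.\<close>

lemma big_const:
  fixes f h :: "'b \<Rightarrow> real"
  assumes "finite D"
  shows "\<exists>C. \<forall>d\<in>D. 0 < f d \<longrightarrow> h d < C * f d"
proof -
  define C where "C = Max (insert 0 ((\<lambda>d. h d / f d) ` D)) + 1"
  have "h d < C * f d" if "d \<in> D" "0 < f d" for d
  proof -
    have "h d / f d \<le> Max (insert 0 ((\<lambda>d. h d / f d) ` D))"
      using assms that by (intro Max_ge) auto
    then have "h d / f d < C" by (simp add: C_def)
    then show ?thesis using that by (simp add: divide_less_eq)
  qed
  then show ?thesis by blast
qed

text \<open>The component \<open>z\<close> of \<open>d\<close> orthogonal to the plane is nonzero,
  and of the points \<open>y + t z\<close> only finitely many are orthogonal to a given one of the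
  vectors not orthogonal to \<open>z\<close>.\<close>

lemma generic_orthogonal:
  fixes a b :: "'a::euclidean_space"
  assumes "finite D" "\<And>d. d \<in> D \<Longrightarrow> d \<notin> span {a, b}"
  shows "\<exists>y. y \<bullet> a = 0 \<and> y \<bullet> b = 0 \<and> (\<forall>d\<in>D. y \<bullet> d \<noteq> 0)"
  using assms
proof (induction D)
  case empty
  show ?case by (intro exI[of _ 0]) simp
next
  case (insert d D)
  then obtain y where y: "y \<bullet> a = 0" "y \<bullet> b = 0" "\<And>e. e \<in> D \<Longrightarrow> y \<bullet> e \<noteq> 0" by auto
  obtain s z where z: "s \<in> span {a, b}" "\<And>w. w \<in> span {a, b} \<Longrightarrow> orthogonal z w" "d = s + z"
    using orthogonal_subspace_decomp_exists[of "{a, b}" d] by blast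
  have za: "z \<bullet> a = 0" "z \<bullet> b = 0" "z \<bullet> s = 0"
    using z(1,2) span_base[of a "{a, b}"] span_base[of b "{a, b}"] by (auto simp: orthogonal_def)
  have "z \<noteq> 0" using z insert.prems by auto
  then have zd: "z \<bullet> d \<noteq> 0" by (simp add: z(3) inner_add_right za)
  have "infinite (UNIV :: real set)" by (rule infinite_UNIV_char_0)
  then obtain t where t: "t \<notin> insert 0 ((\<lambda>e. - (y \<bullet> e) / (z \<bullet> e)) ` insert d D)"
    using insert.hyps(1) by (metis ex_new_if_finite finite_imageI finite_insert)
  have "(y + t *\<^sub>R z) \<bullet> e \<noteq> 0" if e: "e \<in> insert d D" for e
  proof (cases "z \<bullet> e = 0")
    case True
    then show ?thesis using e zd y(3) by (auto simp: inner_add_left)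
  next
    case False
    have "t \<noteq> - (y \<bullet> e) / (z \<bullet> e)" using t e by blast
    then show ?thesis using False by (auto simp: inner_add_left field_simps add_eq_0_iff)
  qed
  then show ?case using y za by (intro exI[of _ "y + t *\<^sub>R z"]) (auto simp: inner_add_left)
qed

text \<open>A large multiple of \<open>x\<close> plus a generic point of the orthogonal complement:
  the multiple keeps \<open>M\<close> positive, and the generic point decides the vectors orthogonal
  to \<open>x\<close>.\<close>

lemma generic_separation:
  fixes a b :: "'a::euclidean_space"
  assumes D: "finite D" "\<And>d. d \<in> D \<Longrightarrow> - d \<in> D" and M: "M \<subseteq> D"
    and x: "x \<bullet> a = 0" "x \<bullet> b = 0" "\<And>d. d \<in> M \<Longrightarrow> 0 < x \<bullet> d"
  shows "\<exists>y. y \<bullet> a = 0 \<and> y \<bullet> b = 0 \<and> (\<forall>d\<in>M. 0 < y \<bullet> d) \<and> (\<forall>d\<in>D - span {a, b}. y \<bullet> d \<noteq> 0)"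
proof -
  obtain y where y: "y \<bullet> a = 0" "y \<bullet> b = 0" "\<And>d. d \<in> D - span {a, b} \<Longrightarrow> y \<bullet> d \<noteq> 0"
    using generic_orthogonal[of "D - span {a, b}" a b] D by auto
  obtain C where C: "\<And>d. d \<in> D \<Longrightarrow> 0 < x \<bullet> d \<Longrightarrow> - (y \<bullet> d) < C * (x \<bullet> d)"
    using big_const[OF D(1), of "\<lambda>d. x \<bullet> d" "\<lambda>d. - (y \<bullet> d)"] by blast
  define w where "w = C *\<^sub>R x + y"
  have w: "w \<bullet> d = C * (x \<bullet> d) + y \<bullet> d" for d by (simp add: w_def inner_add_left)
  have "w \<bullet> d \<noteq> 0" if "d \<in> D - span {a, b}" for d
  proof -
    consider "x \<bullet> d = 0" | "0 < x \<bullet> d" | "0 < x \<bullet> (- d)" by (auto simp: not_less) linarith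
    then show ?thesis
    proof cases
      case 1 then show ?thesis using w y that by simp
    next
      case 2 then show ?thesis using w C[of d] that by auto
    next
      case 3 then show ?thesis using w C[of "- d"] D(2) that by auto
    qed
  qed
  moreover have "0 < w \<bullet> d" if "d \<in> M" for d using C[of d] x(3)[of d] that M w by force
  ultimately show ?thesis using x y w by (intro exI[of _ w]) auto
qed

section \<open>Chambers with both outer roots as walls\<close>

context based_roots
begin

text \<open>After a generic perturbation \<open>x0\<close> lies inside a face of codimension two, on
  which only \<alpha>, \<beta>, their sum and their negatives vanish. The chamber at this face where
  \<alpha> and \<beta> are positive is reached by a word \<open>us\<close> without inversions
  outside the segment. Going around the face lists the triple consecutively, the weak order leads on
  to the end of the segment, and the word property turns the result into moves.\<close>

lemma gatherable_if_separated:
  assumes ws: "red ws" "Suc q \<le> length ws"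
    and \<kappa>: "0 < \<kappa>" "\<alpha> \<bullet> \<alpha> = 2 * \<kappa>" "\<beta> \<bullet> \<beta> = 2 * \<kappa>" "\<alpha> \<bullet> \<beta> = - \<kappa>"
    and plane: "\<And>z. z \<in> R \<Longrightarrow> z \<in> span {\<alpha>, \<beta>} \<Longrightarrow> z \<in> {\<alpha>, - \<alpha>, \<beta>, - \<beta>, \<alpha> + \<beta>, - (\<alpha> + \<beta>)}"
    and mem: "\<alpha> \<in> inv (take (Suc q) ws)" "\<beta> \<in> inv (take (Suc q) ws)" "\<alpha> + \<beta> \<in> inv (take (Suc q) ws)"
    and x0: "x0 \<bullet> \<alpha> = 0" "x0 \<bullet> \<beta> = 0" "\<And>d. d \<in> P - inv (take (Suc q) ws) \<Longrightarrow> 0 < x0 \<bullet> d"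
  shows "gatherable_inside \<Delta> ws 0 q {\<alpha>, \<beta>, \<alpha> + \<beta>}"
proof -
  define ts where "ts = take (Suc q) ws"
  have ts: "red ts" "set ts \<subseteq> \<Delta>" using red_take[OF ws(1)] red_set by (auto simp: ts_def)
  have memP: "\<alpha> \<in> P" "\<beta> \<in> P" "\<alpha> + \<beta> \<in> P" using mem by (auto simp: lambda_set_def)
  obtain y where y: "y \<bullet> \<alpha> = 0" "y \<bullet> \<beta> = 0" "\<And>d. d \<in> P - inv ts \<Longrightarrow> 0 < y \<bullet> d"
    "\<And>d. d \<in> R \<Longrightarrow> d \<notin> span {\<alpha>, \<beta>} \<Longrightarrow> y \<bullet> d \<noteq> 0"
    using generic_separation[OF root_finite root_minus, of "P - inv ts" x0 \<alpha> \<beta>] x0 pos_root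
    unfolding ts_def by blast
  have plane0: "z \<in> {\<alpha>, - \<alpha>, \<beta>, - \<beta>, \<alpha> + \<beta>, - (\<alpha> + \<beta>)}" if "z \<in> R" "y \<bullet> z = 0" for z
    using plane y(4) that by blast
  obtain K where K: "\<And>d. d \<in> R \<Longrightarrow> 0 < y \<bullet> d \<Longrightarrow> \<bar>ht d\<bar> < K * (y \<bullet> d)"
    using big_const[OF root_finite, of "\<lambda>d. y \<bullet> d" "\<lambda>d. \<bar>ht d\<bar>"] by blast
  \<comment> \<open>A point close to the face: \<open>y\<close> decides the roots off the plane, and
    the height breaks the tie in favour of \<alpha>, \<beta> and their sum.\<close>
  define g where "g z = K * (y \<bullet> z) + ht z" for z
  have lin_g: "linear g" by (rule linearI) (simp_all add: g_def inner_add_right algebra_simps)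
  have gpos: "0 < g d" if "d \<in> R" "0 < y \<bullet> d" for d using K[OF that] by (auto simp: g_def)
  have gneg: "g d < 0" if "d \<in> R" "y \<bullet> d < 0" for d
    using gpos[OF root_minus[OF that(1)]] that linear_neg[OF lin_g] by simp
  have ht_memb: "0 < ht \<alpha>" "0 < ht \<beta>" using memP ht_pos[of \<alpha>] ht_pos[of \<beta>] by auto
  have g0: "0 < g z \<and> z \<in> {\<alpha>, \<beta>, \<alpha> + \<beta>} \<or> g z < 0 \<and> - z \<in> {\<alpha>, \<beta>, \<alpha> + \<beta>}" if "z \<in> R" "y \<bullet> z = 0" for z
    using plane0[OF that] ht_memb that(2) y by (auto simp: g_def)
  have gnz: "g z \<noteq> 0" if "z \<in> R" for z
    using gpos[OF that] gneg[OF that] g0[OF that] by (metis less_irrefl linorder_neqE_linordered_idom)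
  obtain us where us: "red us" "inv us = {z \<in> P. g z < 0}"
    using red_extend[OF lin_g gnz, of "[]"] by auto
  note usD = red_set[OF us(1)]
  have sub: "inv us \<subseteq> inv ts"
  proof
    fix z assume z: "z \<in> inv us"
    then have zP: "z \<in> P" "g z < 0" using us(2) by auto
    show "z \<in> inv ts"
    proof (rule ccontr)
      assume "z \<notin> inv ts"
      then have "0 < g z" using gpos[OF pos_root] y(3) zP by blast
      then show False using zP by simp
    qed
  qed
  \<comment> \<open>Normalised to be 1 at \<alpha> and \<beta> and 2 at their sum. With a large
    multiple of \<open>y\<close> added, it is at least 1 on all roots positive for \<open>g\<close>,
    as \<open>base_by_functional\<close> requires for showing that the images of \<alpha> and
    \<beta> are simple.\<close>
  define l where "l z = (z \<bullet> (\<alpha> + \<beta>)) / \<kappa>" for z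
  have ll: "l \<alpha> = 1" "l \<beta> = 1" "l (\<alpha> + \<beta>) = 2"
    using \<kappa> by (simp_all add: l_def inner_add_left inner_add_right inner_commute)
  obtain C where C: "\<And>d. d \<in> R \<Longrightarrow> 0 < y \<bullet> d \<Longrightarrow> 1 - l d < C * (y \<bullet> d)"
    using big_const[OF root_finite, of "\<lambda>d. y \<bullet> d" "\<lambda>d. 1 - l d"] by blast
  have simple: "word_map us z \<in> \<Delta>" if z: "z \<in> {\<alpha>, \<beta>}" for z
  proof -
    have zP: "z \<in> P" "y \<bullet> z = 0" "l z = 1" using z memP y ll by auto
    have "0 < g z" using zP ht_pos[of z] by (simp add: g_def)
    then have "z \<notin> inv us" using us(2) by simp
    then have uz: "word_map us z \<in> P" using mem_inv[OF usD] zP by simp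
    define h where "h v = C * (y \<bullet> word_map (rev us) v) + l (word_map (rev us) v)" for v
    have "linear h"
      by (rule linearI) (simp_all add: h_def l_def inner_add_right inner_add_left add_divide_distrib algebra_simps)
    moreover have "1 \<le> h e" if e: "e \<in> \<Delta>" for e
    proof -
      define v where "v = word_map (rev us) e"
      have v: "v \<in> R" "word_map us v = e" using word_map_rev_root[OF usD] e base_sub by (auto simp: v_def)
      have "0 < g v"
      proof (rule ccontr)
        assume "\<not> 0 < g v"
        then have gv: "g v < 0" using gnz[OF v(1)] by simp
        show False
        proof (cases "v \<in> P")
          case True
          then show False using us(2) mem_inv[OF usD, of v] gv v base_pos[OF e] by auto
        next
          case False
          then have "- v \<in> P" "g (- v) > 0" using neg_iff v gv linear_neg[OF lin_g] by auto
          then have "word_map us (- v) \<in> P" using us(2) mem_inv[OF usD, of "- v"] by auto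
          then show False using v pos_not_neg[OF base_pos[OF e]] by simp
        qed
      qed
      then have "0 < y \<bullet> v \<or> (y \<bullet> v = 0 \<and> v \<in> {\<alpha>, \<beta>, \<alpha> + \<beta>})"
        using gneg[OF v(1)] g0[OF v(1)] by (metis less_asym linorder_neqE_linordered_idom)
      then show ?thesis
      proof
        assume "0 < y \<bullet> v"
        then show ?thesis using C[OF v(1)] by (simp add: h_def v_def)
      next
        assume "y \<bullet> v = 0 \<and> v \<in> {\<alpha>, \<beta>, \<alpha> + \<beta>}"
        then have "y \<bullet> v = 0" "1 \<le> l v" using ll by auto
        then show ?thesis by (simp add: h_def v_def)
      qed
    qed
    moreover have "h (word_map us z) \<le> 1" by (simp add: h_def zP)
    ultimately show ?thesis using base_by_functional[OF uz] by blast
  qed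
  define a b where "a = word_map us \<alpha>" and "b = word_map us \<beta>"
  have abD: "a \<in> \<Delta>" "b \<in> \<Delta>" using simple by (auto simp: a_def b_def)
  have ra: "reflect a b = a + b" "reflect b a = a + b"
    using \<kappa> by (simp_all add: reflect_def a_def b_def inner_commute)
  have inva: "word_map (rev us) a = \<alpha>" "word_map (rev us) b = \<beta>" by (simp_all add: a_def b_def)
  \<comment> \<open>The braid word of the face: its last three letters cross \<alpha>,
    \<open>\<alpha> + \<beta>\<close> and \<beta>.\<close>
  define as where "as = us @ [a, b, a]"
  have r1: "red (us @ [a])" using us(1) abD memP inva by (simp add: red_snoc)
  have r2: "red ((us @ [a]) @ [b])" using r1 abD memP inva ra by (simp add: red_snoc[of "us @ [a]"] del: append_assoc)
  have r3: "red (((us @ [a]) @ [b]) @ [a])"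
    using r2 abD memP inva ra by (simp add: red_snoc[of "(us @ [a]) @ [b]"] del: append_assoc)
  have as: "red as" using r3 by (simp add: as_def)
  have lam: "lambda_seq as = lambda_seq us @ [\<alpha>, \<alpha> + \<beta>, \<beta>]"
  proof -
    have "as = ((us @ [a]) @ [b]) @ [a]" by (simp add: as_def)
    then show ?thesis using inva ra by (simp only: lambda_seq_snoc) simp
  qed
  have "inv as \<subseteq> inv ts"
    using lam red_lambda[OF as] red_lambda[OF us(1)] sub mem by (auto simp: ts_def)
  then obtain zs where zs: "red (as @ zs)" "word_map (as @ zs) = word_map ts"
    using red_extend_word[OF as ts(2)] by blast
  have len: "length ts = Suc q" using ws by (simp add: ts_def)
  have "(coxeter_move \<Delta> 0 (Suc q))\<^sup>*\<^sup>* ts (as @ zs)"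
    using word_property[OF ts(1) zs(1)] zs(2) len by simp
  then have moves: "(coxeter_move \<Delta> 0 (Suc q))\<^sup>*\<^sup>* ws ((as @ zs) @ drop (Suc q) ws)"
    using coxeter_moves_append[of \<Delta> "Suc q" ts "as @ zs" "drop (Suc q) ws"] by (simp add: ts_def)
  define vs where "vs = as @ zs @ drop (Suc q) ws"
  have "take (length as) (lambda_seq vs) = lambda_seq as"
    by (simp add: take_lambda_seq vs_def)
  then have "take 3 (drop (length us) (lambda_seq vs)) = [\<alpha>, \<alpha> + \<beta>, \<beta>]"
    using drop_take[of "length us" "length as" "lambda_seq vs"] lam by (simp add: as_def)
  then have "set (segment (length us) (length us + 2) (lambda_seq vs)) = {\<alpha>, \<beta>, \<alpha> + \<beta>}"
    by (auto simp: segment_def numeral_3_eq_3)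
  moreover have "length us + 2 < length vs" by (simp add: vs_def as_def)
  ultimately show ?thesis using moves unfolding gatherable_inside_def
    by (intro exI[of _ vs] exI[of _ "length us"]) (simp add: vs_def)
qed

text \<open>Just before the gathered triple is crossed, \<alpha> and \<beta> are walls of the
  current chamber. The coordinate along the image of \<alpha> is then nonnegative on all positive
  roots not yet crossed, in particular on those outside the segment, but negative at
  \<open>\<beta> - \<alpha>\<close>.\<close>

lemma no_relation_if_gatherable:
  assumes ws: "red ws" "Suc q \<le> length ws"
    and \<kappa>: "0 < \<kappa>" "\<alpha> \<bullet> \<alpha> = 2 * \<kappa>" "\<beta> \<bullet> \<beta> = 2 * \<kappa>" "\<alpha> \<bullet> \<beta> = - \<kappa>"
    and mem: "\<alpha> \<in> inv (take (Suc q) ws)" "\<beta> \<in> inv (take (Suc q) ws)" "\<alpha> + \<beta> \<in> inv (take (Suc q) ws)"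
    and gath: "gatherable_inside \<Delta> ws 0 q {\<alpha>, \<beta>, \<alpha> + \<beta>}"
  obtains f :: "'a \<Rightarrow> real" where "linear f" "f (\<beta> - \<alpha>) < 0"
    "\<And>d. d \<in> P - inv (take (Suc q) ws) \<Longrightarrow> 0 \<le> f d"
proof -
  obtain vs k where vs: "(coxeter_move \<Delta> 0 (Suc q))\<^sup>*\<^sup>* ws vs" "k + 2 < length vs"
    "set (segment k (k + 2) (lambda_seq vs)) = {\<alpha>, \<beta>, \<alpha> + \<beta>}"
    using gath unfolding gatherable_inside_def by blast
  note I = coxeter_moves_invariants[OF vs(1) red_set[OF ws(1)]]
  have redv: "red vs" using red_same_map[OF ws(1)] I by blast
  define L where "L = lambda_seq vs"
  have distL: "distinct L" and lenL: "length L = length vs" using red_distinct[OF redv] by (simp_all add: L_def)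
  have redt: "red (take n vs)" for n using red_take[OF redv] .
  have invt: "inv (take n vs) = set (take n L)" for n
    using red_lambda[OF redt] by (simp add: L_def take_lambda_seq)
  have invq: "inv (take (Suc q) vs) = inv (take (Suc q) ws)" using I by simp
  have seg: "segment k (k + 2) L = [L ! k, L ! (k + 1), L ! (k + 2)]"
  proof (rule nth_equalityI)
    show "length (segment k (k + 2) L) = length [L ! k, L ! (k + 1), L ! (k + 2)]"
      using vs(2) lenL by (simp add: segment_def)
    fix i assume "i < length (segment k (k + 2) L)"
    then have i: "i < 3" "i \<in> {0, 1, 2}" by (auto simp: segment_def)
    then show "segment k (k + 2) L ! i = [L ! k, L ! (k + 1), L ! (k + 2)] ! i"
      using vs(2) lenL by (auto simp: segment_def)
  qed
  then have three: "{L ! k, L ! (k + 1), L ! (k + 2)} = {\<alpha>, \<beta>, \<alpha> + \<beta>}"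
    using vs(3) by (simp add: L_def)
  have memP: "\<alpha> \<in> P" "\<beta> \<in> P" "\<alpha> + \<beta> \<in> P" using mem by (auto simp: lambda_set_def)
  have dist3: "\<alpha> \<noteq> \<beta>" "\<alpha> + \<beta> \<noteq> \<alpha>" "\<alpha> + \<beta> \<noteq> \<beta>" using \<kappa> by auto
  have idx: "L ! i \<in> set (take n L) \<longleftrightarrow> i < n" if "i < length L" for i n
    using distL that by (auto simp: in_set_conv_nth nth_eq_iff_index_eq)
  have kq: "k < Suc q"
  proof -
    have "L ! k \<in> set (take (Suc q) L)" using three mem invt[of "Suc q"] invq by auto
    then show ?thesis using idx[of k "Suc q"] vs(2) lenL by simp
  qed
  have htm: "z \<in> P \<Longrightarrow> z \<in> set (take n L) \<longleftrightarrow> ht (word_map (take n vs) z) < 0" for z n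
    using mem_inv_ht[OF red_set[OF redt[of n]]] invt by simp
  have idx3: "L ! k \<notin> set (take k L)" "L ! (k + 1) \<notin> set (take (k + 1) L)" "L ! (k + 2) \<notin> set (take (k + 1) L)"
     "L ! k \<in> set (take (k + 1) L)" "L ! k \<in> set (take (k + 2) L)" "L ! (k + 1) \<in> set (take (k + 2) L)"
     "L ! (k + 2) \<notin> set (take (k + 2) L)" "L ! (k + 1) \<notin> set (take k L)" "L ! (k + 2) \<notin> set (take k L)"
    using idx vs(2) lenL by auto
  have sum: "ht (word_map (take n vs) (\<alpha> + \<beta>)) = ht (word_map (take n vs) \<alpha>) + ht (word_map (take n vs) \<beta>)" for n
    by simp
  \<comment> \<open>Among positive roots, inversion sets and their complements are closed under
    sums, so the sum is neither the first nor the last of the three.\<close>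
  have "L ! k \<noteq> \<alpha> + \<beta>"
  proof
    assume a: "L ! k = \<alpha> + \<beta>"
    then have "\<alpha> \<in> {L ! (k + 1), L ! (k + 2)}" "\<beta> \<in> {L ! (k + 1), L ! (k + 2)}" using three dist3 by auto
    then have "\<alpha> \<notin> set (take (k + 1) L)" "\<beta> \<notin> set (take (k + 1) L)" "\<alpha> + \<beta> \<in> set (take (k + 1) L)"
      using idx3 a by auto
    then show False using htm memP sum[of "k + 1"] by fastforce
  qed
  moreover have "L ! (k + 2) \<noteq> \<alpha> + \<beta>"
  proof
    assume a: "L ! (k + 2) = \<alpha> + \<beta>"
    then have "\<alpha> \<in> {L ! k, L ! (k + 1)}" "\<beta> \<in> {L ! k, L ! (k + 1)}" using three dist3 by auto
    then have "\<alpha> \<in> set (take (k + 2) L)" "\<beta> \<in> set (take (k + 2) L)" "\<alpha> + \<beta> \<notin> set (take (k + 2) L)"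
      using idx3 a by auto
    then show False using htm memP sum[of "k + 2"] by fastforce
  qed
  moreover have "\<alpha> + \<beta> \<in> {L ! k, L ! (k + 1), L ! (k + 2)}" unfolding three by simp
  ultimately have mid: "L ! (k + 1) = \<alpha> + \<beta>" by (metis insertE singletonD)
  then have ends: "(L ! k = \<alpha> \<or> L ! k = \<beta>)" using \<open>L ! k \<noteq> \<alpha> + \<beta>\<close> three by auto
  define us i j where "us = take k vs" and "i = vs ! k" and "j = vs ! (k + 1)"
  have ij: "i \<in> \<Delta>" "j \<in> \<Delta>" using red_set[OF redv] vs(2) by (auto simp: i_def j_def)
  have t1: "take (k + 1) vs = us @ [i]" using vs(2) by (simp add: us_def i_def take_Suc_conv_app_nth)
  have Lk: "word_map us (L ! k) = i" using vs(2) by (simp add: L_def lambda_seq_nth us_def i_def)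
  have "L ! (k + 1) = word_map (rev (us @ [i])) j" using vs(2) t1 by (simp add: L_def lambda_seq_nth j_def)
  then have "\<alpha> + \<beta> = word_map (rev us) (reflect i j)" using mid by simp
  then have ug: "word_map us (\<alpha> + \<beta>) = reflect i j" by (simp only: word_map_rev2)
  \<comment> \<open>The outer root that is crossed last; the moves may have reversed the order of
    \<alpha> and \<beta>.\<close>
  define p' where "p' = \<alpha> + \<beta> - L ! k"
  have p': "p' = \<alpha> \<or> p' = \<beta>" "{L ! k, p'} = {\<alpha>, \<beta>}" "L ! k \<bullet> p' = - \<kappa>" "L ! k \<bullet> L ! k = 2 * \<kappa>"
    using ends \<kappa> by (auto simp: p'_def inner_commute)
  have up: "word_map us p' = reflect i j - i" using ug Lk by (simp add: p'_def)
  have "i \<bullet> i = 2 * \<kappa>" using p'(4) Lk inner_word_map[of us "L ! k" "L ! k"] by simp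
  moreover have "i \<bullet> (reflect i j - i) = - \<kappa>" using p'(3) Lk up inner_word_map[of us "L ! k" p'] by simp
  moreover have "i \<bullet> reflect i j = - (i \<bullet> j)"
    using inner_reflect[of i i "reflect i j"] by simp
  ultimately have "i \<bullet> j = - \<kappa>" by (simp add: inner_diff_right)
  then have "reflect i j = j + i" using \<kappa>(1) \<open>i \<bullet> i = 2 * \<kappa>\<close> by (simp add: reflect_def inner_commute)
  then have "word_map us p' = j" using up by simp
  then have simple: "word_map us \<alpha> \<in> \<Delta>" "word_map us \<beta> \<in> \<Delta>" using Lk p'(1,2) ends ij by auto
  define f where "f z = co (word_map us \<alpha>) (word_map us z)" for z
  have "linear f" unfolding f_def using linear_compose[OF linear_word_map linear_co] by (simp add: o_def)
  moreover have "f (\<beta> - \<alpha>) < 0" using simple dist3 by (simp add: f_def co_base)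
  moreover have "0 \<le> f d" if d: "d \<in> P - inv (take (Suc q) ws)" for d
  proof -
    have "set (take k L) \<subseteq> set (take (Suc q) L)" using kq by (simp add: set_take_subset_set_take)
    then have "d \<notin> inv us" using d invq invt unfolding us_def by blast
    then have "word_map us d \<in> P" using d mem_inv[OF red_set[OF redt[of k]]] by (auto simp: us_def)
    then show ?thesis unfolding f_def using co_nonneg[OF pos_nonneg] simple(1) by blast
  qed
  ultimately show ?thesis using that by blast
qed

end

section \<open>The dual root system\<close>

text \<open>The coroots of a root system with norms \<open>2\<kappa>\<close> and \<open>4\<kappa>\<close>, scaled so that short roots are fixed.
  Positivity is not affected, so inversion sets and Coxeter moves can be compared.\<close>

definition halve_long :: "real \<Rightarrow> 'a::euclidean_space \<Rightarrow> 'a" where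
  "halve_long \<kappa> x = (if x \<bullet> x = 4 * \<kappa> then (1 / 2) *\<^sub>R x else x)"

lemma reflect_scaled: "c \<noteq> 0 \<Longrightarrow> reflect (c *\<^sub>R a) x = reflect a x"
  by (simp add: reflect_def)

text \<open>Scaling a root does not change its reflection, and halving the long roots transposes the
  Cartan numbers.\<close>

lemma dual_root_system:
  assumes R: "root_system R" and \<kappa>: "0 < \<kappa>" and n: "\<And>x. x \<in> R \<Longrightarrow> x \<bullet> x = 2 * \<kappa> \<or> x \<bullet> x = 4 * \<kappa>"
  shows "root_system (halve_long \<kappa> ` R)"
proof -
  note D = root_systemD[OF R]
  let ?s = "halve_long \<kappa>"
  have s: "reflect (?s a) (?s x) = ?s (reflect a x)" for a x
    by (simp add: halve_long_def reflect_scaled)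
  have refl: "reflect (?s a) ` (?s ` R) = ?s ` R" if "a \<in> R" for a
  proof -
    have "reflect a ` R = R" using R that unfolding root_system_def by simp
    moreover have "reflect (?s a) ` (?s ` R) = ?s ` (reflect a ` R)" by (simp only: image_image s)
    ultimately show ?thesis by simp
  qed
  have cartan: "cartan_number (?s a) (?s b) = cartan_number b a" if "a \<in> R" "b \<in> R" for a b
    using n[OF that(1)] n[OF that(2)] \<kappa> by (auto simp: halve_long_def cartan_number_def inner_commute)
  have mult: "c = 1 \<or> c = - 1" if H: "a \<in> R" "b \<in> R" "c *\<^sub>R ?s a = ?s b" for a b c
  proof -
    obtain r where r: "?s a = r *\<^sub>R a"
      by (cases "a \<bullet> a = 4 * \<kappa>") (auto simp: halve_long_def intro: that[of "1 / 2"] that[of 1])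
    obtain t where t: "b = t *\<^sub>R a"
    proof (cases "b \<bullet> b = 4 * \<kappa>")
      case True
      then have "(1 / 2) *\<^sub>R b = c *\<^sub>R ?s a" using H(3) by (simp add: halve_long_def)
      then have "2 *\<^sub>R ((1 / 2) *\<^sub>R b) = 2 *\<^sub>R (c *\<^sub>R ?s a)" by simp
      then have "b = (2 * c * r) *\<^sub>R a" by (simp add: r)
      then show ?thesis by (rule that)
    next
      case False
      then have "b = c *\<^sub>R ?s a" using H(3) by (simp add: halve_long_def)
      then have "b = (c * r) *\<^sub>R a" by (simp add: r)
      then show ?thesis by (rule that)
    qed
    then have "t = 1 \<or> t = - 1" using D(5) H by blast
    then have b: "b = a \<or> b = - a" using t by auto
    have "?s a \<noteq> 0" using H D(2) by (auto simp: halve_long_def)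
    moreover have "?s (- a) = - ?s a" by (simp add: halve_long_def)
    ultimately show ?thesis using b H(3)
      by (metis scaleR_cancel_right scaleR_minus1_left scaleR_one)
  qed
  have "0 \<notin> ?s ` R" using D(2) by (auto simp: halve_long_def split: if_splits)
  moreover have "\<forall>a\<in>?s ` R. reflect a ` (?s ` R) = ?s ` R" using refl by blast
  moreover have "\<forall>a\<in>?s ` R. \<forall>b\<in>?s ` R. cartan_number a b \<in> \<int>" using cartan D(4) by auto
  moreover have "\<forall>a\<in>?s ` R. \<forall>c. c *\<^sub>R a \<in> ?s ` R \<longrightarrow> c = 1 \<or> c = - 1" using mult by (metis imageE)
  ultimately show ?thesis
    unfolding root_system_def using D(1) by simp
qed

section \<open>Roots of two lengths in the core configuration\<close>

context triple_core
begin

text \<open>A root in the plane equals its projection, so if it were not one of the six, its squared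
  length would be 0 or 2/3 of \<open>\<kappa>\<close>, and neither occurs.\<close>

lemma plane_roots:
  assumes z: "z \<in> Q" "z \<in> span {\<alpha>, \<beta>}"
  shows "z \<in> {\<alpha>, - \<alpha>, \<beta>, - \<beta>, \<alpha> + \<beta>, - (\<alpha> + \<beta>)}"
proof (rule ccontr)
  assume n: "\<not> ?thesis"
  obtain s t where st: "z = s *\<^sub>R \<alpha> + t *\<^sub>R \<beta>" using z(2) by (rule span_pairD)
  have i: "z \<bullet> \<alpha> = (2 * s - t) * \<kappa>" "z \<bullet> \<beta> = (2 * t - s) * \<kappa>"
    by (simp_all add: st inner_add_left aln ben ab algebra_simps)
  have "z \<bullet> (s *\<^sub>R \<alpha> + t *\<^sub>R \<beta>) = s * (z \<bullet> \<alpha>) + t * (z \<bullet> \<beta>)" by (simp add: inner_add_right)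
  then have zz: "z \<bullet> z = s * (z \<bullet> \<alpha>) + t * (z \<bullet> \<beta>)" by (simp only: st[symmetric])
  have one: "v * \<kappa> = \<kappa> \<longleftrightarrow> v = 1" "v * \<kappa> = 0 \<longleftrightarrow> v = 0" "v * \<kappa> = - \<kappa> \<longleftrightarrow> v = - 1" for v
    using kpos by (auto simp: minus_equation_iff simp flip: minus_mult_left) (metis less_irrefl minus_minus minus_mult_left mult_cancel_right1)
  have types: "(z \<bullet> \<alpha>, z \<bullet> \<beta>) \<in> {(0,0), (\<kappa>,0), (0,\<kappa>), (-\<kappa>,0), (0,-\<kappa>), (\<kappa>,-\<kappa>), (-\<kappa>,\<kappa>)}"
    using plane_types[OF z(1)] n by blast
  define p q where "p = 2 * s - t" and "q = 2 * t - s"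
  have st': "s = (2 * p + q) / 3" "t = (p + 2 * q) / 3" by (simp_all add: p_def q_def)
  have "z \<bullet> z = s * (p * \<kappa>) + t * (q * \<kappa>)" using zz unfolding i p_def q_def .
  then have "z \<bullet> z = 2 / 3 * \<kappa> * (p * p + p * q + q * q)" unfolding st' by (simp add: field_simps)
  moreover have "(p, q) \<in> {(0,0), (1,0), (0,1), (-1,0), (0,-1), (1,-1), (-1,1)}"
    using types unfolding i p_def[symmetric] q_def[symmetric] insert_iff prod.inject one by blast
  ultimately have "z \<bullet> z = 0 \<or> z \<bullet> z = 2 / 3 * \<kappa>" by (elim insertE emptyE) simp_all
  then show False using norms[OF z(1)] kpos by auto
qed

lemma tA_inner: "tA x \<Longrightarrow> x \<bullet> (\<beta> - \<alpha>) = 2 * \<kappa>"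
  by (simp add: tA_def inner_diff_right)

lemma long_int:
  assumes "x \<in> Q" "y \<in> Q" "x \<bullet> x = 2 * \<kappa>"
  obtains k :: int where "y \<bullet> x = k * \<kappa>"
proof -
  have "cartan_number y x \<in> \<int>" using root_systemD(4)[OF rsQ] assms by blast
  then obtain k :: int where "cartan_number y x = k" by (rule Ints_cases)
  then have "y \<bullet> x = k * \<kappa>" using kpos assms(3) by (simp add: cartan_number_def field_simps)
  then show ?thesis by (rule that)
qed

text \<open>With \<open>g = \<alpha> + \<beta>\<close> the three roots form an orthogonal frame of
  equal lengths, in which 2\<alpha> is \<open>g - x - y - z\<close>. The short root \<open>e\<close>
  has integral coordinates in halves of this frame, with sum of squares at most 2 and with
  \<open>d - a - b - c\<close> even and nonzero. So exactly two of them are nonzero and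
  \<open>e\<close> lies in the span of the frame. If \<open>g\<close> occurs in it, subtracting
  \<alpha> from \<open>e\<close> or \<open>- e\<close> gives the half sum of the two roots among
  \<open>x\<close>, \<open>y\<close>, \<open>z\<close> that do not occur.\<close>

lemma half_sum_from_short:
  assumes long: "x \<in> Q" "y \<in> Q" "z \<in> Q" "x \<bullet> x = 2 * \<kappa>" "y \<bullet> y = 2 * \<kappa>" "z \<bullet> z = 2 * \<kappa>"
    and orth: "x \<bullet> y = 0" "x \<bullet> z = 0" "y \<bullet> z = 0" and types: "tA x" "tA y" "tA z"
    and sum: "x + y + z = \<beta> - \<alpha>"
    and e: "e \<in> Q" "e \<bullet> e = \<kappa>" "e \<bullet> \<alpha> \<noteq> 0"
  shows "(1/2) *\<^sub>R (x + y) \<in> Q \<or> (1/2) *\<^sub>R (x + z) \<in> Q \<or> (1/2) *\<^sub>R (y + z) \<in> Q"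
proof -
  define g where "g = \<alpha> + \<beta>"
  have gn: "g \<bullet> g = 2 * \<kappa>" "g \<in> Q" using gan gaQ by (simp_all add: g_def)
  have go: "x \<bullet> g = 0" "y \<bullet> g = 0" "z \<bullet> g = 0"
    using types by (simp_all add: g_def tA_def inner_add_right)
  have al: "2 *\<^sub>R \<alpha> = g - x - y - z"
  proof -
    have "g - (x + y + z) = 2 *\<^sub>R \<alpha>" unfolding sum g_def by (simp add: scaleR_2)
    then show ?thesis by (simp add: algebra_simps)
  qed
  obtain a b c d :: int where abcd: "e \<bullet> x = a * \<kappa>" "e \<bullet> y = b * \<kappa>" "e \<bullet> z = c * \<kappa>" "e \<bullet> g = d * \<kappa>"
    using long_int[OF long(1) e(1) long(4)] long_int[OF long(2) e(1) long(5)]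
      long_int[OF long(3) e(1) long(6)] long_int[OF gn(2) e(1) gn(1)] by metis
  obtain k :: int where k: "e \<bullet> \<alpha> = k * \<kappa>" using long_int[OF alQ e(1) aln] by metis
  have "2 * (e \<bullet> \<alpha>) = e \<bullet> (2 *\<^sub>R \<alpha>)" by simp
  also have "\<dots> = (d - a - b - c) * \<kappa>" unfolding al by (simp add: inner_diff_right abcd algebra_simps)
  finally have "real_of_int (2 * k) * \<kappa> = real_of_int (d - a - b - c) * \<kappa>" using k by simp
  then have par: "2 * k = d - a - b - c" using kpos by (metis less_irrefl mult_right_cancel of_int_eq_iff)
  have k0: "k \<noteq> 0" using k e(3) by auto
  define w where "w = e - (1/2) *\<^sub>R (real_of_int a *\<^sub>R x + real_of_int b *\<^sub>R y + real_of_int c *\<^sub>R z + real_of_int d *\<^sub>R g)"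
  have comm: "x \<bullet> e = a * \<kappa>" "y \<bullet> e = b * \<kappa>" "z \<bullet> e = c * \<kappa>" "g \<bullet> e = d * \<kappa>"
    "y \<bullet> x = 0" "z \<bullet> x = 0" "z \<bullet> y = 0" "g \<bullet> x = 0" "g \<bullet> y = 0" "g \<bullet> z = 0"
    using abcd orth go by (simp_all add: inner_commute)
  have ww: "w \<bullet> w = \<kappa> - \<kappa> / 2 * real_of_int (a * a + b * b + c * c + d * d)"
    unfolding w_def inner_diff_left inner_diff_right inner_add_left inner_add_right
      inner_scaleR_left inner_scaleR_right abcd comm orth go long gn e by (simp add: algebra_simps)
  then have "\<kappa> / 2 * real_of_int (a * a + b * b + c * c + d * d) \<le> \<kappa> / 2 * 2"
    using inner_ge_zero[of w] by simp
  then have "real_of_int (a * a + b * b + c * c + d * d) \<le> 2" using kpos by (simp only: mult_le_cancel_left_pos half_gt_zero_iff)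
  then have le2: "a * a + b * b + c * c + d * d \<le> 2" by linarith
  have sq: "v * v \<le> 2 \<Longrightarrow> v \<in> {-1, 0, 1}" for v :: int
  proof -
    assume "v * v \<le> 2"
    then have "\<bar>v\<bar> < 2" using abs_le_square_iff[of 2 v] by (simp add: power2_eq_square)
    then show ?thesis by auto
  qed
  have nn: "0 \<le> a * a" "0 \<le> b * b" "0 \<le> c * c" "0 \<le> d * d" by simp_all
  have v: "a \<in> {-1, 0, 1}" "b \<in> {-1, 0, 1}" "c \<in> {-1, 0, 1}" "d \<in> {-1, 0, 1}"
    using le2 nn by (intro sq; linarith)+
  have cases: "(a,b,c,d) \<in> {(1,1,0,0), (-1,-1,0,0), (1,0,1,0), (-1,0,-1,0), (0,1,1,0), (0,-1,-1,0),
      (-1,0,0,1), (1,0,0,-1), (0,-1,0,1), (0,1,0,-1), (0,0,-1,1), (0,0,1,-1)}"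
    using v le2 par k0 by (elim insertE emptyE) (simp_all; presburger)+
  then have "a * a + b * b + c * c + d * d = 2" by auto
  then have "w \<bullet> w = 0" unfolding ww by simp
  then have e_eq: "e = (1/2) *\<^sub>R (real_of_int a *\<^sub>R x + real_of_int b *\<^sub>R y + real_of_int c *\<^sub>R z + real_of_int d *\<^sub>R g)"
    by (simp add: w_def)
  have neg: "- e \<in> Q" using root_systemD(6)[OF rsQ] e(1) by blast
  have conv: "(1/2) *\<^sub>R (v + u) \<in> Q"
    if t: "(1/2) *\<^sub>R (g - t) \<in> Q" "g - t - v - u = 2 *\<^sub>R \<alpha>" "t \<bullet> \<alpha> = - \<kappa>" for t v u
  proof -
    have ga: "g \<bullet> \<alpha> = \<kappa>" by (simp add: g_def inner_add_left aln ab)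
    have i: "((1/2) *\<^sub>R (g - t)) \<bullet> - \<alpha> < 0" using kpos by (simp add: inner_diff_left ga t)
    have "(1/2) *\<^sub>R (g - t) \<noteq> \<alpha>"
    proof
      assume "(1/2) *\<^sub>R (g - t) = \<alpha>"
      then have "((1/2) *\<^sub>R (g - t)) \<bullet> \<alpha> = \<alpha> \<bullet> \<alpha>" by simp
      then show False using kpos by (simp add: inner_diff_left ga t aln)
    qed
    then have "(1/2) *\<^sub>R (g - t) + - \<alpha> \<in> Q"
      using root_add[OF rsQ t(1) root_systemD(6)[OF rsQ alQ] i] by simp
    moreover have "(1/2) *\<^sub>R (g - t) + - \<alpha> = (1/2) *\<^sub>R (v + u)"
    proof -
      have "(1/2) *\<^sub>R (2 *\<^sub>R \<alpha>) = (1/2) *\<^sub>R (g - t - v - u)" using t(2) by simp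
      then have "\<alpha> = (1/2) *\<^sub>R (g - t - v - u)" by simp
      then show ?thesis by (simp add: algebra_simps)
    qed
    ultimately show ?thesis by simp
  qed
  have ta: "x \<bullet> \<alpha> = - \<kappa>" "y \<bullet> \<alpha> = - \<kappa>" "z \<bullet> \<alpha> = - \<kappa>" using types by (auto simp: tA_def)
  have g1: "g - x - y - z = 2 *\<^sub>R \<alpha>" "g - y - x - z = 2 *\<^sub>R \<alpha>" "g - z - x - y = 2 *\<^sub>R \<alpha>"
    unfolding al by (simp_all add: algebra_simps)
  have six: "(1/2) *\<^sub>R (x + y) \<in> {e, - e} \<or> (1/2) *\<^sub>R (x + z) \<in> {e, - e} \<or> (1/2) *\<^sub>R (y + z) \<in> {e, - e} \<or>
     (1/2) *\<^sub>R (g - x) \<in> {e, - e} \<or> (1/2) *\<^sub>R (g - y) \<in> {e, - e} \<or> (1/2) *\<^sub>R (g - z) \<in> {e, - e}"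
    using cases unfolding e_eq by (elim insertE emptyE) (simp_all add: algebra_simps)
  have eQ: "v \<in> {e, - e} \<Longrightarrow> v \<in> Q" for v using e(1) neg by auto
  from six show ?thesis
    using conv[OF eQ g1(1) ta(1)] conv[OF eQ g1(2) ta(2)] conv[OF eQ g1(3) ta(3)] eQ by blast
qed

text \<open>Each of the three roots has product \<open>2 * \<kappa>\<close> with
  \<open>\<beta> - \<alpha>\<close>. Three long roots are therefore orthogonal, and
  \<open>half_sum_from_short\<close> applies. Exactly two long roots would require the product
  \<open>\<kappa> / 2\<close>, against integrality. With one long root the two short ones coincide.
  Of three short roots one is doubled and completed by a long root.\<close>

lemma long_short_pair:
  assumes xyz: "{x, y, z} \<subseteq> M" "tA x" "tA y" "tA z" "x + y + z = \<beta> - \<alpha>"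
    and e0: "e0 \<in> Q" "e0 \<bullet> e0 = \<kappa>" "e0 \<bullet> \<alpha> \<noteq> 0"
  shows "\<exists>d e. d \<in> M \<and> e \<in> M \<and> d \<bullet> d = 2 * \<kappa> \<and> e \<bullet> e = \<kappa> \<and> d + 2 *\<^sub>R e = \<beta> - \<alpha>"
proof -
  have Q: "x \<in> Q" "y \<in> Q" "z \<in> Q" and M: "x \<in> M" "y \<in> M" "z \<in> M" using xyz(1) by (auto simp: M_def)
  have row: "u \<bullet> u + u \<bullet> v + u \<bullet> w = 2 * \<kappa>" if "tA u" "u + v + w = \<beta> - \<alpha>" for u v w
  proof -
    have "u \<bullet> (u + v + w) = 2 * \<kappa>" unfolding that(2) by (rule tA_inner[OF that(1)])
    then show ?thesis by (simp add: inner_add_right)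
  qed
  have r: "x \<bullet> x + x \<bullet> y + x \<bullet> z = 2 * \<kappa>" "y \<bullet> y + x \<bullet> y + y \<bullet> z = 2 * \<kappa>" "z \<bullet> z + x \<bullet> z + y \<bullet> z = 2 * \<kappa>"
    using row[of x y z] row[of y x z] row[of z x y] xyz by (simp_all add: algebra_simps inner_commute)
  have halfM: "v \<in> M" if "v \<in> Q" "v = (1/2) *\<^sub>R (s + t)" "s \<in> M" "t \<in> M" for v s t
    using that by (auto simp: M_def)
  have SSL: ?thesis if "s \<in> M" "t \<in> M" "u \<in> M" "s \<bullet> s = \<kappa>" "t \<bullet> t = \<kappa>" "u \<bullet> u = 2 * \<kappa>"
    "u + s + t = \<beta> - \<alpha>" "s \<bullet> t = \<kappa>" for s t u
  proof -
    have "(s - t) \<bullet> (s - t) = 0" using that by (simp add: inner_diff_left inner_diff_right inner_commute)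
    then have "s = t" by simp
    then show ?thesis using that by (intro exI[of _ u] exI[of _ s]) (simp add: scaleR_2 add.assoc)
  qed
  have LLS: False if L: "u \<in> Q" "s \<in> Q" "u \<bullet> u = 2 * \<kappa>" "u \<bullet> s = \<kappa> / 2" for u s
  proof -
    obtain k :: int where "s \<bullet> u = k * \<kappa>" using long_int[OF L(1,2,3)] by metis
    moreover have "2 * (s \<bullet> u) = \<kappa>" using L(4) by (simp add: inner_commute)
    ultimately have "real_of_int (2 * k) * \<kappa> = real_of_int 1 * \<kappa>" by simp
    then have "real_of_int (2 * k) = real_of_int 1" using kpos by (metis less_irrefl mult_right_cancel)
    then have "2 * k = 1" by (simp only: of_int_eq_iff)
    then show False by presburger
  qed
  have N: "v \<bullet> v = \<kappa> \<or> v \<bullet> v = 2 * \<kappa>" if "v \<in> Q" for v using norms that by blast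
  consider "x \<bullet> x = 2 * \<kappa>" "y \<bullet> y = 2 * \<kappa>" "z \<bullet> z = 2 * \<kappa>" | "x \<bullet> x = 2 * \<kappa>" "y \<bullet> y = 2 * \<kappa>" "z \<bullet> z = \<kappa>"
    | "x \<bullet> x = 2 * \<kappa>" "y \<bullet> y = \<kappa>" "z \<bullet> z = 2 * \<kappa>" | "x \<bullet> x = \<kappa>" "y \<bullet> y = 2 * \<kappa>" "z \<bullet> z = 2 * \<kappa>"
    | "x \<bullet> x = 2 * \<kappa>" "y \<bullet> y = \<kappa>" "z \<bullet> z = \<kappa>" | "x \<bullet> x = \<kappa>" "y \<bullet> y = 2 * \<kappa>" "z \<bullet> z = \<kappa>"
    | "x \<bullet> x = \<kappa>" "y \<bullet> y = \<kappa>" "z \<bullet> z = 2 * \<kappa>" | "x \<bullet> x = \<kappa>" "y \<bullet> y = \<kappa>" "z \<bullet> z = \<kappa>"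
    using N[OF Q(1)] N[OF Q(2)] N[OF Q(3)] by blast
  then show ?thesis
  proof cases
    case 1
    then have o: "x \<bullet> y = 0" "x \<bullet> z = 0" "y \<bullet> z = 0" using r by linarith+
    have n: "((1/2) *\<^sub>R (u + v)) \<bullet> ((1/2) *\<^sub>R (u + v)) = \<kappa>" if "u \<bullet> u = 2 * \<kappa>" "v \<bullet> v = 2 * \<kappa>" "u \<bullet> v = 0" for u v
      using that by (simp add: inner_add_left inner_add_right inner_commute)
    have fin: ?thesis if "(1/2) *\<^sub>R (u + v) \<in> Q" "u \<in> M" "v \<in> M" "t \<in> M" "t \<bullet> t = 2 * \<kappa>" "u \<bullet> u = 2 * \<kappa>" "v \<bullet> v = 2 * \<kappa>" "u \<bullet> v = 0"
      "t + (u + v) = \<beta> - \<alpha>" for t u v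
      using that halfM[OF that(1) refl that(2,3)] n[OF that(6-8)]
      by (intro exI[of _ t] exI[of _ "(1/2) *\<^sub>R (u + v)"]) simp
    have e: "z + (x + y) = \<beta> - \<alpha>" "y + (x + z) = \<beta> - \<alpha>" "x + (y + z) = \<beta> - \<alpha>"
      unfolding xyz(5)[symmetric] by (simp_all add: algebra_simps)
    from half_sum_from_short[OF Q 1 o xyz(2-5) e0] show ?thesis
      using fin[OF _ M(1) M(2) M(3) 1(3) 1(1) 1(2) o(1) e(1)] fin[OF _ M(1) M(3) M(2) 1(2) 1(1) 1(3) o(2) e(2)]
        fin[OF _ M(2) M(3) M(1) 1(1) 1(2) 1(3) o(3) e(3)] by blast
  next
    case 2
    then have "x \<bullet> z = \<kappa> / 2" using r by linarith
    then show ?thesis using LLS[OF Q(1) Q(3)] 2 by blast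
  next
    case 3
    then have "x \<bullet> y = \<kappa> / 2" using r by linarith
    then show ?thesis using LLS[OF Q(1) Q(2)] 3 by blast
  next
    case 4
    then have "y \<bullet> x = \<kappa> / 2" using r by (simp add: inner_commute)
    then show ?thesis using LLS[OF Q(2) Q(1)] 4 by blast
  next
    case 5
    then have "y \<bullet> z = \<kappa>" using r by linarith
    then show ?thesis using SSL[OF M(2) M(3) M(1)] 5 xyz(5) by (simp add: algebra_simps)
  next
    case 6
    then have "x \<bullet> z = \<kappa>" using r by linarith
    then show ?thesis using SSL[OF M(1) M(3) M(2)] 6 xyz(5) by (simp add: algebra_simps)
  next
    case 7
    then have "x \<bullet> y = \<kappa>" using r by linarith
    then show ?thesis using SSL[OF M(1) M(2) M(3)] 7 xyz(5) by (simp add: algebra_simps)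
  next
    case 8
    \<comment> \<open>The long root \<open>d\<close> comes from \<beta> by the reflection in
      \<open>t\<close> and subtraction of \<alpha>; the last two conditions say that
      \<open>f1\<close> and \<open>f2\<close> are positive on it. At most one of the three roots
      takes half or more of \<open>f1 \<beta>\<close>, and at most one takes half or more of
      \<open>- f2 \<alpha>\<close>, so some \<open>t\<close> satisfies both.\<close>
    have fin: ?thesis if t: "t \<in> M" "tA t" "t \<bullet> t = \<kappa>" "2 * f1 t < f1 \<beta>" "2 * f2 t < - f2 \<alpha>" for t
    proof -
      define d where "d = \<beta> - \<alpha> - 2 *\<^sub>R t"
      have tQ: "t \<in> Q" using t by (simp add: M_def)
      have i: "t \<bullet> \<alpha> = - \<kappa>" "t \<bullet> \<beta> = \<kappa>" "\<alpha> \<bullet> t = - \<kappa>" "\<beta> \<bullet> t = \<kappa>" using t(2) by (auto simp: tA_def inner_commute)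
      have "reflect t \<beta> = \<beta> - 2 *\<^sub>R t" using kpos by (simp add: reflect_def i t)
      then have bq: "\<beta> - 2 *\<^sub>R t \<in> Q" using root_systemD(3)[OF rsQ tQ beQ] by simp
      have bi: "(\<beta> - 2 *\<^sub>R t) \<bullet> \<alpha> = \<kappa>" by (simp add: inner_diff_left ab i)
      then have "\<beta> - 2 *\<^sub>R t \<noteq> \<alpha>" using aln kpos by (metis less_irrefl mult_2 add_cancel_right_right)
      then have "(\<beta> - 2 *\<^sub>R t) + - \<alpha> \<in> Q"
        using root_add[OF rsQ bq root_systemD(6)[OF rsQ alQ]] bi kpos by simp
      moreover have "(\<beta> - 2 *\<^sub>R t) + - \<alpha> = d" by (simp add: d_def)
      ultimately have dQ: "d \<in> Q" by simp
      have "d \<in> M" using dQ t by (simp add: M_def d_def)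
      moreover have "d \<bullet> d = 2 * \<kappa>"
        unfolding d_def inner_diff_left inner_diff_right inner_scaleR_left inner_scaleR_right i aln ben ab t(3) by simp
      moreover have "d + 2 *\<^sub>R t = \<beta> - \<alpha>" by (simp add: d_def)
      ultimately show ?thesis using t by blast
    qed
    have f: "f1 x + f1 y + f1 z = f1 \<beta>" "f2 x + f2 y + f2 z = - f2 \<alpha>"
      using arg_cong[OF xyz(5), of f1] arg_cong[OF xyz(5), of f2] by simp_all
    have p: "0 < f1 x" "0 < f1 y" "0 < f1 z" "0 < f2 x" "0 < f2 y" "0 < f2 z" using M by (auto simp: M_def)
    have "(2 * f1 x < f1 \<beta> \<and> 2 * f2 x < - f2 \<alpha>) \<or> (2 * f1 y < f1 \<beta> \<and> 2 * f2 y < - f2 \<alpha>) \<or> (2 * f1 z < f1 \<beta> \<and> 2 * f2 z < - f2 \<alpha>)"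
      using f p by linarith
    then show ?thesis using fin[OF M(1) xyz(2) 8(1)] fin[OF M(2) xyz(3) 8(2)] fin[OF M(3) xyz(4) 8(3)] by blast
  qed
qed

text \<open>Comparing squared lengths in the relation shows that \<open>d\<close> and
  \<open>e\<close> are orthogonal. Hence both have product \<open>2 * \<kappa>\<close> with
  \<open>\<beta> - \<alpha>\<close>, and only one entry of \<open>M_types\<close> attains this
  value.\<close>

lemma long_short_types:
  assumes de: "d \<in> M" "e \<in> M" "d \<bullet> d = 2 * \<kappa>" "e \<bullet> e = \<kappa>" "d + 2 *\<^sub>R e = \<beta> - \<alpha>"
  shows "d \<bullet> \<alpha> = - \<kappa> \<and> e \<bullet> \<alpha> = - \<kappa>"
proof -
  have "(\<beta> - \<alpha>) \<bullet> (\<beta> - \<alpha>) = 6 * \<kappa>"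
    by (simp add: inner_diff_left inner_diff_right aln ben ab)
  moreover have "(d + 2 *\<^sub>R e) \<bullet> (d + 2 *\<^sub>R e) = 6 * \<kappa> + 4 * (d \<bullet> e)"
    by (simp add: inner_add_left inner_add_right de(3,4) inner_commute)
  ultimately have o: "d \<bullet> e = 0" unfolding de(5) by simp
  have "d \<bullet> (d + 2 *\<^sub>R e) = 2 * \<kappa>" "e \<bullet> (d + 2 *\<^sub>R e) = 2 * \<kappa>"
    using o by (simp_all add: inner_add_right de(3,4) inner_commute)
  then have "d \<bullet> \<beta> - d \<bullet> \<alpha> = 2 * \<kappa>" "e \<bullet> \<beta> - e \<bullet> \<alpha> = 2 * \<kappa>"
    unfolding de(5) by (simp_all add: inner_diff_right)
  moreover have "x \<bullet> \<alpha> = - \<kappa>" if "x \<in> M" "x \<bullet> \<beta> - x \<bullet> \<alpha> = 2 * \<kappa>" for x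
    using M_types[OF that(1)] that(2) kpos by auto
  ultimately show ?thesis using de(1,2) by blast
qed

end

section \<open>Subsystems in coordinates\<close>

lemma nonneg_comb_scale: "x \<in> nonneg_comb D \<Longrightarrow> real n *\<^sub>R x \<in> nonneg_comb D"
  by (induction n) (auto simp: nonneg_comb_0 scaleR_left_distrib intro: nonneg_comb_add)

lemma nonneg_comb_sum: "(\<And>i. i \<in> I \<Longrightarrow> f i \<in> nonneg_comb D) \<Longrightarrow> sum f I \<in> nonneg_comb D"
  by (induction I rule: infinite_finite_induct) (auto simp: nonneg_comb_0 intro: nonneg_comb_add)

lemma nonneg_comb_trans:
  assumes "G \<subseteq> nonneg_comb D" shows "nonneg_comb G \<subseteq> nonneg_comb D"
proof
  fix x assume "x \<in> nonneg_comb G"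
  then obtain c :: "'a \<Rightarrow> nat" where "x = (\<Sum>a\<in>G. real (c a) *\<^sub>R a)" unfolding nonneg_comb_def by auto
  then show "x \<in> nonneg_comb D" using assms by (auto intro!: nonneg_comb_sum nonneg_comb_scale)
qed

lemma independent_dual:
  fixes G :: "'a::euclidean_space set"
  assumes "\<And>g. g \<in> G \<Longrightarrow> \<exists>w. w \<bullet> g \<noteq> 0 \<and> (\<forall>h\<in>G - {g}. w \<bullet> h = 0)"
  shows "independent G"
  unfolding dependent_def
proof
  assume "\<exists>a\<in>G. a \<in> span (G - {a})"
  then obtain g where g: "g \<in> G" "g \<in> span (G - {g})" by blast
  then obtain w where w: "w \<bullet> g \<noteq> 0" "\<forall>h\<in>G - {g}. w \<bullet> h = 0" using assms by blast
  have "orthogonal w g" by (rule orthogonal_to_span[OF g(2)]) (use w in \<open>auto simp: orthogonal_def\<close>)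
  then show False using w by (simp add: orthogonal_def)
qed

lemma sub_root_system:
  assumes R: "root_system R" and S: "S \<subseteq> R" and closed: "\<And>a x. a \<in> S \<Longrightarrow> x \<in> S \<Longrightarrow> reflect a x \<in> S"
  shows "root_system S"
proof -
  note D = root_systemD[OF R]
  have "reflect a ` S = S" if "a \<in> S" for a
  proof
    show "reflect a ` S \<subseteq> S" using closed that by blast
    show "S \<subseteq> reflect a ` S" using closed[OF that] by (metis image_eqI reflect_reflect subsetI)
  qed
  then show ?thesis
    unfolding root_system_def using D S by (meson finite_subset subsetD)
qed

context based_roots
begin

text \<open>As \<Gamma> consists of positive roots, whatever is positive in the coordinates is
  positive in \<open>R\<close>. Opposite roots are never both positive, so the two notions agree on
  the subsystem.\<close>

lemma subsystem_from_coords: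
  assumes C: "C \<subseteq> R" and closed: "\<And>a x. a \<in> C \<union> uminus ` C \<Longrightarrow> x \<in> C \<union> uminus ` C \<Longrightarrow> reflect a x \<in> C \<union> uminus ` C"
    and \<Gamma>: "\<Gamma> \<subseteq> C" "\<Gamma> \<subseteq> P" "independent \<Gamma>" "C \<subseteq> nonneg_comb \<Gamma>"
  shows "C \<union> uminus ` C \<subseteq> R" "root_system (C \<union> uminus ` C)" "is_base (C \<union> uminus ` C) \<Gamma>"
    "(C \<union> uminus ` C) \<inter> P = C" "pos_roots (C \<union> uminus ` C) \<Gamma> = C"
proof -
  let ?S = "C \<union> uminus ` C"
  show sub: "?S \<subseteq> R" using C root_minus by auto
  show rs: "root_system ?S" by (rule sub_root_system[OF rs sub closed])
  show base: "is_base ?S \<Gamma>" using \<Gamma> unfolding is_base_def by auto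
  have CP: "C \<subseteq> P"
    using C \<Gamma> nonneg_comb_trans[of \<Gamma> \<Delta>] pos_nonneg by (auto simp: pos_roots_def)
  show "?S \<inter> P = C" using CP pos_not_neg by force
  interpret S: based_roots ?S \<Gamma> using rs base by unfold_locales
  have "C \<subseteq> S.P" using \<Gamma>(4) by (auto simp: pos_roots_def)
  moreover have "S.P \<subseteq> ?S" by (auto simp: pos_roots_def)
  ultimately show "S.P = C" using S.pos_not_neg by force
qed

lemma base_eqI: "\<Delta> \<subseteq> A \<Longrightarrow> finite A \<Longrightarrow> card A \<le> card \<Delta> \<Longrightarrow> \<Delta> = A"
  by (rule card_seteq) auto

end

lemma has_type_card: "has_type X G \<Longrightarrow> card G = rank X"
  unfolding has_type_def using bij_betw_same_card by fastforce

subsection \<open>Types B3 and C3\<close>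

definition coords_BC :: "real \<Rightarrow> 'a::real_vector \<Rightarrow> 'a \<Rightarrow> 'a \<Rightarrow> 'a set" where
  "coords_BC m e1 e2 e3 = {e1 + e2, e1 + e3, e2 + e3, e1 - e2, e1 - e3, e2 - e3, m *\<^sub>R e1, m *\<^sub>R e2, m *\<^sub>R e3}"

lemma pairs3: "{f i j |i j. 1 \<le> i \<and> i < j \<and> j \<le> (3::nat)} = {f 1 2, f 1 3, f 2 3}"
proof -
  have "{f i j |i j. 1 \<le> i \<and> i < j \<and> j \<le> 3} = (\<lambda>(i, j). f i j) ` {(i, j). 1 \<le> i \<and> i < j \<and> j \<le> 3}" by auto
  also have "{(i, j). 1 \<le> i \<and> i < j \<and> j \<le> (3::nat)} = {(1, 2), (1, 3), (2, 3)}" by auto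
  finally show ?thesis by simp
qed

lemma pairs4: "{f i j |i j. 1 \<le> i \<and> i < j \<and> j \<le> (4::nat)} = {f 1 2, f 1 3, f 1 4, f 2 3, f 2 4, f 3 4}"
proof -
  have "{f i j |i j. 1 \<le> i \<and> i < j \<and> j \<le> 4} = (\<lambda>(i, j). f i j) ` {(i, j). 1 \<le> i \<and> i < j \<and> j \<le> 4}" by auto
  also have "{(i, j). 1 \<le> i \<and> i < j \<and> j \<le> (4::nat)} = {(1, 2), (1, 3), (1, 4), (2, 3), (2, 4), (3, 4)}" by auto
  finally show ?thesis by simp
qed

lemma singles3: "{f i |i. 1 \<le> i \<and> i \<le> (3::nat)} = {f 1, f 2, f 3}"
proof -
  have "{f i |i. 1 \<le> i \<and> i \<le> 3} = f ` {i. 1 \<le> i \<and> i \<le> 3}" by auto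
  also have "{i. 1 \<le> i \<and> i \<le> (3::nat)} = {1, 2, 3}" by auto
  finally show ?thesis by simp
qed

lemma coord_roots_B3: "coord_roots_B 3 \<epsilon> = coords_BC 1 (\<epsilon> 1) (\<epsilon> 2) (\<epsilon> 3)"
  unfolding coord_roots_B_def coord_roots_D_def pairs3 singles3 coords_BC_def scaleR_one by blast

lemma coord_roots_C3: "coord_roots_C 3 \<epsilon> = coords_BC 2 (\<epsilon> 1) (\<epsilon> 2) (\<epsilon> 3)"
  unfolding coord_roots_C_def coord_roots_D_def pairs3 singles3 coords_BC_def by blast

text \<open>B3 and C3 together: \<open>k\<close> is the factor in the roots \<open>k e_i\<close>,
  thus 1 or 2, and \<open>h = 2 / k\<close> makes \<open>2 e_i\<close> the \<open>h\<close>-fold of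
  a root in either type.\<close>

locale frame3 =
  fixes e1 e2 e3 :: "'a::euclidean_space" and \<kappa> :: real and k h :: nat
  assumes kappa: "0 < \<kappa>" and kh: "(k, h) \<in> {(1, 2), (2, 1)}"
    and ip: "e1 \<bullet> e1 = \<kappa>" "e2 \<bullet> e2 = \<kappa>" "e3 \<bullet> e3 = \<kappa>" "e1 \<bullet> e2 = 0" "e1 \<bullet> e3 = 0" "e2 \<bullet> e3 = 0"
      "e2 \<bullet> e1 = 0" "e3 \<bullet> e1 = 0" "e3 \<bullet> e2 = 0"
begin

definition C where "C = coords_BC (real k) e1 e2 e3"

lemma hk: "real h * real k = 2" "k \<noteq> 0" "real k \<noteq> 0"
  using kh by auto

lemma refl_basis [simp]:
  "reflect (e1 - e2) e1 = e2" "reflect (e1 - e2) e2 = e1" "reflect (e1 - e2) e3 = e3"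
  "reflect (e2 - e3) e1 = e1" "reflect (e2 - e3) e2 = e3" "reflect (e2 - e3) e3 = e2"
  "reflect (real k *\<^sub>R e1) e1 = - e1" "reflect (real k *\<^sub>R e1) e2 = e2" "reflect (real k *\<^sub>R e1) e3 = e3"
  "reflect (real k *\<^sub>R e2) e1 = e1" "reflect (real k *\<^sub>R e2) e2 = - e2" "reflect (real k *\<^sub>R e2) e3 = e3"
  "reflect (real k *\<^sub>R e3) e1 = e1" "reflect (real k *\<^sub>R e3) e2 = e2" "reflect (real k *\<^sub>R e3) e3 = - e3"
  using kappa hk by (simp_all add: reflect_def inner_diff_left inner_diff_right ip scaleR_2)

definition vec where "vec a b c = real_of_int a *\<^sub>R e1 + real_of_int b *\<^sub>R e2 + real_of_int c *\<^sub>R e3"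

lemma inner_vec: "vec a b c \<bullet> vec x y z = \<kappa> * real_of_int (a * x + b * y + c * z)"
  by (simp add: vec_def inner_add_left inner_add_right ip algebra_simps)

lemma reflect_vec:
  assumes t: "t * (a * a + b * b + c * c) = 2 * (a * x + b * y + c * z)" and nz: "a * a + b * b + c * c \<noteq> 0"
  shows "reflect (vec a b c) (vec x y z) = vec (x - t * a) (y - t * b) (z - t * c)"
proof -
  define N D where "N = real_of_int (a * a + b * b + c * c)" and "D = real_of_int (a * x + b * y + c * z)"
  have "real_of_int (t * (a * a + b * b + c * c)) = real_of_int (2 * (a * x + b * y + c * z))" using t by simp
  then have "real_of_int t * N = 2 * D" by (simp add: N_def D_def)
  moreover have "N \<noteq> 0" using nz unfolding N_def by (metis of_int_0_eq_iff)
  ultimately have "2 * (\<kappa> * D) / (\<kappa> * N) = real_of_int t" using kappa by (simp add: field_simps)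
  moreover have "vec x y z \<bullet> vec a b c = \<kappa> * D" "vec a b c \<bullet> vec a b c = \<kappa> * N"
    by (simp_all only: inner_vec N_def D_def mult.commute[of x a] mult.commute[of y b] mult.commute[of z c])
  ultimately have "reflect (vec a b c) (vec x y z) = vec x y z - real_of_int t *\<^sub>R vec a b c"
    by (simp add: reflect_def)
  then show ?thesis by (simp add: vec_def algebra_simps)
qed

text \<open>The roots of both signs are the integral vectors of squared norm 2 or
  \<open>k * k\<close>. In this form closure under reflections is only a matter of integrality,
  since reflections keep the norm.\<close>

definition good where "good a b c \<longleftrightarrow> a * a + b * b + c * c \<in> {2, int k * int k}"

definition tuples :: "(int \<times> int \<times> int) set" where
  "tuples = {(1,1,0), (1,0,1), (0,1,1), (1,-1,0), (1,0,-1), (0,1,-1), (int k,0,0), (0,int k,0), (0,0,int k)}"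

lemma C_tuples: "C = (\<lambda>(a, b, c). vec a b c) ` tuples"
  by (simp add: C_def coords_BC_def tuples_def vec_def)

lemma good_bound:
  assumes "good a b c" shows "a \<in> {-2,-1,0,1,2}" "b \<in> {-2,-1,0,1,2}" "c \<in> {-2,-1,0,1,2}"
proof -
  have le: "a * a + b * b + c * c \<le> 4" using assms kh by (auto simp: good_def)
  have sq: "v \<in> {-2,-1,0,1,2}" if "v * v \<le> 4" for v :: int
  proof -
    have "\<bar>v\<bar> \<le> 2" using that abs_le_square_iff[of v 2] by (simp add: power2_eq_square)
    then show ?thesis by auto
  qed
  have "0 \<le> a * a" "0 \<le> b * b" "0 \<le> c * c" by simp_all
  then have "a * a \<le> 4" "b * b \<le> 4" "c * c \<le> 4" using le by linarith+
  then show "a \<in> {-2,-1,0,1,2}" "b \<in> {-2,-1,0,1,2}" "c \<in> {-2,-1,0,1,2}" using sq by blast+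
qed

lemma good_tuples:
  assumes "good a b c" shows "(a, b, c) \<in> tuples \<or> (- a, - b, - c) \<in> tuples"
  using good_bound[OF assms] assms kh unfolding good_def tuples_def
  by (elim insertE emptyE) simp_all

lemma tuples_good: "(a, b, c) \<in> tuples \<Longrightarrow> good a b c"
  using kh by (auto simp: tuples_def good_def)

lemma S_good: "C \<union> uminus ` C = {vec a b c |a b c. good a b c}"
proof
  have neg: "- vec a b c = vec (- a) (- b) (- c)" for a b c by (simp add: vec_def)
  have m: "good (- a) (- b) (- c) = good a b c" for a b c by (simp add: good_def)
  have 1: "C \<subseteq> {vec a b c |a b c. good a b c}" unfolding C_tuples using tuples_good by fastforce
  moreover have "- u \<in> {vec a b c |a b c. good a b c}" if "u \<in> {vec a b c |a b c. good a b c}" for u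
    using that m neg by blast
  ultimately show "C \<union> uminus ` C \<subseteq> {vec a b c |a b c. good a b c}" by blast
  show "{vec a b c |a b c. good a b c} \<subseteq> C \<union> uminus ` C"
  proof clarify
    fix a b c assume g: "good a b c" and n: "vec a b c \<notin> uminus ` C"
    from good_tuples[OF g] show "vec a b c \<in> C"
    proof
      assume "(- a, - b, - c) \<in> tuples"
      then have "vec (- a) (- b) (- c) \<in> C" by (force simp: C_tuples)
      then have "- vec (- a) (- b) (- c) \<in> uminus ` C" by blast
      then show ?thesis using n neg by simp
    qed (force simp: C_tuples)
  qed
qed

lemma closed:
  assumes "u \<in> C \<union> uminus ` C" "v \<in> C \<union> uminus ` C" shows "reflect u v \<in> C \<union> uminus ` C"
proof -
  from assms obtain a b c x y z where u: "u = vec a b c" "good a b c" and v: "v = vec x y z" "good x y z"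
    unfolding S_good by auto
  define N where "N = a * a + b * b + c * c"
  have N: "N = 1 \<or> N = 2 \<or> N = 4" using u(2) kh by (auto simp: good_def N_def)
  have "\<exists>t. t * N = 2 * (a * x + b * y + c * z)"
  proof (cases "N = 4")
    case False
    then have "N = 1 \<or> N = 2" using N by blast
    then show ?thesis
      using exI[of "\<lambda>t. t * N = 2 * (a * x + b * y + c * z)" "2 * (a * x + b * y + c * z)"]
        exI[of "\<lambda>t. t * N = 2 * (a * x + b * y + c * z)" "a * x + b * y + c * z"] by fastforce
  next
    case True
    \<comment> \<open>Squared norm 4 is possible only with a single entry +-2, so dividing by it
      still leaves an integral coefficient.\<close>
    have "even a \<and> even b \<and> even c"
      using good_bound[OF u(2)] True unfolding N_def by (elim insertE emptyE) simp_all
    then obtain a' b' c' where "a = 2 * a'" "b = 2 * b'" "c = 2 * c'" by (auto elim!: evenE)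
    then show ?thesis using True by (intro exI[of _ "a' * x + b' * y + c' * z"]) (simp add: algebra_simps)
  qed
  then obtain t where t: "t * N = 2 * (a * x + b * y + c * z)" by blast
  have "reflect u v = vec (x - t * a) (y - t * b) (z - t * c)"
    unfolding u v using t N by (intro reflect_vec) (auto simp: N_def)
  moreover have "(x - t * a) * (x - t * a) + (y - t * b) * (y - t * b) + (z - t * c) * (z - t * c)
      = x * x + y * y + z * z + t * (t * N - 2 * (a * x + b * y + c * z))"
    by (simp add: N_def algebra_simps)
  then have "good (x - t * a) (y - t * b) (z - t * c)" using v(2) t by (simp add: good_def)
  ultimately show ?thesis unfolding S_good by blast
qed

definition base where "base = {e1 - e2, e2 - e3, real k *\<^sub>R e3}"

lemma independent_base: "independent base"
proof (rule independent_dual)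
  fix g assume "g \<in> base"
  then consider "g = e1 - e2" | "g = e2 - e3" | "g = real k *\<^sub>R e3" by (auto simp: base_def)
  then show "\<exists>w. w \<bullet> g \<noteq> 0 \<and> (\<forall>h\<in>base - {g}. w \<bullet> h = 0)"
  proof cases
    case 1
    then show ?thesis using kappa
      by (intro exI[of _ e1]) (auto simp: base_def inner_diff_right inner_add_left ip)
  next
    case 2
    then show ?thesis using kappa
      by (intro exI[of _ "e1 + e2"]) (auto simp: base_def inner_diff_right inner_add_left ip)
  next
    case 3
    then show ?thesis using kappa hk
      by (intro exI[of _ "e1 + e2 + e3"]) (auto simp: base_def inner_diff_right inner_add_left ip)
  qed
qed

lemma C_nonneg: "C \<subseteq> nonneg_comb base"
proof -
  have g: "real p *\<^sub>R (e1 - e2) + real q *\<^sub>R (e2 - e3) + real r *\<^sub>R (real k *\<^sub>R e3) \<in> nonneg_comb base" for p q r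
    by (intro nonneg_comb_add nonneg_comb_scale nonneg_comb_base) (auto simp: base_def)
  have "e1 + e2 \<in> nonneg_comb base" "e1 + e3 \<in> nonneg_comb base" "e2 + e3 \<in> nonneg_comb base"
    "e1 - e2 \<in> nonneg_comb base" "e1 - e3 \<in> nonneg_comb base" "e2 - e3 \<in> nonneg_comb base"
    "real k *\<^sub>R e1 \<in> nonneg_comb base" "real k *\<^sub>R e2 \<in> nonneg_comb base" "real k *\<^sub>R e3 \<in> nonneg_comb base"
    using g[of 1 2 h] g[of 1 1 h] g[of 0 1 h] g[of 1 0 0] g[of 1 1 0] g[of 0 1 0] g[of k k 1] g[of 0 k 1] g[of 0 0 1]
    by (simp_all add: hk algebra_simps scaleR_2)
  then show ?thesis by (simp add: C_def coords_BC_def)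
qed

lemma C_in_roots:
  assumes R: "\<And>a b. a \<in> R \<Longrightarrow> b \<in> R \<Longrightarrow> reflect a b \<in> R" and base: "base \<subseteq> R"
  shows "C \<subseteq> R"
proof -
  have b: "e1 - e2 \<in> R" "e2 - e3 \<in> R" "real k *\<^sub>R e3 \<in> R" using base by (auto simp: base_def)
  have 1: "real k *\<^sub>R e2 \<in> R" using R[OF b(2) b(3)] by simp
  have 2: "real k *\<^sub>R e1 \<in> R" using R[OF b(1) 1] by simp
  have 3: "e1 - e3 \<in> R" using R[OF b(1) b(2)] by simp
  have 4: "e2 + e3 \<in> R" using R[OF b(3) b(2)] by simp
  have 5: "e1 + e3 \<in> R" using R[OF b(3) 3] by simp
  have 6: "e1 + e2 \<in> R" using R[OF 1 b(1)] by simp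
  show ?thesis using b 1 2 3 4 5 6 by (simp add: C_def coords_BC_def)
qed

lemma has_type_base: "has_type (if k = 1 then TypeB 3 else TypeC 3) base"
proof -
  define a where "a i = (if i = 1 then e1 - e2 else if i = 2 then e2 - e3 else real k *\<^sub>R e3)" for i :: nat
  have i3: "{1..3::nat} = {1, 2, 3}" by auto
  have ne: "e1 - e2 \<noteq> e2 - e3" "e1 - e2 \<noteq> real k *\<^sub>R e3" "e2 - e3 \<noteq> real k *\<^sub>R e3"
  proof -
    have "e1 \<bullet> (e1 - e2) \<noteq> e1 \<bullet> (e2 - e3)" "e1 \<bullet> (e1 - e2) \<noteq> e1 \<bullet> (real k *\<^sub>R e3)"
      "e2 \<bullet> (e2 - e3) \<noteq> e2 \<bullet> (real k *\<^sub>R e3)"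
      using kappa by (simp_all add: inner_diff_right ip)
    then show "e1 - e2 \<noteq> e2 - e3" "e1 - e2 \<noteq> real k *\<^sub>R e3" "e2 - e3 \<noteq> real k *\<^sub>R e3" by metis+
  qed
  have r: "rank (if k = 1 then TypeB 3 else TypeC 3) = 3" by simp
  have bij: "bij_betw a {1..3} base"
    unfolding i3 bij_betw_def using ne by (auto simp: a_def base_def inj_on_def)
  have "cartan_number (a i) (a j) = of_int (cartan_matrix (if k = 1 then TypeB 3 else TypeC 3) i j)"
    if "i \<in> {1..3}" "j \<in> {1..3}" for i j
    using that kh kappa unfolding i3
    by (elim insertE emptyE) (simp_all add: a_def cartan_number_def cartan_matrix_def inner_diff_left inner_diff_right ip)
  then show ?thesis unfolding has_type_def r using bij by blast
qed

text \<open>A palindrome around \<open>e2 - e3\<close> for the reflection in \<open>e1 + e2\<close>,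
  chosen so that its \<lambda>-sequence is the displayed one.\<close>

definition word where "word = [e2 - e3, real k *\<^sub>R e3, e1 - e2, e2 - e3, e1 - e2, real k *\<^sub>R e3, e2 - e3]"

lemma lambda_word:
  "lambda_seq word = [e2 - e3, real k *\<^sub>R e2, e1 - e3, e1 + e2, e2 + e3, real k *\<^sub>R e1, e1 + e3]"
  by (simp add: word_def lambda_seq_Cons add.commute)

end

text \<open>A palindrome is a conjugate of the reflection in its middle letter, hence the reflection
  in the image of this letter.\<close>

lemma word_map_palindrome: "word_map (us @ b # rev us) x = reflect (word_map (rev us) b) x"
  using reflect_conjugate[OF linear_word_map, of "rev us" b "word_map us x"] by simp

lemma (in frame3) word_map_word: "word_map word = reflect (e1 + e2)"
proof
  fix x
  have "word = [e2 - e3, real k *\<^sub>R e3, e1 - e2] @ (e2 - e3) # rev [e2 - e3, real k *\<^sub>R e3, e1 - e2]"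
    by (simp add: word_def)
  moreover have "word_map (rev [e2 - e3, real k *\<^sub>R e3, e1 - e2]) (e2 - e3) = e1 + e2" by simp
  ultimately show "word_map word x = reflect (e1 + e2) x" using word_map_palindrome by metis
qed

subsection \<open>Type D4\<close>

definition coords_D4 :: "'a::real_vector \<Rightarrow> 'a \<Rightarrow> 'a \<Rightarrow> 'a \<Rightarrow> 'a set" where
  "coords_D4 e1 e2 e3 e4 = {e1 + e2, e1 + e3, e1 + e4, e2 + e3, e2 + e4, e3 + e4,
     e1 - e2, e1 - e3, e1 - e4, e2 - e3, e2 - e4, e3 - e4}"

lemma coord_roots_D4: "coord_roots_D 4 \<epsilon> = coords_D4 (\<epsilon> 1) (\<epsilon> 2) (\<epsilon> 3) (\<epsilon> 4)"
  unfolding coord_roots_D_def pairs4 coords_D4_def by blast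

locale frame4 =
  fixes e1 e2 e3 e4 :: "'a::euclidean_space" and \<kappa> :: real
  assumes kappa: "0 < \<kappa>"
    and ip: "e1 \<bullet> e1 = \<kappa>" "e2 \<bullet> e2 = \<kappa>" "e3 \<bullet> e3 = \<kappa>" "e4 \<bullet> e4 = \<kappa>"
      "e1 \<bullet> e2 = 0" "e1 \<bullet> e3 = 0" "e1 \<bullet> e4 = 0" "e2 \<bullet> e3 = 0" "e2 \<bullet> e4 = 0" "e3 \<bullet> e4 = 0"
      "e2 \<bullet> e1 = 0" "e3 \<bullet> e1 = 0" "e4 \<bullet> e1 = 0" "e3 \<bullet> e2 = 0" "e4 \<bullet> e2 = 0" "e4 \<bullet> e3 = 0"
begin

definition C where "C = coords_D4 e1 e2 e3 e4"

lemma refl_basis [simp]: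
  "reflect (e1 - e2) e1 = e2" "reflect (e1 - e2) e2 = e1" "reflect (e1 - e2) e3 = e3" "reflect (e1 - e2) e4 = e4"
  "reflect (e2 - e3) e1 = e1" "reflect (e2 - e3) e2 = e3" "reflect (e2 - e3) e3 = e2" "reflect (e2 - e3) e4 = e4"
  "reflect (e3 - e4) e1 = e1" "reflect (e3 - e4) e2 = e2" "reflect (e3 - e4) e3 = e4" "reflect (e3 - e4) e4 = e3"
  "reflect (e3 + e4) e1 = e1" "reflect (e3 + e4) e2 = e2" "reflect (e3 + e4) e3 = - e4" "reflect (e3 + e4) e4 = - e3"
  using kappa by (simp_all add: reflect_def inner_diff_left inner_diff_right inner_add_left inner_add_right ip)

definition vec where
  "vec a b c d = real_of_int a *\<^sub>R e1 + real_of_int b *\<^sub>R e2 + real_of_int c *\<^sub>R e3 + real_of_int d *\<^sub>R e4"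

lemma inner_vec: "vec a b c d \<bullet> vec x y z w = \<kappa> * real_of_int (a * x + b * y + c * z + d * w)"
  by (simp add: vec_def inner_add_left inner_add_right ip algebra_simps)

definition good where "good a b c d \<longleftrightarrow> a * a + b * b + c * c + d * d = (2 :: int)"

lemma reflect_vec:
  fixes x y z w :: int
  assumes "good a b c d"
  defines "t \<equiv> a * x + b * y + c * z + d * w"
  shows "reflect (vec a b c d) (vec x y z w) = vec (x - t * a) (y - t * b) (z - t * c) (w - t * d)"
proof -
  have "vec x y z w \<bullet> vec a b c d = \<kappa> * real_of_int t"
    by (simp only: inner_vec t_def mult.commute[of x a] mult.commute[of y b] mult.commute[of z c] mult.commute[of w d])
  moreover have "vec a b c d \<bullet> vec a b c d = \<kappa> * 2"
    unfolding inner_vec using assms(1) unfolding good_def by (simp only: of_int_numeral)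
  ultimately have "reflect (vec a b c d) (vec x y z w) = vec x y z w - real_of_int t *\<^sub>R vec a b c d"
    using kappa by (simp add: reflect_def)
  then show ?thesis by (simp add: vec_def algebra_simps)
qed

definition tuples :: "(int \<times> int \<times> int \<times> int) set" where
  "tuples = {(1,1,0,0), (1,0,1,0), (1,0,0,1), (0,1,1,0), (0,1,0,1), (0,0,1,1),
    (1,-1,0,0), (1,0,-1,0), (1,0,0,-1), (0,1,-1,0), (0,1,0,-1), (0,0,1,-1)}"

lemma C_tuples: "C = (\<lambda>(a, b, c, d). vec a b c d) ` tuples"
  by (simp add: C_def coords_D4_def tuples_def vec_def)

lemma good_tuples:
  assumes "good a b c d" shows "(a, b, c, d) \<in> tuples \<or> (- a, - b, - c, - d) \<in> tuples"
proof -
  have sq: "v \<in> {-1,0,1}" if "v * v \<le> 2" for v :: int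
  proof -
    have "\<bar>v\<bar> < 2" using that abs_le_square_iff[of 2 v] by (simp add: power2_eq_square)
    then show ?thesis by auto
  qed
  have "0 \<le> a * a" "0 \<le> b * b" "0 \<le> c * c" "0 \<le> d * d" by simp_all
  then have "a * a \<le> 2" "b * b \<le> 2" "c * c \<le> 2" "d * d \<le> 2" using assms unfolding good_def by linarith+
  then have "a \<in> {-1,0,1}" "b \<in> {-1,0,1}" "c \<in> {-1,0,1}" "d \<in> {-1,0,1}" using sq by blast+
  then show ?thesis using assms unfolding good_def tuples_def
    by (elim insertE emptyE) simp_all
qed

lemma tuples_good: "(a, b, c, d) \<in> tuples \<Longrightarrow> good a b c d"
  by (auto simp: tuples_def good_def)

lemma S_good: "C \<union> uminus ` C = {vec a b c d |a b c d. good a b c d}"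
proof
  have neg: "- vec a b c d = vec (- a) (- b) (- c) (- d)" for a b c d by (simp add: vec_def)
  have m: "good (- a) (- b) (- c) (- d) = good a b c d" for a b c d by (simp add: good_def)
  have 1: "C \<subseteq> {vec a b c d |a b c d. good a b c d}" unfolding C_tuples using tuples_good by fastforce
  moreover have "- u \<in> {vec a b c d |a b c d. good a b c d}" if "u \<in> {vec a b c d |a b c d. good a b c d}" for u
    using that m neg by blast
  ultimately show "C \<union> uminus ` C \<subseteq> {vec a b c d |a b c d. good a b c d}" by blast
  show "{vec a b c d |a b c d. good a b c d} \<subseteq> C \<union> uminus ` C"
  proof clarify
    fix a b c d assume g: "good a b c d" and n: "vec a b c d \<notin> uminus ` C"
    from good_tuples[OF g] show "vec a b c d \<in> C"
    proof
      assume "(- a, - b, - c, - d) \<in> tuples"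
      then have "vec (- a) (- b) (- c) (- d) \<in> C" by (force simp: C_tuples)
      then have "- vec (- a) (- b) (- c) (- d) \<in> uminus ` C" by blast
      then show ?thesis using n neg by simp
    qed (force simp: C_tuples)
  qed
qed

lemma closed:
  assumes "u \<in> C \<union> uminus ` C" "v \<in> C \<union> uminus ` C" shows "reflect u v \<in> C \<union> uminus ` C"
proof -
  from assms obtain a b c d x y z w where u: "u = vec a b c d" "good a b c d" and v: "v = vec x y z w" "good x y z w"
    unfolding S_good by auto
  define t where "t = a * x + b * y + c * z + d * w"
  have "reflect u v = vec (x - t * a) (y - t * b) (z - t * c) (w - t * d)"
    unfolding u v t_def by (rule reflect_vec[OF u(2)])
  moreover have "(x - t * a) * (x - t * a) + (y - t * b) * (y - t * b) + (z - t * c) * (z - t * c) + (w - t * d) * (w - t * d)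
      = x * x + y * y + z * z + w * w + t * (t * (a * a + b * b + c * c + d * d) - 2 * t)"
    by (simp add: algebra_simps) (simp add: t_def algebra_simps)
  then have "good (x - t * a) (y - t * b) (z - t * c) (w - t * d)" using u(2) v(2) by (simp add: good_def)
  ultimately show ?thesis unfolding S_good by blast
qed

definition base where "base = {e1 - e2, e2 - e3, e3 - e4, e3 + e4}"

lemma independent_base: "independent base"
proof (rule independent_dual)
  fix g assume "g \<in> base"
  then consider "g = e1 - e2" | "g = e2 - e3" | "g = e3 - e4" | "g = e3 + e4" by (auto simp: base_def)
  then show "\<exists>w. w \<bullet> g \<noteq> 0 \<and> (\<forall>h\<in>base - {g}. w \<bullet> h = 0)"
  proof cases
    case 1
    then show ?thesis using kappa
      by (intro exI[of _ e1]) (auto simp: base_def inner_diff_right inner_add_left inner_add_right ip)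
  next
    case 2
    then show ?thesis using kappa
      by (intro exI[of _ "e1 + e2"]) (auto simp: base_def inner_diff_right inner_add_left inner_add_right ip)
  next
    case 3
    then show ?thesis using kappa
      by (intro exI[of _ "e1 + e2 + e3 - e4"]) (auto simp: base_def inner_diff_right inner_diff_left inner_add_left inner_add_right ip)
  next
    case 4
    then show ?thesis using kappa
      by (intro exI[of _ "e1 + e2 + e3 + e4"]) (auto simp: base_def inner_diff_right inner_add_left inner_add_right ip)
  qed
qed

lemma C_nonneg: "C \<subseteq> nonneg_comb base"
proof -
  have g: "real p *\<^sub>R (e1 - e2) + real q *\<^sub>R (e2 - e3) + real r *\<^sub>R (e3 - e4) + real s *\<^sub>R (e3 + e4) \<in> nonneg_comb base" for p q r s
    by (intro nonneg_comb_add nonneg_comb_scale nonneg_comb_base) (auto simp: base_def)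
  have "e1 + e2 \<in> nonneg_comb base" "e1 + e3 \<in> nonneg_comb base" "e1 + e4 \<in> nonneg_comb base"
    "e2 + e3 \<in> nonneg_comb base" "e2 + e4 \<in> nonneg_comb base" "e3 + e4 \<in> nonneg_comb base"
    "e1 - e2 \<in> nonneg_comb base" "e1 - e3 \<in> nonneg_comb base" "e1 - e4 \<in> nonneg_comb base"
    "e2 - e3 \<in> nonneg_comb base" "e2 - e4 \<in> nonneg_comb base" "e3 - e4 \<in> nonneg_comb base"
    using g[of 1 2 1 1] g[of 1 1 1 1] g[of 1 1 0 1] g[of 0 1 1 1] g[of 0 1 0 1] g[of 0 0 0 1]
      g[of 1 0 0 0] g[of 1 1 0 0] g[of 1 1 1 0] g[of 0 1 0 0] g[of 0 1 1 0] g[of 0 0 1 0]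
    by (simp_all add: algebra_simps scaleR_2)
  then show ?thesis by (simp add: C_def coords_D4_def)
qed

lemma C_in_roots:
  assumes R: "\<And>a b. a \<in> R \<Longrightarrow> b \<in> R \<Longrightarrow> reflect a b \<in> R" and base: "base \<subseteq> R"
  shows "C \<subseteq> R"
proof -
  have b: "e1 - e2 \<in> R" "e2 - e3 \<in> R" "e3 - e4 \<in> R" "e3 + e4 \<in> R" using base by (auto simp: base_def)
  have 1: "e1 - e3 \<in> R" using R[OF b(1) b(2)] by simp
  have 2: "e2 - e4 \<in> R" using R[OF b(2) b(3)] by simp
  have 3: "e2 + e4 \<in> R" using R[OF b(2) b(4)] by simp
  have 4: "e1 - e4 \<in> R" using R[OF b(1) 2] by simp
  have 5: "e1 + e4 \<in> R" using R[OF b(1) 3] by simp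
  have 6: "e2 + e3 \<in> R" using R[OF b(4) 2] by simp
  have 7: "e1 + e3 \<in> R" using R[OF b(1) 6] by simp
  have 8: "e1 + e2 \<in> R" using R[OF b(2) 7] by simp
  show ?thesis using b 1 2 3 4 5 6 7 8 by (simp add: C_def coords_D4_def)
qed

lemma has_type_base: "has_type (TypeD 4) base"
proof -
  define a where "a i = (if i = 1 then e1 - e2 else if i = 2 then e2 - e3 else if i = 3 then e3 - e4 else e3 + e4)" for i :: nat
  have i4: "{1..4::nat} = {1, 2, 3, 4}" by auto
  have ne: "e1 - e2 \<noteq> e2 - e3" "e1 - e2 \<noteq> e3 - e4" "e1 - e2 \<noteq> e3 + e4" "e2 - e3 \<noteq> e3 - e4" "e2 - e3 \<noteq> e3 + e4" "e3 - e4 \<noteq> e3 + e4"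
  proof -
    have "e1 \<bullet> (e1 - e2) \<noteq> e1 \<bullet> (e2 - e3)" "e1 \<bullet> (e1 - e2) \<noteq> e1 \<bullet> (e3 - e4)" "e1 \<bullet> (e1 - e2) \<noteq> e1 \<bullet> (e3 + e4)"
      "e2 \<bullet> (e2 - e3) \<noteq> e2 \<bullet> (e3 - e4)" "e2 \<bullet> (e2 - e3) \<noteq> e2 \<bullet> (e3 + e4)" "e4 \<bullet> (e3 - e4) \<noteq> e4 \<bullet> (e3 + e4)"
      using kappa by (simp_all add: inner_diff_right inner_add_right ip)
    then show "e1 - e2 \<noteq> e2 - e3" "e1 - e2 \<noteq> e3 - e4" "e1 - e2 \<noteq> e3 + e4" "e2 - e3 \<noteq> e3 - e4" "e2 - e3 \<noteq> e3 + e4" "e3 - e4 \<noteq> e3 + e4"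
      by metis+
  qed
  have bij: "bij_betw a {1..4} base"
    unfolding i4 bij_betw_def using ne by (auto simp: a_def base_def inj_on_def)
  have "cartan_number (a i) (a j) = of_int (cartan_matrix (TypeD 4) i j)"
    if "i \<in> {1..4}" "j \<in> {1..4}" for i j
    using that kappa unfolding i4
    by (elim insertE emptyE) (simp_all add: a_def cartan_number_def cartan_matrix_def inner_diff_left inner_diff_right inner_add_left inner_add_right ip)
  then show ?thesis unfolding has_type_def rank.simps using bij by blast
qed

text \<open>The middle letter is \<open>e1 - e2\<close>. The word is a palindrome only up to the
  order of the commuting letters \<open>e3 - e4\<close> and \<open>e3 + e4\<close>, which the
  displayed sequence dictates.\<close>

definition word where "word = [e2 - e3, e3 - e4, e3 + e4, e2 - e3, e1 - e2, e2 - e3, e3 - e4, e3 + e4, e2 - e3]"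

lemma lambda_word:
  "lambda_seq word = [e2 - e3, e2 - e4, e2 + e4, e2 + e3, e1 + e2, e1 - e3, e1 + e4, e1 - e4, e1 + e3]"
  by (simp add: word_def lambda_seq_Cons add.commute)

lemma word_map_word: "word_map word = reflect (e1 + e2)"
proof
  fix x
  have "word_map ([e2 - e3, e3 - e4, e3 + e4, e2 - e3] @ (e1 - e2) # rev [e2 - e3, e3 - e4, e3 + e4, e2 - e3]) x
      = reflect (e1 + e2) x"
    by (subst word_map_palindrome) simp
  moreover have "reflect (e3 + e4) (reflect (e3 - e4) y) = reflect (e3 - e4) (reflect (e3 + e4) y)" for y
    using reflect_conjugate[OF linear_reflect inner_reflect, of "e3 - e4" "e3 + e4" y] by (simp add: add.commute)
  ultimately show "word_map word x = reflect (e1 + e2) x" by (simp add: word_def)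
qed

end

section \<open>Lengths of roots\<close>

text \<open>A degenerate height: the sum of all coordinates except that at \<open>a\<close>. It
  corresponds to a point in the interior of the wall of \<open>a\<close>.\<close>

lemma (in based_roots) wall_functional:
  assumes "a \<in> \<Delta>"
  obtains f :: "'a \<Rightarrow> real" where "linear f" "f a = 0" "\<And>x. x \<in> P \<Longrightarrow> x \<noteq> a \<Longrightarrow> 0 < f x"
    "\<And>x. x \<in> P \<Longrightarrow> 0 \<le> f x"
proof -
  obtain f :: "'a \<Rightarrow> real" where f: "linear f" "\<And>b. b \<in> \<Delta> \<Longrightarrow> f b = (if b = a then 0 else 1)"
    using functional_exists[of "\<lambda>b. if b = a then 0 else 1"] by blast
  have fx: "f x = (\<Sum>b\<in>\<Delta>. co b x * f b)" "\<And>b. b \<in> \<Delta> \<Longrightarrow> 0 \<le> co b x * f b" if "x \<in> P" for x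
    using linear_expand[OF pos_root[OF that] f(1)] co_nonneg[OF pos_nonneg[OF that]] f(2) by auto
  have "0 < f x" if x: "x \<in> P" "x \<noteq> a" for x
  proof -
    obtain b where b: "b \<in> \<Delta>" "b \<noteq> a" "0 < co b x" using pos_other_coefficient[OF assms x] by blast
    have "co b x * f b \<le> f x" unfolding fx(1)[OF x(1)] using b fx(2)[OF x(1)] base_finite by (intro member_le_sum) auto
    then show ?thesis using b f(2) by simp
  qed
  moreover have "f a = 0" using f assms by simp
  ultimately show ?thesis using f(1) by (intro that[of f]) (auto simp: order_le_less)
qed

lemma (in based_roots) nonneg_comb_antisym:
  assumes "x \<in> nonneg_comb \<Delta>" "- x \<in> nonneg_comb \<Delta>" shows "x = 0"
proof -
  obtain c :: "'a \<Rightarrow> nat" where c: "x = (\<Sum>a\<in>\<Delta>. real (c a) *\<^sub>R a)" "\<And>a. a \<in> \<Delta> \<Longrightarrow> co a x = c a"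
    using nonneg_comb_functional[OF assms(1)] by metis
  have "real (c a) = 0" if "a \<in> \<Delta>" for a
    using c(2)[OF that] co_nonneg[OF assms(2) that] by simp
  then show ?thesis using c(1) by simp
qed

lemma (in based_roots) maximal_root_unique:
  assumes "maximal_root \<Delta> A \<theta>" "maximal_root \<Delta> A \<theta>'" shows "\<theta> = \<theta>'"
proof -
  have "\<theta> - \<theta>' \<in> nonneg_comb \<Delta>" "- (\<theta> - \<theta>') \<in> nonneg_comb \<Delta>"
    using assms by (auto simp: maximal_root_def)
  then show ?thesis using nonneg_comb_antisym[of "\<theta> - \<theta>'"] by simp
qed

text \<open>The span of the roots of a different length is invariant under the Weyl group.\<close>

lemma nonorthogonal_other_length:
  assumes R: "root_system R" and irr: "irreducible_roots R" and \<alpha>: "\<alpha> \<in> R"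
    and y: "y \<in> R" "y \<bullet> y \<noteq> \<alpha> \<bullet> \<alpha>"
  shows "\<exists>e\<in>R. e \<bullet> e \<noteq> \<alpha> \<bullet> \<alpha> \<and> e \<bullet> \<alpha> \<noteq> 0"
proof (rule ccontr)
  assume n: "\<not> ?thesis"
  note D = root_systemD[OF R]
  define V where "V = span {e \<in> R. e \<bullet> e \<noteq> \<alpha> \<bullet> \<alpha>}"
  have V: "x \<in> V" if "x \<in> R" "e \<in> R" "e \<bullet> e \<noteq> \<alpha> \<bullet> \<alpha>" "e \<bullet> x \<noteq> 0" for x e
  proof -
    have "reflect x e \<in> {e \<in> R. e \<bullet> e \<noteq> \<alpha> \<bullet> \<alpha>}" using D(3) that by simp
    then have "e - reflect x e \<in> V" unfolding V_def using that by (intro span_diff span_base) auto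
    then have "cartan_number e x *\<^sub>R x \<in> V" by (simp add: reflect_cartan)
    then have "(1 / cartan_number e x) *\<^sub>R cartan_number e x *\<^sub>R x \<in> V" unfolding V_def by (rule span_scale)
    moreover have "cartan_number e x \<noteq> 0" using that D(2) by (auto simp: cartan_number_def)
    ultimately show ?thesis by simp
  qed
  have "\<alpha> \<notin> V"
  proof
    assume "\<alpha> \<in> V"
    then have "orthogonal \<alpha> \<alpha>" unfolding V_def
      by (rule orthogonal_to_span) (use n in \<open>auto simp: orthogonal_def inner_commute\<close>)
    then show False using \<alpha> D(2) by (auto simp: orthogonal_def)
  qed
  have "\<exists>A B. A \<noteq> {} \<and> B \<noteq> {} \<and> A \<inter> B = {} \<and> A \<union> B = R \<and> (\<forall>a\<in>A. \<forall>b\<in>B. a \<bullet> b = 0)"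
  proof (intro exI conjI ballI)
    show "R \<inter> V \<noteq> {}" using y by (auto simp: V_def intro: span_base)
    show "R - V \<noteq> {}" using \<alpha> \<open>\<alpha> \<notin> V\<close> by blast
    show "R \<inter> V \<inter> (R - V) = {}" "R \<inter> V \<union> (R - V) = R" by auto
    fix a b assume a: "a \<in> R \<inter> V" and b: "b \<in> R - V"
    have "orthogonal b a" using a unfolding V_def
      by (intro orthogonal_to_span[of a "{e \<in> R. e \<bullet> e \<noteq> \<alpha> \<bullet> \<alpha>}"])
        (use V[of b] b in \<open>auto simp: orthogonal_def inner_commute\<close>)
    then show "a \<bullet> b = 0" by (simp add: orthogonal_def inner_commute)
  qed
  then show False using irr by (simp add: irreducible_roots_def)
qed

section \<open>Non-gatherable triples\<close>

text \<open>\<open>\<kappa>\<close> is half the squared length of the triple, long or short; which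
  of the two it is shows only in the lengths of the other roots.\<close>

locale triple_word = based_roots R \<Delta> for R \<Delta> :: "'a::euclidean_space set" +
  fixes ws :: "'a list" and q r :: nat and \<alpha> \<beta> :: 'a and \<kappa> :: real
  assumes ws: "red ws" and qr: "0 < r" "r < q" "q < length ws"
    and seq: "lambda_seq ws ! 0 = \<alpha>" "lambda_seq ws ! r = \<alpha> + \<beta>" "lambda_seq ws ! q = \<beta>"
    and \<kappa>: "0 < \<kappa>" "\<alpha> \<bullet> \<alpha> = 2 * \<kappa>" "\<beta> \<bullet> \<beta> = 2 * \<kappa>" "(\<alpha> + \<beta>) \<bullet> (\<alpha> + \<beta>) = 2 * \<kappa>"
begin

definition ts where "ts = take (Suc q) ws"

definition N where "N = inv ts"

lemma ts: "red ts" "set ts \<subseteq> \<Delta>" "length ts = Suc q"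
  using red_take[OF ws] red_set qr by (auto simp: ts_def)

lemma seg_lambda: "segment 0 q (lambda_seq ws) = lambda_seq ts"
  by (simp add: segment_def take_lambda_seq ts_def)

lemma seg_N: "set (segment 0 q (lambda_seq ws)) = N"
  unfolding seg_lambda N_def by (rule red_lambda[OF ts(1)])

lemma lambda_ts: "i \<le> q \<Longrightarrow> lambda_seq ts ! i = lambda_seq ws ! i"
  by (simp add: ts_def flip: take_lambda_seq)

lemma mem_N: "\<alpha> \<in> N" "\<beta> \<in> N" "\<alpha> + \<beta> \<in> N"
proof -
  have "lambda_seq ws ! i \<in> N" if "i \<le> q" for i
    using that ts(3) lambda_ts[OF that] red_lambda[OF ts(1)] unfolding N_def
    by (metis length_lambda_seq le_imp_less_Suc nth_mem)
  then show "\<alpha> \<in> N" "\<beta> \<in> N" "\<alpha> + \<beta> \<in> N" using seq qr by (metis le0, metis order_refl, metis less_imp_le)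
qed

lemma mem_P: "\<alpha> \<in> P" "\<beta> \<in> P" "\<alpha> + \<beta> \<in> P"
  using mem_N by (auto simp: N_def lambda_set_def)

lemma inner_ab: "\<alpha> \<bullet> \<beta> = - \<kappa>" "\<beta> \<bullet> \<alpha> = - \<kappa>"
  using \<kappa> by (auto simp: inner_add_left inner_add_right inner_commute)

lemma alpha_base: "\<alpha> \<in> \<Delta>"
proof -
  have "\<alpha> = ws ! 0" using seq(1) qr by (subst (asm) lambda_seq_nth) auto
  moreover have "ws ! 0 \<in> set ws" using qr by (cases ws) auto
  ultimately show ?thesis using red_set[OF ws] by auto
qed

text \<open>One linear form whose sign decides which positive roots lie in the segment, so that
  statements about \<open>N\<close> become linear arithmetic.\<close>

definition sgnf where "sgnf x = ht (word_map ts x)"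

lemma linear_sgnf: "linear sgnf"
  unfolding sgnf_def using linear_compose[OF linear_word_map linear_ht] by (simp add: o_def)

lemmas sgnf_simps [simp] = linear_add[OF linear_sgnf] linear_diff[OF linear_sgnf]
  linear_neg[OF linear_sgnf] linear_scale[OF linear_sgnf]

lemma sgnf_N: "x \<in> P \<Longrightarrow> x \<in> N \<longleftrightarrow> sgnf x < 0"
  using mem_inv_ht[OF ts(2)] by (simp add: N_def sgnf_def)

lemma sgnf_not_N: "x \<in> P \<Longrightarrow> x \<notin> N \<longleftrightarrow> 0 < sgnf x"
proof -
  assume x: "x \<in> P"
  have r: "word_map ts x \<in> R" using word_map_root[OF ts(2)] pos_root x by blast
  have "sgnf x \<noteq> 0" unfolding sgnf_def
    using pos_cases[OF r] ht_pos[of "word_map ts x"] ht_pos[of "- word_map ts x"] by auto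
  then show ?thesis using sgnf_N[OF x] by linarith
qed

text \<open>\<open>f1\<close> is the degenerate height at the wall \<alpha> of the fundamental
  chamber. Since \<open>ts\<close> sends \<beta> to \<open>- j\<close>, where \<open>j\<close> is
  its last letter, the degenerate height at \<open>j\<close> pulled back by \<open>ts\<close>
  vanishes at \<beta>; this is \<open>f2\<close>. A root is positive for both exactly when it is
  positive and remains so under \<open>ts\<close>.\<close>

lemma functionals:
  "\<exists>(f1 :: 'a \<Rightarrow> real) (f2 :: 'a \<Rightarrow> real). linear f1 \<and> linear f2 \<and>
    (\<forall>x. x \<in> R \<longrightarrow> f1 x = 0 \<longrightarrow> x = \<alpha> \<or> x = - \<alpha>) \<and> (\<forall>x. x \<in> R \<longrightarrow> f2 x = 0 \<longrightarrow> x = \<beta> \<or> x = - \<beta>) \<and>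
    f1 \<alpha> = 0 \<and> f2 \<beta> = 0 \<and> 0 < f1 \<beta> \<and> f2 \<alpha> < 0 \<and>
    (\<forall>x. x \<in> R \<longrightarrow> (0 < f1 x \<and> 0 < f2 x \<longleftrightarrow> x \<in> P - N))"
proof -
  obtain f1 :: "'a \<Rightarrow> real" where f1: "linear f1" "f1 \<alpha> = 0" "\<And>x. x \<in> P \<Longrightarrow> x \<noteq> \<alpha> \<Longrightarrow> 0 < f1 x"
    "\<And>x. x \<in> P \<Longrightarrow> 0 \<le> f1 x"
    using wall_functional[OF alpha_base] by metis
  define j where "j = ws ! q"
  have j: "j \<in> \<Delta>" using red_set[OF ws] qr by (auto simp: j_def)
  have "ts = take q ws @ [j]" using qr by (simp add: ts_def j_def take_Suc_conv_app_nth)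
  moreover have "word_map (take q ws) \<beta> = j"
    using seq(3) qr by (subst (asm) lambda_seq_nth) (auto simp: j_def)
  ultimately have wb: "word_map ts \<beta> = - j" by simp
  obtain g :: "'a \<Rightarrow> real" where g: "linear g" "g j = 0" "\<And>x. x \<in> P \<Longrightarrow> x \<noteq> j \<Longrightarrow> 0 < g x"
    "\<And>x. x \<in> P \<Longrightarrow> 0 \<le> g x"
    using wall_functional[OF j] by metis
  define f2 where "f2 x = g (word_map ts x)" for x
  have lin2: "linear f2" unfolding f2_def using linear_compose[OF linear_word_map g(1)] by (simp add: o_def)
  have wR: "word_map ts x \<in> R" if "x \<in> R" for x using word_map_root[OF ts(2) that] .
  have wj: "word_map ts x = j \<longleftrightarrow> x = - \<beta>" "word_map ts x = - j \<longleftrightarrow> x = \<beta>" for x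
    using wb by (metis word_map_inj word_map_linear_simps(3) minus_minus)+
  have zero: "x = a \<or> x = - a" if "x \<in> R" "f x = 0" "linear f" "\<And>x. x \<in> P \<Longrightarrow> x \<noteq> a \<Longrightarrow> 0 < f x"
    for x a and f :: "'a \<Rightarrow> real"
  proof (cases "x \<in> P")
    case True then show ?thesis using that(2) that(4)[of x] by auto
  next
    case False
    then have "- x \<in> P" using neg_iff that by blast
    then show ?thesis using that(2) that(4)[of "- x"] linear_neg[OF that(3)] by (metis less_irrefl minus_minus neg_0_equal_iff_equal)
  qed
  have N: "x \<in> N \<longleftrightarrow> x \<in> P \<and> word_map ts x \<notin> P" for x unfolding N_def by (rule mem_inv[OF ts(2)])
  show ?thesis
  proof (rule exI[of _ f1], rule exI[of _ f2], intro conjI allI impI)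
    show "linear f1" "linear f2" "f1 \<alpha> = 0" by fact+
    show "x = \<alpha> \<or> x = - \<alpha>" if "x \<in> R" "f1 x = 0" for x using zero[OF that f1(1) f1(3)] .
    show "x = \<beta> \<or> x = - \<beta>" if "x \<in> R" "f2 x = 0" for x
      using zero[of "word_map ts x" g j] wR[OF that(1)] that(2) g(1,3) wj unfolding f2_def by blast
    show "f2 \<beta> = 0" using wb g(2) linear_neg[OF g(1)] by (simp add: f2_def)
    have "\<beta> \<noteq> \<alpha>" using \<kappa> inner_ab by auto
    then show "0 < f1 \<beta>" using f1(3) mem_P by blast
    have "- word_map ts \<alpha> \<in> P" using mem_N(1) by (auto simp: N_def lambda_set_def)
    moreover have "- word_map ts \<alpha> \<noteq> j" using wj(2)[of \<alpha>] \<open>\<beta> \<noteq> \<alpha>\<close> by auto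
    ultimately show "f2 \<alpha> < 0" using g(3)[of "- word_map ts \<alpha>"] linear_neg[OF g(1)] by (simp add: f2_def)
    fix x assume x: "x \<in> R"
    show "0 < f1 x \<and> 0 < f2 x \<longleftrightarrow> x \<in> P - N"
    proof
      assume p: "0 < f1 x \<and> 0 < f2 x"
      have "x \<in> P"
      proof (rule ccontr)
        assume "x \<notin> P"
        then have "- x \<in> P" using neg_iff x by blast
        then show False using f1(4)[of "- x"] p linear_neg[OF f1(1)] by simp
      qed
      moreover have "word_map ts x \<in> P"
      proof (rule ccontr)
        assume "word_map ts x \<notin> P"
        then have "- word_map ts x \<in> P" using neg_iff wR[OF x] by blast
        then show False using g(4)[of "- word_map ts x"] p linear_neg[OF g(1)] by (simp add: f2_def)
      qed
      ultimately show "x \<in> P - N" using N by blast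
    next
      assume p: "x \<in> P - N"
      then have "x \<noteq> \<alpha>" using mem_N by blast
      moreover have "word_map ts x \<in> P" using p N by blast
      moreover have "word_map ts x \<noteq> j"
      proof
        assume "word_map ts x = j"
        then have "x = - \<beta>" using wj by blast
        then show False using p pos_not_neg mem_P by blast
      qed
      ultimately show "0 < f1 x \<and> 0 < f2 x" using f1(3) g(3) p by (simp add: f2_def)
    qed
  qed
qed

abbreviation gatherable where "gatherable \<equiv> gatherable_inside \<Delta> ws 0 q {\<alpha>, \<beta>, \<alpha> + \<beta>}"

text \<open>The form that exists for a gatherable triple is negative on the left of the relation and
  nonnegative on the right. Three terms with real coefficients fit D4 as well as B3 and C3.\<close>

lemma not_gatherable_if_relation:
  assumes "\<beta> - \<alpha> = c1 *\<^sub>R d1 + c2 *\<^sub>R d2 + c3 *\<^sub>R d3" "0 \<le> c1" "0 \<le> c2" "0 \<le> c3"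
    and "{d1, d2, d3} \<subseteq> P - N"
  shows "\<not> gatherable"
proof
  assume g: gatherable
  obtain f :: "'a \<Rightarrow> real" where f: "linear f" "f (\<beta> - \<alpha>) < 0" "\<And>d. d \<in> P - inv (take (Suc q) ws) \<Longrightarrow> 0 \<le> f d"
    using no_relation_if_gatherable[OF ws _ \<kappa>(1,2,3) inner_ab(1) _ _ _ g] mem_N qr unfolding N_def ts_def by (metis Suc_leI)
  have "0 \<le> c1 * f d1 + c2 * f d2 + c3 * f d3"
    using assms f(3) unfolding N_def ts_def by (intro add_nonneg_nonneg mult_nonneg_nonneg) auto
  moreover have "f (\<beta> - \<alpha>) = c1 * f d1 + c2 * f d2 + c3 * f d3"
    unfolding assms(1) by (simp add: linear_add[OF f(1)] linear_scale[OF f(1)])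
  ultimately show False using f(2) by simp
qed

lemma separated_gatherable:
  assumes "\<And>z. z \<in> R \<Longrightarrow> z \<in> span {\<alpha>, \<beta>} \<Longrightarrow> z \<in> {\<alpha>, - \<alpha>, \<beta>, - \<beta>, \<alpha> + \<beta>, - (\<alpha> + \<beta>)}"
    and "x \<bullet> \<alpha> = 0" "x \<bullet> \<beta> = 0" "\<And>d. d \<in> P - N \<Longrightarrow> 0 < x \<bullet> d"
  shows gatherable
  using gatherable_if_separated[OF ws _ \<kappa>(1,2,3) inner_ab(1) assms(1) _ _ _ assms(2,3), of q]
    mem_N qr assms(4) unfolding N_def ts_def by simp

lemma relation_if_not_gatherable:
  assumes n: "\<And>x. x \<in> R \<Longrightarrow> x \<bullet> x = \<kappa> \<or> x \<bullet> x = 2 * \<kappa>" and ng: "\<not> gatherable"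
  obtains f1 f2 x y z where "triple_core R \<alpha> \<beta> \<kappa> f1 f2" "triple_core.M R f1 f2 = P - N"
    "{x, y, z} \<subseteq> P - N" "triple_core.tA \<alpha> \<beta> \<kappa> x" "triple_core.tA \<alpha> \<beta> \<kappa> y" "triple_core.tA \<alpha> \<beta> \<kappa> z"
    "x + y + z = \<beta> - \<alpha>"
proof -
  obtain f1 f2 :: "'a \<Rightarrow> real" where f: "linear f1" "linear f2"
    "\<And>x. x \<in> R \<Longrightarrow> f1 x = 0 \<Longrightarrow> x = \<alpha> \<or> x = - \<alpha>" "\<And>x. x \<in> R \<Longrightarrow> f2 x = 0 \<Longrightarrow> x = \<beta> \<or> x = - \<beta>"
    "f1 \<alpha> = 0" "f2 \<beta> = 0" "0 < f1 \<beta>" "f2 \<alpha> < 0"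
    "\<And>x. x \<in> R \<Longrightarrow> 0 < f1 x \<and> 0 < f2 x \<longleftrightarrow> x \<in> P - N" using functionals by blast
  have core: "triple_core R \<alpha> \<beta> \<kappa> f1 f2"
  proof (rule triple_core.intro)
    show "\<alpha> \<in> R" "\<beta> \<in> R" "\<alpha> + \<beta> \<in> R" using mem_P pos_root by auto
  qed (fact rs n \<kappa> f)+
  interpret triple_core R \<alpha> \<beta> \<kappa> f1 f2 by (rule core)
  have M: "M = P - N" using f(9) pos_root by (auto simp: M_def)
  have "\<not> (\<exists>x. x \<bullet> \<alpha> = 0 \<and> x \<bullet> \<beta> = 0 \<and> (\<forall>d\<in>M. 0 < x \<bullet> d))"
    using separated_gatherable[OF plane_roots] ng unfolding M by blast
  then obtain X where "relation X" using separation_or_relation by blast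
  then obtain x y z where "{x, y, z} \<subseteq> M" "tA x" "tA y" "tA z" "x + y + z = \<beta> - \<alpha>"
    using relation_triple by blast
  then show ?thesis using that core M by metis
qed

text \<open>The product of each root with the sum is already exhausted by its own squared length. So
  any two of the three mutual products add up to 0, and all of them vanish.\<close>

lemma simply_laced_obstruction:
  assumes n: "\<And>x. x \<in> R \<Longrightarrow> x \<bullet> x = 2 * \<kappa>" and ng: "\<not> gatherable"
  obtains x y z where "{x, y, z} \<subseteq> P - N" "x + y + z = \<beta> - \<alpha>" "x \<bullet> y = 0" "x \<bullet> z = 0" "y \<bullet> z = 0"
    "x \<bullet> \<alpha> = - \<kappa>" "y \<bullet> \<alpha> = - \<kappa>" "z \<bullet> \<alpha> = - \<kappa>"
proof -
  have n': "\<And>x. x \<in> R \<Longrightarrow> x \<bullet> x = \<kappa> \<or> x \<bullet> x = 2 * \<kappa>" using n by blast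
  obtain f1 f2 x y z where *: "triple_core R \<alpha> \<beta> \<kappa> f1 f2"
    "{x, y, z} \<subseteq> P - N" "triple_core.tA \<alpha> \<beta> \<kappa> x" "triple_core.tA \<alpha> \<beta> \<kappa> y" "triple_core.tA \<alpha> \<beta> \<kappa> z"
    "x + y + z = \<beta> - \<alpha>" using relation_if_not_gatherable[OF n' ng] by metis
  interpret triple_core R \<alpha> \<beta> \<kappa> f1 f2 by (rule *)
  have R: "x \<bullet> x = 2 * \<kappa>" "y \<bullet> y = 2 * \<kappa>" "z \<bullet> z = 2 * \<kappa>" using *(2) n pos_root by auto
  have "x \<bullet> (x + y + z) = 2 * \<kappa>" "y \<bullet> (x + y + z) = 2 * \<kappa>" "z \<bullet> (x + y + z) = 2 * \<kappa>"
    unfolding *(6) using tA_inner *(3-5) by auto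
  then have "x \<bullet> y + x \<bullet> z = 0" "x \<bullet> y + y \<bullet> z = 0" "x \<bullet> z + y \<bullet> z = 0"
    using R by (simp_all add: inner_add_right inner_commute)
  then have "x \<bullet> y = 0" "x \<bullet> z = 0" "y \<bullet> z = 0" by linarith+
  then show ?thesis using that *(2-6) by (auto simp: tA_def)
qed

lemma long_obstruction:
  assumes n: "\<And>x. x \<in> R \<Longrightarrow> x \<bullet> x = \<kappa> \<or> x \<bullet> x = 2 * \<kappa>" and ng: "\<not> gatherable"
    and e0: "e0 \<in> R" "e0 \<bullet> e0 = \<kappa>" "e0 \<bullet> \<alpha> \<noteq> 0"
  obtains d e where "d \<in> P - N" "e \<in> P - N" "d \<bullet> d = 2 * \<kappa>" "e \<bullet> e = \<kappa>" "d + 2 *\<^sub>R e = \<beta> - \<alpha>"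
    "d \<bullet> \<alpha> = - \<kappa>" "e \<bullet> \<alpha> = - \<kappa>"
proof -
  obtain f1 f2 x y z where *: "triple_core R \<alpha> \<beta> \<kappa> f1 f2" "triple_core.M R f1 f2 = P - N"
    "{x, y, z} \<subseteq> P - N" "triple_core.tA \<alpha> \<beta> \<kappa> x" "triple_core.tA \<alpha> \<beta> \<kappa> y" "triple_core.tA \<alpha> \<beta> \<kappa> z"
    "x + y + z = \<beta> - \<alpha>" using relation_if_not_gatherable[OF n ng] by metis
  interpret triple_core R \<alpha> \<beta> \<kappa> f1 f2 by (rule *)
  obtain d e where de: "d \<in> M" "e \<in> M" "d \<bullet> d = 2 * \<kappa>" "e \<bullet> e = \<kappa>" "d + 2 *\<^sub>R e = \<beta> - \<alpha>"
    using long_short_pair[OF _ *(4-7) e0] *(3) unfolding *(2) by blast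
  have "d \<bullet> \<alpha> = - \<kappa>" "e \<bullet> \<alpha> = - \<kappa>" using long_short_types[OF de] by auto
  then show ?thesis using that de unfolding *(2) by blast
qed

text \<open>In the dual system \<open>Q\<close> the triple is long, and the elements of
  \<open>Q\<close> are positive multiples of the roots of \<open>R\<close>, so functionals,
  \<open>M\<close> and separating points correspond. The short root of the resulting relation is
  half of a long root \<open>g\<close> of \<open>R\<close>, which absorbs the coefficient 2.\<close>

lemma short_obstruction:
  assumes n: "\<And>x. x \<in> R \<Longrightarrow> x \<bullet> x = 2 * \<kappa> \<or> x \<bullet> x = 4 * \<kappa>" and ng: "\<not> gatherable"
    and e0: "e0 \<in> R" "e0 \<bullet> e0 = 4 * \<kappa>" "e0 \<bullet> \<alpha> \<noteq> 0"
  obtains d g where "d \<in> P - N" "g \<in> P - N" "d \<bullet> d = 2 * \<kappa>" "g \<bullet> g = 4 * \<kappa>" "d + g = \<beta> - \<alpha>"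
    "d \<bullet> \<alpha> = - \<kappa>" "g \<bullet> \<alpha> = - 2 * \<kappa>"
proof -
  obtain f1 f2 :: "'a \<Rightarrow> real" where f: "linear f1" "linear f2"
    "\<And>x. x \<in> R \<Longrightarrow> f1 x = 0 \<Longrightarrow> x = \<alpha> \<or> x = - \<alpha>" "\<And>x. x \<in> R \<Longrightarrow> f2 x = 0 \<Longrightarrow> x = \<beta> \<or> x = - \<beta>"
    "f1 \<alpha> = 0" "f2 \<beta> = 0" "0 < f1 \<beta>" "f2 \<alpha> < 0"
    "\<And>x. x \<in> R \<Longrightarrow> 0 < f1 x \<and> 0 < f2 x \<longleftrightarrow> x \<in> P - N" using functionals by blast
  let ?s = "halve_long \<kappa>"
  define Q where "Q = ?s ` R"
  have s_short: "?s x = x" if "x \<bullet> x = 2 * \<kappa>" for x using that \<kappa>(1) by (simp add: halve_long_def)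
  have s_scale: "\<exists>c>0. ?s x = c *\<^sub>R x" for x
    by (cases "x \<bullet> x = 4 * \<kappa>") (auto simp: halve_long_def intro: exI[of _ "1/2"] exI[of _ 1])
  have sf: "f (?s x) = 0 \<longleftrightarrow> f x = 0" "0 < f (?s x) \<longleftrightarrow> 0 < f x" if "linear f" for x and f :: "'a \<Rightarrow> real"
    using s_scale[of x] linear_scale[OF that] by (auto simp: zero_less_mult_iff)
  have sQ: "\<alpha> \<in> Q" "\<beta> \<in> Q" "\<alpha> + \<beta> \<in> Q"
    using s_short \<kappa> mem_P pos_root unfolding Q_def by (metis imageI)+
  have nQ: "x \<bullet> x = \<kappa> \<or> x \<bullet> x = 2 * \<kappa>" if "x \<in> Q" for x
    using that n \<kappa>(1) by (auto simp: Q_def halve_long_def)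
  have mono: "?s x = \<alpha> \<Longrightarrow> x = \<alpha>" "?s x = - \<alpha> \<Longrightarrow> x = - \<alpha>" "?s x = \<beta> \<Longrightarrow> x = \<beta>" "?s x = - \<beta> \<Longrightarrow> x = - \<beta>"
    "?s x = \<alpha> + \<beta> \<Longrightarrow> x = \<alpha> + \<beta>" "?s x = - (\<alpha> + \<beta>) \<Longrightarrow> x = - (\<alpha> + \<beta>)" if "x \<in> R" for x
  proof -
    have *: "x = v" if "?s x = v" "v \<bullet> v = 2 * \<kappa>" for v
    proof -
      have "?s x \<bullet> ?s x = 2 * \<kappa>" using that by simp
      then have "x \<bullet> x \<noteq> 4 * \<kappa>" using \<kappa>(1) by (auto simp: halve_long_def)
      then show ?thesis using that by (simp add: halve_long_def)
    qed
    show "?s x = \<alpha> \<Longrightarrow> x = \<alpha>" "?s x = - \<alpha> \<Longrightarrow> x = - \<alpha>" "?s x = \<beta> \<Longrightarrow> x = \<beta>" "?s x = - \<beta> \<Longrightarrow> x = - \<beta>"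
      "?s x = \<alpha> + \<beta> \<Longrightarrow> x = \<alpha> + \<beta>" "?s x = - (\<alpha> + \<beta>) \<Longrightarrow> x = - (\<alpha> + \<beta>)"
      by (rule *, assumption, simp only: inner_minus_left inner_minus_right minus_minus \<kappa>)+
  qed
  have sneg: "?s (- x) = - ?s x" for x by (simp add: halve_long_def)
  have core: "triple_core Q \<alpha> \<beta> \<kappa> f1 f2"
  proof (rule triple_core.intro)
    show "root_system Q" unfolding Q_def by (rule dual_root_system[OF rs \<kappa>(1) n])
    show "x = \<alpha> \<or> x = - \<alpha>" if x: "x \<in> Q" "f1 x = 0" for x
    proof -
      obtain x' where x': "x' \<in> R" "x = ?s x'" using x(1) by (auto simp: Q_def)
      then have "x' = \<alpha> \<or> x' = - \<alpha>" using f(3) x(2) sf(1)[OF f(1)] by simp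
      then show ?thesis using x'(2) by (elim disjE) (simp_all add: sneg s_short[OF \<kappa>(2)])
    qed
    show "x = \<beta> \<or> x = - \<beta>" if x: "x \<in> Q" "f2 x = 0" for x
    proof -
      obtain x' where x': "x' \<in> R" "x = ?s x'" using x(1) by (auto simp: Q_def)
      then have "x' = \<beta> \<or> x' = - \<beta>" using f(4) x(2) sf(1)[OF f(2)] by simp
      then show ?thesis using x'(2) by (elim disjE) (simp_all add: sneg s_short[OF \<kappa>(3)])
    qed
  qed (fact nQ sQ \<kappa> f)+
  interpret triple_core Q \<alpha> \<beta> \<kappa> f1 f2 by (rule core)
  have M: "M = ?s ` (P - N)"
  proof -
    have "M = ?s ` {x \<in> R. 0 < f1 x \<and> 0 < f2 x}"
      unfolding M_def unfolding Q_def using sf(2)[OF f(1)] sf(2)[OF f(2)] by auto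
    also have "{x \<in> R. 0 < f1 x \<and> 0 < f2 x} = P - N" using f(9) pos_root by blast
    finally show ?thesis .
  qed
  \<comment> \<open>Gathering takes place in \<open>R\<close>, so the planar roots of
    \<open>R\<close> are needed; they are pulled back along the scaling.\<close>
  have plane: "z \<in> {\<alpha>, - \<alpha>, \<beta>, - \<beta>, \<alpha> + \<beta>, - (\<alpha> + \<beta>)}" if z: "z \<in> R" "z \<in> span {\<alpha>, \<beta>}" for z
  proof -
    obtain c where "?s z = c *\<^sub>R z" using s_scale by blast
    then have "?s z \<in> span {\<alpha>, \<beta>}" using span_scale[OF z(2)] by simp
    moreover have "?s z \<in> Q" using z by (simp add: Q_def)
    ultimately have "?s z \<in> {\<alpha>, - \<alpha>, \<beta>, - \<beta>, \<alpha> + \<beta>, - (\<alpha> + \<beta>)}" by (intro plane_roots)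
    then show ?thesis using mono[OF z(1)] by blast
  qed
  have "\<not> (\<exists>x. x \<bullet> \<alpha> = 0 \<and> x \<bullet> \<beta> = 0 \<and> (\<forall>d\<in>M. 0 < x \<bullet> d))"
  proof
    assume "\<exists>x. x \<bullet> \<alpha> = 0 \<and> x \<bullet> \<beta> = 0 \<and> (\<forall>d\<in>M. 0 < x \<bullet> d)"
    then obtain x where x: "x \<bullet> \<alpha> = 0" "x \<bullet> \<beta> = 0" "\<And>d. d \<in> P - N \<Longrightarrow> 0 < x \<bullet> ?s d" unfolding M by blast
    have "0 < x \<bullet> d" if "d \<in> P - N" for d
    proof -
      obtain c where "0 < c" "?s d = c *\<^sub>R d" using s_scale by blast
      then show ?thesis using x(3)[OF that] by (simp add: zero_less_mult_iff)
    qed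
    then show False using separated_gatherable[OF plane x(1,2)] ng by blast
  qed
  then obtain X where "relation X" using separation_or_relation by blast
  then obtain x y z where xyz: "{x, y, z} \<subseteq> M" "tA x" "tA y" "tA z" "x + y + z = \<beta> - \<alpha>"
    using relation_triple by blast
  have "?s e0 \<in> Q" "?s e0 \<bullet> ?s e0 = \<kappa>" "?s e0 \<bullet> \<alpha> \<noteq> 0" using e0 by (auto simp: Q_def halve_long_def)
  then obtain d e where de: "d \<in> M" "e \<in> M" "d \<bullet> d = 2 * \<kappa>" "e \<bullet> e = \<kappa>" "d + 2 *\<^sub>R e = \<beta> - \<alpha>"
    using long_short_pair[OF xyz] by blast
  have t: "d \<bullet> \<alpha> = - \<kappa>" "e \<bullet> \<alpha> = - \<kappa>" using long_short_types[OF de] by auto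
  obtain d' e' where d': "d' \<in> P - N" "d = ?s d'" and e': "e' \<in> P - N" "e = ?s e'" using de(1,2) unfolding M by blast
  have "d' = d" using de(3) d'(2) \<kappa>(1) by (auto simp: halve_long_def split: if_splits)
  moreover have "e' = 2 *\<^sub>R e"
  proof -
    have "e' \<bullet> e' = 4 * \<kappa>"
    proof (rule ccontr)
      assume h: "e' \<bullet> e' \<noteq> 4 * \<kappa>"
      then have "e' \<bullet> e' = 2 * \<kappa>" using n[OF pos_root] e'(1) by blast
      then show False using h e'(2) de(4) \<kappa>(1) by (simp add: halve_long_def)
    qed
    then show ?thesis using e'(2) by (simp add: halve_long_def)
  qed
  ultimately show ?thesis using that[of d' e'] d'(1) e'(1) de t by simp
qed

end

section \<open>Coordinate subsystems\<close>

lemma norm_eq_inner: "norm x = norm y \<longleftrightarrow> x \<bullet> x = y \<bullet> y"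
  by (simp add: norm_eq_sqrt_inner)

context based_roots
begin

lemma coord_subsystem_BC:
  assumes frame: "frame3 e1 e2 e3 \<kappa> k h" and base: "frame3.base e1 e2 e3 k \<subseteq> P"
  defines "C \<equiv> frame3.C e1 e2 e3 k"
  defines "\<epsilon> \<equiv> \<lambda>i::nat. if i = 1 then e1 else if i = 2 then e2 else e3"
  shows "coord_subsystem R \<Delta> (if k = 1 then TypeB 3 else TypeC 3) (C \<union> uminus ` C) (frame3.base e1 e2 e3 k) \<epsilon>"
proof -
  interpret f: frame3 e1 e2 e3 \<kappa> k h by (rule frame)
  have C: "C = f.C" by (simp add: C_def)
  have bR: "f.base \<subseteq> R" using base pos_root by blast
  have bC: "f.base \<subseteq> f.C" by (auto simp: f.base_def f.C_def coords_BC_def)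
  note s = subsystem_from_coords[OF f.C_in_roots[OF root_reflect bR] f.closed bC base f.independent_base f.C_nonneg]
  have e: "\<epsilon> 1 = e1" "\<epsilon> 2 = e2" "\<epsilon> 3 = e3" by (simp_all add: \<epsilon>_def)
  have i3: "{1..3::nat} = {1, 2, 3}" by auto
  have fr: "orthogonal_frame 3 \<epsilon>"
    unfolding orthogonal_frame_def i3 using f.ip f.kappa by (auto simp: \<epsilon>_def norm_eq_inner)
  have "standard_coords (if k = 1 then TypeB 3 else TypeC 3) \<epsilon> f.C"
  proof (cases "k = 1")
    case True
    then show ?thesis unfolding f.C_def using fr by (simp add: coord_roots_B3 e[unfolded One_nat_def])
  next
    case False
    then have "k = 2" using f.kh by auto
    then show ?thesis unfolding f.C_def using fr by (simp add: coord_roots_C3 e[unfolded One_nat_def])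
  qed
  then show ?thesis
    unfolding coord_subsystem_def C using s f.has_type_base by simp
qed

text \<open>The coordinates prescribe only the positive roots, and the base has to be recovered from
  them. In the height of \<open>S\<close> no element of \<open>C\<close> outside \<open>base\<close>
  has height 1, so \<Gamma> is contained in \<open>base\<close>, and the cardinalities
  agree.\<close>

lemma coord_subsystem_BC_D:
  assumes Y: "(Y, k, h) \<in> {(TypeB 3, 1, 2), (TypeC 3, 2, 1::nat)}" and c: "coord_subsystem R \<Delta> Y S \<Gamma> \<epsilon>"
    and E: "e1 = \<epsilon> 1" "e2 = \<epsilon> 2" "e3 = \<epsilon> 3"
  shows "frame3 e1 e2 e3 (e1 \<bullet> e1) k h" "based_roots S \<Gamma>" "S \<subseteq> R" "pos_roots S \<Gamma> = S \<inter> P"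
    "S \<inter> P = frame3.C e1 e2 e3 k" "\<Gamma> = frame3.base e1 e2 e3 k"
    "coord_factor Y = real k"
proof -
  have fr: "orthogonal_frame 3 \<epsilon>" and SP: "S \<inter> P = coords_BC (real k) e1 e2 e3"
    using c Y unfolding E by (auto simp: coord_subsystem_def coord_roots_B3 coord_roots_C3)
  have fr': "norm (\<epsilon> i) = norm (\<epsilon> j) \<and> (i \<noteq> j \<longrightarrow> \<epsilon> i \<bullet> \<epsilon> j = 0)" if "i \<in> {1..3}" "j \<in> {1..3}" for i j
    using fr that unfolding orthogonal_frame_def by blast
  have "\<epsilon> 1 \<noteq> 0" using fr by (auto simp: orthogonal_frame_def)
  then have "e1 \<noteq> 0" "norm e2 = norm e1" "norm e3 = norm e1" "e1 \<bullet> e2 = 0" "e1 \<bullet> e3 = 0" "e2 \<bullet> e3 = 0"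
    unfolding E using fr'[of 2 1] fr'[of 3 1] fr'[of 1 2] fr'[of 1 3] fr'[of 2 3] by simp_all
  then show frame: "frame3 e1 e2 e3 (e1 \<bullet> e1) k h"
    using Y by unfold_locales (auto simp: norm_eq_inner inner_commute)
  interpret f: frame3 e1 e2 e3 "e1 \<bullet> e1" k h by (rule frame)
  show S: "based_roots S \<Gamma>" "S \<subseteq> R" "pos_roots S \<Gamma> = S \<inter> P"
    using c unfolding coord_subsystem_def based_roots_def by auto
  show C: "S \<inter> P = f.C" unfolding f.C_def by (rule SP)
  show "coord_factor Y = real k" using Y by auto
  interpret S: based_roots S \<Gamma> by (rule S)
  define a b d where "a = S.ht e1" and "b = S.ht e2" and "d = S.ht e3"
  have "1 \<le> S.ht x" if "x \<in> f.C" for x using S.ht_pos[of x] that C S(3) by simp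
  from this[of "e1 - e2"] this[of "e2 - e3"] this[of "real k *\<^sub>R e3"]
  have h: "1 \<le> a - b" "1 \<le> b - d" "1 \<le> real k * d" unfolding f.C_def coords_BC_def by (simp_all add: a_def b_def d_def)
  have kk: "real k = 1 \<or> real k = 2" using Y by auto
  then have pos: "0 < d" "1 < b" "2 < a" using h by auto
  have ne: "a + b \<noteq> 1" "a + d \<noteq> 1" "b + d \<noteq> 1" "a - d \<noteq> 1" "real k * a \<noteq> 1" "real k * b \<noteq> 1"
    using h pos kk by auto
  have "\<Gamma> \<subseteq> f.base"
  proof
    fix g assume g: "g \<in> \<Gamma>"
    have "S.ht g = 1" by (rule S.ht_base[OF g])
    moreover have "g \<in> f.C" using S.base_pos[OF g] C S(3) by simp
    ultimately show "g \<in> f.base"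
      using ne unfolding f.C_def coords_BC_def f.base_def a_def b_def d_def by auto
  qed
  moreover have "card \<Gamma> = 3" using has_type_card c Y unfolding coord_subsystem_def by fastforce
  moreover have "card f.base \<le> 3" unfolding f.base_def by (simp add: card_insert_if)
  moreover have "finite f.base" unfolding f.base_def by simp
  ultimately show "\<Gamma> = f.base" by (intro S.base_eqI) auto
qed

lemma coord_subsystem_D4:
  assumes frame: "frame4 e1 e2 e3 e4 \<kappa>" and base: "frame4.base e1 e2 e3 e4 \<subseteq> P"
  defines "C \<equiv> frame4.C e1 e2 e3 e4"
  defines "\<epsilon> \<equiv> \<lambda>i::nat. if i = 1 then e1 else if i = 2 then e2 else if i = 3 then e3 else e4"
  shows "coord_subsystem R \<Delta> (TypeD 4) (C \<union> uminus ` C) (frame4.base e1 e2 e3 e4) \<epsilon>"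
proof -
  interpret f: frame4 e1 e2 e3 e4 \<kappa> by (rule frame)
  have C: "C = f.C" by (simp add: C_def)
  have bR: "f.base \<subseteq> R" using base pos_root by blast
  have bC: "f.base \<subseteq> f.C" by (auto simp: f.base_def f.C_def coords_D4_def)
  note s = subsystem_from_coords[OF f.C_in_roots[OF root_reflect bR] f.closed bC base f.independent_base f.C_nonneg]
  have e: "\<epsilon> 1 = e1" "\<epsilon> 2 = e2" "\<epsilon> 3 = e3" "\<epsilon> 4 = e4" by (simp_all add: \<epsilon>_def)
  have i4: "{1..4::nat} = {1, 2, 3, 4}" by auto
  have fr: "orthogonal_frame 4 \<epsilon>"
    unfolding orthogonal_frame_def i4 using f.ip f.kappa by (auto simp: \<epsilon>_def norm_eq_inner)
  have "standard_coords (TypeD 4) \<epsilon> f.C"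
    unfolding f.C_def using fr by (simp add: coord_roots_D4 e[unfolded One_nat_def])
  then show ?thesis
    unfolding coord_subsystem_def C using s f.has_type_base by simp
qed

lemma coord_subsystem_D4_D:
  assumes c: "coord_subsystem R \<Delta> (TypeD 4) S \<Gamma> \<epsilon>"
    and E: "e1 = \<epsilon> 1" "e2 = \<epsilon> 2" "e3 = \<epsilon> 3" "e4 = \<epsilon> 4"
  shows "frame4 e1 e2 e3 e4 (e1 \<bullet> e1)" "based_roots S \<Gamma>" "S \<subseteq> R" "pos_roots S \<Gamma> = S \<inter> P"
    "S \<inter> P = frame4.C e1 e2 e3 e4" "\<Gamma> = frame4.base e1 e2 e3 e4"
proof -
  have fr: "orthogonal_frame 4 \<epsilon>" and SP: "S \<inter> P = coords_D4 e1 e2 e3 e4"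
    using c unfolding E by (auto simp: coord_subsystem_def coord_roots_D4)
  have fr': "norm (\<epsilon> i) = norm (\<epsilon> j) \<and> (i \<noteq> j \<longrightarrow> \<epsilon> i \<bullet> \<epsilon> j = 0)" if "i \<in> {1..4}" "j \<in> {1..4}" for i j
    using fr that unfolding orthogonal_frame_def by blast
  have "\<epsilon> 1 \<noteq> 0" using fr by (auto simp: orthogonal_frame_def)
  then have "e1 \<noteq> 0" "norm e2 = norm e1" "norm e3 = norm e1" "norm e4 = norm e1"
    "e1 \<bullet> e2 = 0" "e1 \<bullet> e3 = 0" "e1 \<bullet> e4 = 0" "e2 \<bullet> e3 = 0" "e2 \<bullet> e4 = 0" "e3 \<bullet> e4 = 0"
    unfolding E using fr'[of 2 1] fr'[of 3 1] fr'[of 4 1] fr'[of 1 2] fr'[of 1 3] fr'[of 1 4]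
      fr'[of 2 3] fr'[of 2 4] fr'[of 3 4] by simp_all
  then show frame: "frame4 e1 e2 e3 e4 (e1 \<bullet> e1)"
    by unfold_locales (auto simp: norm_eq_inner inner_commute)
  interpret f: frame4 e1 e2 e3 e4 "e1 \<bullet> e1" by (rule frame)
  show S: "based_roots S \<Gamma>" "S \<subseteq> R" "pos_roots S \<Gamma> = S \<inter> P"
    using c unfolding coord_subsystem_def based_roots_def by auto
  show C: "S \<inter> P = f.C" unfolding f.C_def by (rule SP)
  interpret S: based_roots S \<Gamma> by (rule S)
  define a b d e where "a = S.ht e1" and "b = S.ht e2" and "d = S.ht e3" and "e = S.ht e4"
  have "1 \<le> S.ht x" if "x \<in> f.C" for x using S.ht_pos[of x] that C S(3) by simp
  from this[of "e1 - e2"] this[of "e2 - e3"] this[of "e3 - e4"] this[of "e3 + e4"]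
  have h: "1 \<le> a - b" "1 \<le> b - d" "1 \<le> d - e" "1 \<le> d + e"
    unfolding f.C_def coords_D4_def by (simp_all add: a_def b_def d_def e_def)
  have ne: "a + b \<noteq> 1" "a + d \<noteq> 1" "a + e \<noteq> 1" "b + d \<noteq> 1" "b + e \<noteq> 1" "a - d \<noteq> 1" "a - e \<noteq> 1" "b - e \<noteq> 1"
    using h by auto
  have "\<Gamma> \<subseteq> f.base"
  proof
    fix g assume g: "g \<in> \<Gamma>"
    have "S.ht g = 1" by (rule S.ht_base[OF g])
    moreover have "g \<in> f.C" using S.base_pos[OF g] C S(3) by simp
    ultimately show "g \<in> f.base"
      using ne unfolding f.C_def coords_D4_def f.base_def a_def b_def d_def e_def by auto
  qed
  moreover have "card \<Gamma> = 4" using has_type_card c unfolding coord_subsystem_def by fastforce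
  moreover have "card f.base \<le> 4" unfolding f.base_def by (simp add: card_insert_if)
  moreover have "finite f.base" unfolding f.base_def by simp
  ultimately show "\<Gamma> = f.base" by (intro S.base_eqI) auto
qed

section \<open>Coxeter equivalence of sequences in terms of sets\<close>

lemma coxeter_equiv_seq_set:
  assumes "coxeter_equiv_seq \<Delta> xs ys" shows "set xs = set ys"
proof -
  obtain us vs where u: "reduced_decomposition \<Delta> (word_map us) us"
    "(coxeter_move \<Delta> 0 (length us))\<^sup>*\<^sup>* us vs" "lambda_seq us = xs" "lambda_seq vs = ys"
    using assms unfolding coxeter_equiv_seq_def by blast
  have red: "red us" using u(1) reduced_iff_red by blast
  note I = coxeter_moves_invariants[OF u(2) red_set[OF red]]
  then have "red vs" using red_same_map[OF red] by blast
  moreover have "inv us = inv vs" using I by simp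
  ultimately show ?thesis using red_lambda[OF red] red_lambda[of vs] u by simp
qed

text \<open>By the word property the class of a sequence is determined by its set. Thus the
  conditions on sequences become equalities of sets.\<close>

lemma coxeter_equiv_iff:
  assumes "red us" "red vs"
  shows "coxeter_equiv_seq \<Delta> (lambda_seq us) (lambda_seq vs) \<longleftrightarrow> inv us = inv vs"
proof
  assume "inv us = inv vs"
  then have m: "word_map us = word_map vs" using inv_inject assms red_set by blast
  then have "(coxeter_move \<Delta> 0 (length us))\<^sup>*\<^sup>* us vs" by (rule word_property[OF assms])
  moreover have "reduced_decomposition \<Delta> (word_map us) us" using assms(1) reduced_iff_red by blast
  ultimately show "coxeter_equiv_seq \<Delta> (lambda_seq us) (lambda_seq vs)" unfolding coxeter_equiv_seq_def by blast
next
  assume "coxeter_equiv_seq \<Delta> (lambda_seq us) (lambda_seq vs)"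
  then show "inv us = inv vs" using coxeter_equiv_seq_set red_lambda assms by metis
qed

end

section \<open>The criterion for types B, C, F\<close>

lemma (in based_roots) highest_root_BC:
  assumes Y: "(Y, k, h) \<in> {(TypeB 3, 1, 2), (TypeC 3, 2::nat, 1::nat)}" and c: "coord_subsystem R \<Delta> Y S \<Gamma> \<epsilon>"
  shows "\<exists>vs. reduced_decomposition \<Gamma> (reflect (\<epsilon> 1 + \<epsilon> 2)) vs \<and> lambda_seq vs = seq_BC3 (coord_factor Y) \<epsilon>"
    and "Y = TypeB 3 \<Longrightarrow> maximal_root \<Gamma> S (\<epsilon> 1 + \<epsilon> 2)"
    and "Y = TypeC 3 \<Longrightarrow> maximal_root \<Gamma> {x. short_root S x} (\<epsilon> 1 + \<epsilon> 2)"
proof -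
  define e1 e2 e3 \<kappa> where "e1 = \<epsilon> 1" and "e2 = \<epsilon> 2" and "e3 = \<epsilon> 3" and "\<kappa> = e1 \<bullet> e1"
  note D = coord_subsystem_BC_D[OF Y c e1_def e2_def e3_def, folded \<kappa>_def]
  interpret f: frame3 e1 e2 e3 \<kappa> k h by (rule D(1))
  interpret S: based_roots S \<Gamma> by (rule D(2))
  have SP: "S.P = f.C" using D by simp
  have "set f.word \<subseteq> \<Gamma>" unfolding D(6) f.word_def f.base_def by simp
  moreover have "set (lambda_seq f.word) \<subseteq> S.P" unfolding SP f.lambda_word f.C_def coords_BC_def by simp
  ultimately have word: "S.red f.word" by (rule S.redI)
  have seqw: "seq_BC3 (coord_factor Y) \<epsilon> = lambda_seq f.word"
    unfolding f.lambda_word seq_BC3_def D(7) by (simp add: e1_def e2_def e3_def)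
  show "\<exists>vs. reduced_decomposition \<Gamma> (reflect (\<epsilon> 1 + \<epsilon> 2)) vs \<and> lambda_seq vs = seq_BC3 (coord_factor Y) \<epsilon>"
    unfolding seqw using word f.word_map_word S.reduced_iff_red by (auto simp: e1_def e2_def)
  have CN: "x \<in> f.C \<Longrightarrow> x \<in> nonneg_comb \<Gamma>" for x using f.C_nonneg D(6) by auto
  have CS: "f.C \<subseteq> S" using D(5) by auto
  have th: "e1 + e2 \<in> f.C" by (simp add: f.C_def coords_BC_def)
  have mem: "e1 + e3 \<in> f.C" "e2 + e3 \<in> f.C" "e1 - e2 \<in> f.C" "e1 - e3 \<in> f.C" "e2 - e3 \<in> f.C"
    "real k *\<^sub>R e1 \<in> f.C" "real k *\<^sub>R e2 \<in> f.C" "real k *\<^sub>R e3 \<in> f.C"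
    by (simp_all add: f.C_def coords_BC_def)
  \<comment> \<open>The difference of \<open>e1 + e2\<close> and \<open>e1 - e2\<close> is
    \<open>2 e2\<close>, not a root of B3, but in both types the \<open>h\<close>-fold of the root
    \<open>k e2\<close>.\<close>
  have "real h *\<^sub>R real k *\<^sub>R e2 \<in> nonneg_comb \<Gamma>" by (rule nonneg_comb_scale[OF CN[OF mem(7)]])
  then have two: "2 *\<^sub>R e2 \<in> nonneg_comb \<Gamma>" by (simp add: f.hk)
  have D6: "e1 + e2 - x \<in> nonneg_comb \<Gamma>"
    if "x \<in> {e1 + e2, e1 + e3, e2 + e3, e1 - e2, e1 - e3, e2 - e3}" for x
    using that
  proof (elim insertE emptyE)
    assume "x = e1 + e2" then show ?thesis by (simp add: nonneg_comb_0)
  next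
    assume "x = e1 + e3" then have "e1 + e2 - x = e2 - e3" by simp
    then show ?thesis using CN mem by metis
  next
    assume "x = e2 + e3" then have "e1 + e2 - x = e1 - e3" by simp
    then show ?thesis using CN mem by metis
  next
    assume "x = e1 - e2" then have "e1 + e2 - x = 2 *\<^sub>R e2" by (simp add: scaleR_2)
    then show ?thesis using two by simp
  next
    assume "x = e1 - e3" then have "e1 + e2 - x = e2 + e3" by simp
    then show ?thesis using CN mem by metis
  next
    assume "x = e2 - e3" then have "e1 + e2 - x = e1 + e3" by simp
    then show ?thesis using CN mem by metis
  qed
  have neg: "e1 + e2 - x \<in> nonneg_comb \<Gamma>" if "- x \<in> f.C" for x
    using nonneg_comb_add[OF CN[OF th] CN[OF that]] by simp
  have Scases: "x \<in> S \<Longrightarrow> x \<in> f.C \<or> - x \<in> f.C" for x using S.pos_cases SP by simp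
  show "maximal_root \<Gamma> S (\<epsilon> 1 + \<epsilon> 2)" if "Y = TypeB 3"
  proof -
    have k: "k = 1" using Y that by auto
    have e: "e1 \<in> nonneg_comb \<Gamma>" "e2 \<in> nonneg_comb \<Gamma>" using CN[OF mem(6)] CN[OF mem(7)] k by simp_all
    have "e1 + e2 - x \<in> nonneg_comb \<Gamma>" if x: "x \<in> f.C" for x
    proof -
      consider "x \<in> {e1 + e2, e1 + e3, e2 + e3, e1 - e2, e1 - e3, e2 - e3}" | "x = e1" | "x = e2" | "x = e3"
        using x k unfolding f.C_def coords_BC_def by auto
      then show ?thesis
      proof cases
        case 4
        have "(e1 - e3) + e2 \<in> nonneg_comb \<Gamma>" by (rule nonneg_comb_add[OF CN[OF mem(4)] e(2)])
        then show ?thesis using 4 by (simp add: algebra_simps)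
      qed (use D6 e in simp_all)
    qed
    then show ?thesis using CS th Scases neg unfolding maximal_root_def e1_def[symmetric] e2_def[symmetric] by blast
  qed
  show "maximal_root \<Gamma> {x. short_root S x} (\<epsilon> 1 + \<epsilon> 2)" if "Y = TypeC 3"
  proof -
    have k: "k = 2" using Y that by auto
    have nC: "x \<bullet> x = 2 * \<kappa> \<and> x \<in> {e1 + e2, e1 + e3, e2 + e3, e1 - e2, e1 - e3, e2 - e3} \<or> x \<bullet> x = 4 * \<kappa>" if x: "x \<in> f.C" for x
      using x k unfolding f.C_def coords_BC_def
      by (auto simp: inner_add_left inner_add_right inner_diff_left inner_diff_right f.ip)
    have tt: "(e1 + e2) \<bullet> (e1 + e2) = 2 * \<kappa>" by (simp add: inner_add_left inner_add_right f.ip)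
    have S2: "2 * \<kappa> \<le> x \<bullet> x" if "x \<in> S" for x
      using Scases[OF that] nC[of x] nC[of "- x"] f.kappa by auto
    have "short_root S (e1 + e2)"
      unfolding short_root_def norm_eq_sqrt_inner tt using S2 CS th by auto
    moreover have "e1 + e2 - x \<in> nonneg_comb \<Gamma>" if x: "short_root S x" for x
    proof -
      have xS: "x \<in> S" "norm x \<le> norm (e1 + e2)" using x CS th unfolding short_root_def by auto
      then have "x \<bullet> x \<le> 2 * \<kappa>" unfolding norm_eq_sqrt_inner tt by simp
      then have "x \<bullet> x \<noteq> 4 * \<kappa>" using f.kappa by simp
      then show ?thesis using Scases[OF xS(1)] nC[of x] D6 neg by blast
    qed
    ultimately show ?thesis unfolding maximal_root_def e1_def[symmetric] e2_def[symmetric] by blast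
  qed
qed

lemma (in based_roots) highest_root_D4:
  assumes c: "coord_subsystem R \<Delta> (TypeD 4) S \<Gamma> \<epsilon>"
  shows "maximal_root \<Gamma> S (\<epsilon> 1 + \<epsilon> 2)"
proof -
  define e1 e2 e3 e4 \<kappa> where "e1 = \<epsilon> 1" and "e2 = \<epsilon> 2" and "e3 = \<epsilon> 3" and "e4 = \<epsilon> 4" and "\<kappa> = e1 \<bullet> e1"
  note D = coord_subsystem_D4_D[OF c e1_def e2_def e3_def e4_def, folded \<kappa>_def]
  interpret f: frame4 e1 e2 e3 e4 \<kappa> by (rule D(1))
  interpret S: based_roots S \<Gamma> by (rule D(2))
  have SP: "S.P = f.C" using D by simp
  have CN: "x \<in> f.C \<Longrightarrow> x \<in> nonneg_comb \<Gamma>" for x using f.C_nonneg D(6) by auto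
  have C: "f.C = {e1 + e2, e1 + e3, e1 + e4, e2 + e3, e2 + e4, e3 + e4,
     e1 - e2, e1 - e3, e1 - e4, e2 - e3, e2 - e4, e3 - e4}" by (simp add: f.C_def coords_D4_def)
  have th: "e1 + e2 \<in> f.C" by (simp add: C)
  have pos: "e1 + e2 - x \<in> nonneg_comb \<Gamma>" if x: "x \<in> f.C" for x
  proof -
    have one: ?thesis if "y \<in> f.C" "e1 + e2 - x = y" for y using CN that by simp
    have two: ?thesis if "y \<in> f.C" "z \<in> f.C" "e1 + e2 - x = y + z" for y z
      using nonneg_comb_add[OF CN[OF that(1)] CN[OF that(2)]] that(3) by simp
    show ?thesis using x unfolding C
    proof (elim insertE emptyE)
      assume "x = e1 + e2" then show ?thesis by (simp add: nonneg_comb_0)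
    next
      assume "x = e1 + e3" then show ?thesis by (intro one[of "e2 - e3"]) (simp_all add: C)
    next
      assume "x = e1 + e4" then show ?thesis by (intro one[of "e2 - e4"]) (simp_all add: C)
    next
      assume "x = e2 + e3" then show ?thesis by (intro one[of "e1 - e3"]) (simp_all add: C)
    next
      assume "x = e2 + e4" then show ?thesis by (intro one[of "e1 - e4"]) (simp_all add: C)
    next
      assume "x = e3 + e4" then show ?thesis by (intro two[of "e1 - e3" "e2 - e4"]) (simp_all add: C)
    next
      assume "x = e1 - e2" then show ?thesis by (intro two[of "e2 - e3" "e2 + e3"]) (simp_all add: C)
    next
      assume "x = e1 - e3" then show ?thesis by (intro one[of "e2 + e3"]) (simp_all add: C)
    next
      assume "x = e1 - e4" then show ?thesis by (intro one[of "e2 + e4"]) (simp_all add: C)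
    next
      assume "x = e2 - e3" then show ?thesis by (intro one[of "e1 + e3"]) (simp_all add: C)
    next
      assume "x = e2 - e4" then show ?thesis by (intro one[of "e1 + e4"]) (simp_all add: C)
    next
      assume "x = e3 - e4" then show ?thesis by (intro two[of "e1 - e3" "e2 + e4"]) (simp_all add: C)
    qed
  qed
  have neg: "e1 + e2 - x \<in> nonneg_comb \<Gamma>" if "- x \<in> f.C" for x
    using nonneg_comb_add[OF CN[OF th] CN[OF that]] by simp
  have "x \<in> S \<Longrightarrow> x \<in> f.C \<or> - x \<in> f.C" for x using S.pos_cases SP by simp
  moreover have "e1 + e2 \<in> S" using th D(5) by auto
  ultimately show ?thesis using pos neg unfolding maximal_root_def e1_def[symmetric] e2_def[symmetric] by blast
qed

context triple_word
begin

abbreviation restricted where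
  "restricted S \<equiv> filter (\<lambda>x. x \<in> S \<inter> P) (segment 0 q (lambda_seq ws))"

lemma restricted_word:
  assumes "based_roots S \<Gamma>" "S \<subseteq> R" "pos_roots S \<Gamma> = S \<inter> P"
  obtains us where "based_roots.red S \<Gamma> us" "lambda_seq us = restricted S" "lambda_set (S \<inter> P) (word_map us) = N \<inter> (S \<inter> P)"
proof -
  interpret S: based_roots S \<Gamma> by fact
  obtain us where us: "S.red us" "lambda_seq us = restricted S"
    using lambda_seq_filter[OF ts(1) assms] unfolding seg_lambda by blast
  have "S.inv us = set (restricted S)" using S.red_lambda[OF us(1)] us(2) by simp
  also have "\<dots> = N \<inter> (S \<inter> P)" using seg_N by auto
  finally show ?thesis using that us assms(3) by simp
qed

text \<open>The link is the equality \<open>N \<inter> f.C = W\<close>, where \<open>W\<close> is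
  the inversion set of the reflection in \<open>e1 + e2\<close>. From left to right, the signs of
  \<open>sgnf\<close> at the four given roots force its signs on all of \<open>W\<close>. From right
  to left, \<alpha> is simple in \<open>S\<close> and lies in \<open>W\<close>, so it is
  \<open>e2 - e3\<close>, and the given sum determines \<beta>. The reversed sequence leads to the
  same equality of sets.\<close>

lemma criterion_BC:
  assumes Y: "(Y, k, h) \<in> {(TypeB 3, 1, 2), (TypeC 3, 2::nat, 1::nat)}" and c: "coord_subsystem R \<Delta> Y S \<Gamma> \<epsilon>"
    and ab: "\<alpha> \<in> S" "\<beta> \<in> S"
  shows "\<beta> = \<epsilon> 1 + \<epsilon> 3 \<and> \<alpha> = \<epsilon> 2 - \<epsilon> 3 \<and> \<epsilon> 1 - \<epsilon> 2 \<notin> N \<and> coord_factor Y *\<^sub>R \<epsilon> 3 \<notin> N \<longleftrightarrow>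
    \<alpha> + \<beta> = \<epsilon> 1 + \<epsilon> 2 \<and> (coxeter_equiv_seq \<Gamma> (restricted S) (seq_BC3 (coord_factor Y) \<epsilon>) \<or>
      coxeter_equiv_seq \<Gamma> (rev (restricted S)) (seq_BC3 (coord_factor Y) \<epsilon>))"
proof -
  define e1 e2 e3 \<kappa>' where "e1 = \<epsilon> 1" and "e2 = \<epsilon> 2" and "e3 = \<epsilon> 3" and "\<kappa>' = e1 \<bullet> e1"
  note D = coord_subsystem_BC_D[OF Y c e1_def e2_def e3_def, folded \<kappa>'_def]
  interpret f: frame3 e1 e2 e3 \<kappa>' k h by (rule D(1))
  interpret S: based_roots S \<Gamma> by (rule D(2))
  have SP: "S.P = f.C" using D by simp
  have CP: "f.C \<subseteq> P" using D(5) by auto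
  have "set f.word \<subseteq> \<Gamma>" unfolding D(6) f.word_def f.base_def by simp
  moreover have "set (lambda_seq f.word) \<subseteq> S.P" unfolding SP f.lambda_word f.C_def coords_BC_def by simp
  ultimately have word: "S.red f.word" by (rule S.redI)
  have seqw: "seq_BC3 (coord_factor Y) \<epsilon> = lambda_seq f.word"
    unfolding f.lambda_word seq_BC3_def D(7) by (simp add: e1_def e2_def e3_def)
  obtain us where us: "S.red us" "lambda_seq us = restricted S" "lambda_set (S \<inter> P) (word_map us) = N \<inter> (S \<inter> P)"
    using restricted_word[OF D(2-4)] by blast
  define W where "W = set (lambda_seq f.word)"
  have W: "W = {e2 - e3, real k *\<^sub>R e2, e1 - e3, e1 + e2, e2 + e3, real k *\<^sub>R e1, e1 + e3}"
    unfolding W_def f.lambda_word by simp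
  have CW: "f.C = W \<union> {e1 - e2, real k *\<^sub>R e3}" unfolding W f.C_def coords_BC_def by auto
  have invW: "S.inv f.word = W" using S.red_lambda[OF word] by (simp add: W_def)
  \<comment> \<open>The two remaining positive roots are orthogonal to \<open>e1 + e2\<close>, hence
    not inverted.\<close>
  have fixed: "reflect (e1 + e2) g = g" if "g \<in> {e1 - e2, real k *\<^sub>R e3}" for g
    using that by (auto simp: reflect_def inner_add_right inner_diff_left f.ip)
  have wS: "set f.word \<subseteq> \<Gamma>" using S.red_set[OF word] .
  have "g \<notin> W" if "g \<in> {e1 - e2, real k *\<^sub>R e3}" for g
    using S.mem_inv[OF wS, of g] fixed[OF that] CW that unfolding invW[symmetric] f.word_map_word SP by auto
  then have notW: "e1 - e2 \<notin> W" "real k *\<^sub>R e3 \<notin> W" by blast+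
  have setL: "set (restricted S) = N \<inter> f.C" using seg_N D(5) by auto
  have key: "\<beta> = e1 + e3 \<and> \<alpha> = e2 - e3 \<and> e1 - e2 \<notin> N \<and> real k *\<^sub>R e3 \<notin> N \<longleftrightarrow>
    \<alpha> + \<beta> = e1 + e2 \<and> N \<inter> f.C = W"
  proof
    assume a: "\<beta> = e1 + e3 \<and> \<alpha> = e2 - e3 \<and> e1 - e2 \<notin> N \<and> real k *\<^sub>R e3 \<notin> N"
    have k0: "0 < real k" using f.hk by simp
    define s1 s2 s3 where "s1 = sgnf e1" and "s2 = sgnf e2" and "s3 = sgnf e3"
    have "sgnf (e1 + e3) < 0" "sgnf (e2 - e3) < 0" using mem_N mem_P sgnf_N a by metis+
    moreover have "0 < sgnf (e1 - e2)" "0 < sgnf (real k *\<^sub>R e3)"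
      using a CP CW sgnf_not_N[of "e1 - e2"] sgnf_not_N[of "real k *\<^sub>R e3"] by auto
    ultimately have s: "s1 + s3 < 0" "s2 - s3 < 0" "0 < s1 - s2" "0 < s3"
      using k0 by (simp_all add: s1_def s2_def s3_def zero_less_mult_iff)
    have "sgnf w < 0" if "w \<in> W" for w
    proof -
      have "real k * s2 < 0" "real k * s1 < 0" using s k0 by (auto intro!: mult_pos_neg)
      then show ?thesis using that s unfolding W s1_def s2_def s3_def by (elim insertE emptyE) simp_all
    qed
    then have "W \<subseteq> N" using CP CW sgnf_N by blast
    then have "N \<inter> f.C = W" using CW a by blast
    then show "\<alpha> + \<beta> = e1 + e2 \<and> N \<inter> f.C = W" using a by simp
  next
    assume a: "\<alpha> + \<beta> = e1 + e2 \<and> N \<inter> f.C = W"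
    have "\<alpha> \<in> W" using a mem_N(1) mem_P(1) ab(1) D(5) by blast
    moreover have "\<alpha> \<in> f.base" using base_in_sub[OF D(2) D(4) alpha_base ab(1)] D(6) by simp
    ultimately have al: "\<alpha> = e2 - e3" using notW unfolding f.base_def by blast
    have "\<beta> = (\<alpha> + \<beta>) - \<alpha>" by simp
    also have "\<dots> = (e1 + e2) - (e2 - e3)" using a al by (simp only:)
    finally have "\<beta> = e1 + e3" by simp
    then show "\<beta> = e1 + e3 \<and> \<alpha> = e2 - e3 \<and> e1 - e2 \<notin> N \<and> real k *\<^sub>R e3 \<notin> N"
      using al a notW CW by blast
  qed
  have equiv: "coxeter_equiv_seq \<Gamma> (restricted S) (lambda_seq f.word) \<longleftrightarrow> N \<inter> f.C = W"
    using S.coxeter_equiv_iff[OF us(1) word] us(2,3) D(4,5) invW by auto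
  have equiv_rev: "coxeter_equiv_seq \<Gamma> (rev (restricted S)) (lambda_seq f.word) \<longrightarrow> N \<inter> f.C = W"
  proof
    assume "coxeter_equiv_seq \<Gamma> (rev (restricted S)) (lambda_seq f.word)"
    then have "set (rev (restricted S)) = W" unfolding W_def by (rule S.coxeter_equiv_seq_set)
    then show "N \<inter> f.C = W" unfolding set_rev setL .
  qed
  show ?thesis
    unfolding e1_def[symmetric] e2_def[symmetric] e3_def[symmetric] seqw[unfolded D(7)] D(7) key equiv using equiv_rev by blast
qed

text \<open>The relation is \<open>\<beta> - \<alpha> = (\<epsilon> 1 - \<epsilon> 2) + 2 \<epsilon>
  3\<close>, with the last term written as the \<open>h\<close>-fold of a root.\<close>

lemma not_gatherable_BC:
  assumes Y: "(Y, k, h) \<in> {(TypeB 3, 1, 2), (TypeC 3, 2::nat, 1::nat)}" and c: "coord_subsystem R \<Delta> Y S \<Gamma> \<epsilon>"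
    and C1: "\<beta> = \<epsilon> 1 + \<epsilon> 3" "\<alpha> = \<epsilon> 2 - \<epsilon> 3" "\<epsilon> 1 - \<epsilon> 2 \<notin> N" "coord_factor Y *\<^sub>R \<epsilon> 3 \<notin> N"
  shows "\<not> gatherable" "\<alpha> \<in> S" "\<beta> \<in> S"
proof -
  define e1 e2 e3 \<kappa>' where "e1 = \<epsilon> 1" and "e2 = \<epsilon> 2" and "e3 = \<epsilon> 3" and "\<kappa>' = e1 \<bullet> e1"
  note D = coord_subsystem_BC_D[OF Y c e1_def e2_def e3_def, folded \<kappa>'_def]
  note C = C1[folded e1_def e2_def e3_def, unfolded D(7)]
  interpret f: frame3 e1 e2 e3 \<kappa>' k h by (rule D(1))
  have CC: "f.C \<subseteq> P" "f.C \<subseteq> S" using D(5) by auto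
  have m: "e1 - e2 \<in> f.C" "real k *\<^sub>R e3 \<in> f.C" "e1 + e3 \<in> f.C" "e2 - e3 \<in> f.C"
    by (simp_all add: f.C_def coords_BC_def)
  show "\<alpha> \<in> S" "\<beta> \<in> S" using m CC C by auto
  have "\<beta> - \<alpha> = 1 *\<^sub>R (e1 - e2) + real h *\<^sub>R (real k *\<^sub>R e3) + 0 *\<^sub>R (e1 - e2)"
    unfolding C(1,2) by (simp add: f.hk scaleR_2)
  then show "\<not> gatherable" by (rule not_gatherable_if_relation) (use m CC C in auto)
qed

text \<open>The base is prescribed: \<open>d\<close>, \<alpha>, \<open>g\<close> are to become
  \<open>e1 - e2\<close>, \<open>e2 - e3\<close>, \<open>k e3\<close>, and solving from the end
  gives the frame. The orthogonality of \<open>d\<close> and \<open>e3\<close> follows by comparing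
  squared lengths in the relation.\<close>

lemma exists_BC:
  assumes kh: "(k, h) \<in> {(1, 2), (2::nat, 1::nat)}" and dg: "d \<in> P - N" "g \<in> P - N" "d \<bullet> d = 2 * \<kappa>" "g \<bullet> g = real k * real k * \<kappa>"
    "d + real h *\<^sub>R g = \<beta> - \<alpha>" "d \<bullet> \<alpha> = - \<kappa>" "g \<bullet> \<alpha> = - real k * \<kappa>"
  shows "\<exists>Y\<in>{TypeB 3, TypeC 3}. \<exists>S \<Gamma> \<epsilon>. coord_subsystem R \<Delta> Y S \<Gamma> \<epsilon> \<and>
    \<beta> = \<epsilon> 1 + \<epsilon> 3 \<and> \<alpha> = \<epsilon> 2 - \<epsilon> 3 \<and> \<epsilon> 1 - \<epsilon> 2 \<notin> N \<and> coord_factor Y *\<^sub>R \<epsilon> 3 \<notin> N"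
proof -
  have hk: "real h * real k = 2" "0 < real k" "real k \<noteq> 0" using kh by auto
  define e3 where "e3 = (1 / real k) *\<^sub>R g"
  define e2 where "e2 = \<alpha> + e3"
  define e1 where "e1 = d + e2"
  have g: "g = real k *\<^sub>R e3" using hk by (simp add: e3_def)
  have sum: "d + 2 *\<^sub>R e3 = \<beta> - \<alpha>" using dg(5) unfolding g by (simp add: hk)
  have e33: "e3 \<bullet> e3 = \<kappa>" using dg(4) hk unfolding g by simp
  have "real k * (e3 \<bullet> \<alpha>) = real k * (- \<kappa>)" using dg(7) unfolding g by simp
  then have "e3 \<bullet> \<alpha> = - \<kappa>" using hk(3) by (rule mult_left_cancel[THEN iffD1, rotated])
  then have e3a: "e3 \<bullet> \<alpha> = - \<kappa>" "\<alpha> \<bullet> e3 = - \<kappa>" by (simp_all add: inner_commute)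
  have ad: "\<alpha> \<bullet> d = - \<kappa>" using dg(6) by (simp add: inner_commute)
  have "(\<beta> - \<alpha>) \<bullet> (\<beta> - \<alpha>) = 6 * \<kappa>" by (simp add: inner_diff_left inner_diff_right \<kappa> inner_ab)
  then have "(d + 2 *\<^sub>R e3) \<bullet> (d + 2 *\<^sub>R e3) = 6 * \<kappa>" by (simp only: sum)
  then have de: "d \<bullet> e3 = 0" "e3 \<bullet> d = 0"
    by (simp_all add: inner_add_left inner_add_right dg(3) e33 inner_commute)
  have frame: "frame3 e1 e2 e3 \<kappa> k h"
    by unfold_locales
      (use \<kappa>(1) kh in \<open>auto simp: e1_def e2_def inner_add_left inner_add_right dg(3,6) e33 e3a ad de \<kappa>(2)\<close>)
  interpret f: frame3 e1 e2 e3 \<kappa> k h by (rule frame)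
  have b: "e1 - e2 = d" "e2 - e3 = \<alpha>" "real k *\<^sub>R e3 = g" by (simp_all add: e1_def e2_def g)
  have base: "f.base \<subseteq> P" unfolding f.base_def b using dg mem_P by auto
  define \<epsilon> :: "nat \<Rightarrow> 'a" where "\<epsilon> = (\<lambda>i. if i = 1 then e1 else if i = 2 then e2 else e3)"
  have eps: "\<epsilon> 1 = e1" "\<epsilon> 2 = e2" "\<epsilon> 3 = e3" by (simp_all add: \<epsilon>_def)
  define Y where "Y = (if k = 1 then TypeB 3 else TypeC 3)"
  have cf: "coord_factor Y = real k" "Y \<in> {TypeB 3, TypeC 3}" using kh by (auto simp: Y_def)
  have co: "coord_subsystem R \<Delta> Y (f.C \<union> uminus ` f.C) f.base \<epsilon>"
    unfolding Y_def \<epsilon>_def by (rule coord_subsystem_BC[OF frame base])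
  have "\<beta> = (d + 2 *\<^sub>R e3) + \<alpha>" unfolding sum by simp
  also have "\<dots> = e1 + e3" by (simp add: e1_def e2_def scaleR_2)
  finally have "\<beta> = e1 + e3" .
  then show ?thesis using co cf(2) dg(1,2) b
    by (intro bexI[of _ Y] exI[of _ "f.C \<union> uminus ` f.C"] exI[of _ f.base] exI[of _ \<epsilon>])
      (auto simp: eps[unfolded One_nat_def] cf(1))
qed

section \<open>The criterion for types D, E\<close>

text \<open>Again all conditions amount to \<open>N \<inter> f.C = W\<close>. Now \<gamma> is not
  given on the right, so \<beta> is found as the last root of the restricted sequence: its word
  represents the reflection in \<open>e1 + e2\<close>, hence its last letter is minus the image of
  \<beta>. This letter is not one of the three fixed simple roots, so it is
  \<open>e2 - e3\<close>.\<close>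

lemma criterion_D4:
  assumes c: "coord_subsystem R \<Delta> (TypeD 4) S \<Gamma> \<epsilon>" and ab: "\<alpha> \<in> S" "\<beta> \<in> S"
  shows "\<beta> = \<epsilon> 1 + \<epsilon> 3 \<and> \<alpha> + \<beta> = \<epsilon> 1 + \<epsilon> 2 \<and> \<alpha> = \<epsilon> 2 - \<epsilon> 3 \<and> {\<epsilon> 1 - \<epsilon> 2, \<epsilon> 3 - \<epsilon> 4, \<epsilon> 3 + \<epsilon> 4} \<inter> N = {} \<longleftrightarrow>
      coxeter_equiv_seq \<Gamma> (restricted S) (seq_D4 \<epsilon>)" (is "?A \<longleftrightarrow> ?B")
    and "coxeter_equiv_seq \<Gamma> (restricted S) (seq_D4 \<epsilon>) \<longleftrightarrow>
      N \<inter> (S \<inter> P) = lambda_set (S \<inter> P) (reflect (\<epsilon> 1 + \<epsilon> 2))"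
proof -
  define e1 e2 e3 e4 \<kappa>' where "e1 = \<epsilon> 1" and "e2 = \<epsilon> 2" and "e3 = \<epsilon> 3" and "e4 = \<epsilon> 4" and "\<kappa>' = e1 \<bullet> e1"
  note D = coord_subsystem_D4_D[OF c e1_def e2_def e3_def e4_def, folded \<kappa>'_def]
  interpret f: frame4 e1 e2 e3 e4 \<kappa>' by (rule D(1))
  interpret S: based_roots S \<Gamma> by (rule D(2))
  have SP: "S.P = f.C" using D by simp
  have CP: "f.C \<subseteq> P" using D(5) by auto
  have "set f.word \<subseteq> \<Gamma>" unfolding D(6) f.word_def f.base_def by simp
  moreover have "set (lambda_seq f.word) \<subseteq> S.P" unfolding SP f.lambda_word f.C_def coords_D4_def by simp
  ultimately have word: "S.red f.word" by (rule S.redI)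
  have seqw: "seq_D4 \<epsilon> = lambda_seq f.word"
    unfolding f.lambda_word seq_D4_def by (simp add: e1_def e2_def e3_def e4_def)
  obtain us where us: "S.red us" "lambda_seq us = restricted S" "lambda_set (S \<inter> P) (word_map us) = N \<inter> (S \<inter> P)"
    using restricted_word[OF D(2-4)] by blast
  define W where "W = set (lambda_seq f.word)"
  have W: "W = {e2 - e3, e2 - e4, e2 + e4, e2 + e3, e1 + e2, e1 - e3, e1 + e4, e1 - e4, e1 + e3}"
    unfolding W_def f.lambda_word by simp
  have CW: "f.C = W \<union> {e1 - e2, e3 - e4, e3 + e4}" unfolding W f.C_def coords_D4_def by auto
  have invW: "S.inv f.word = W" using S.red_lambda[OF word] by (simp add: W_def)
  have fixed: "reflect (e1 + e2) g = g" if "g \<in> {e1 - e2, e3 - e4, e3 + e4}" for g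
    using that by (auto simp: reflect_def inner_add_right inner_add_left inner_diff_left f.ip)
  have wS: "set f.word \<subseteq> \<Gamma>" using S.red_set[OF word] .
  have notW: "g \<notin> W" if "g \<in> {e1 - e2, e3 - e4, e3 + e4}" for g
    using S.mem_inv[OF wS, of g] fixed[OF that] CW that unfolding invW[symmetric] f.word_map_word SP by auto
  have equiv: "coxeter_equiv_seq \<Gamma> (restricted S) (lambda_seq f.word) \<longleftrightarrow> N \<inter> f.C = W"
    using S.coxeter_equiv_iff[OF us(1) word] us(2,3) D(4,5) invW by auto
  have lamW: "lambda_set (S \<inter> P) (reflect (e1 + e2)) = W"
    using invW unfolding f.word_map_word D(4) .
  show "coxeter_equiv_seq \<Gamma> (restricted S) (seq_D4 \<epsilon>) \<longleftrightarrow>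
      N \<inter> (S \<inter> P) = lambda_set (S \<inter> P) (reflect (\<epsilon> 1 + \<epsilon> 2))"
    unfolding seqw e1_def[symmetric] e2_def[symmetric] lamW using equiv D(5) by simp
  have key: "\<beta> = e1 + e3 \<and> \<alpha> + \<beta> = e1 + e2 \<and> \<alpha> = e2 - e3 \<and> {e1 - e2, e3 - e4, e3 + e4} \<inter> N = {} \<longleftrightarrow> N \<inter> f.C = W"
  proof
    assume a: "\<beta> = e1 + e3 \<and> \<alpha> + \<beta> = e1 + e2 \<and> \<alpha> = e2 - e3 \<and> {e1 - e2, e3 - e4, e3 + e4} \<inter> N = {}"
    define s1 s2 s3 s4 where "s1 = sgnf e1" and "s2 = sgnf e2" and "s3 = sgnf e3" and "s4 = sgnf e4"
    have "sgnf (e1 + e3) < 0" "sgnf (e2 - e3) < 0" using mem_N mem_P sgnf_N a by metis+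
    moreover have "0 < sgnf g" if "g \<in> {e1 - e2, e3 - e4, e3 + e4}" for g
      using sgnf_not_N[of g] a CP CW that by blast
    then have "0 < sgnf (e1 - e2)" "0 < sgnf (e3 - e4)" "0 < sgnf (e3 + e4)" by blast+
    ultimately have s: "s1 + s3 < 0" "s2 - s3 < 0" "0 < s1 - s2" "0 < s3 - s4" "0 < s3 + s4"
      by (simp_all add: s1_def s2_def s3_def s4_def)
    have "sgnf w < 0" if "w \<in> W" for w
      using that s unfolding W s1_def s2_def s3_def s4_def by (elim insertE emptyE) simp_all
    then have "W \<subseteq> N" using CP CW sgnf_N by blast
    then show "N \<inter> f.C = W" using CW a by blast
  next
    assume a: "N \<inter> f.C = W"
    have "\<alpha> \<in> W" using a mem_N(1) mem_P(1) ab(1) D(5) by blast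
    moreover have "\<alpha> \<in> f.base" using base_in_sub[OF D(2) D(4) alpha_base ab(1)] D(6) by simp
    ultimately have al: "\<alpha> = e2 - e3" using notW unfolding f.base_def by blast
    have umap: "word_map us = reflect (e1 + e2)"
      using S.inv_inject[OF S.red_set[OF us(1)] wS] us(3) a invW D(4,5) f.word_map_word by auto
    \<comment> \<open>The segment ends with \<beta>, and \<beta> lies in \<open>S\<close>, so the
      restricted sequence ends with it too.\<close>
    have seg_last: "segment 0 q (lambda_seq ws) = lambda_seq (take q ts) @ [\<beta>]"
    proof -
      have "lambda_seq ts = take q (lambda_seq ts) @ [lambda_seq ts ! q]"
        using ts(3) by (metis length_lambda_seq lessI take_Suc_conv_app_nth take_all order_refl)
      then show ?thesis using lambda_ts[of q] seq(3) by (simp add: seg_lambda take_lambda_seq)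
    qed
    then have lastL: "lambda_seq us \<noteq> []" "last (lambda_seq us) = \<beta>"
      using ab(2) mem_P(2) us(2) by simp_all
    then obtain vs g where vg: "us = vs @ [g]" by (metis lambda_seq_Nil rev_exhaust)
    then have "word_map (rev vs) g = \<beta>" using lastL(2) by simp
    then have "word_map us \<beta> = - g" unfolding vg by (metis reflect_self word_map_Cons word_map_Nil word_map_append word_map_rev2 id_apply)
    then have "reflect (e1 + e2) \<beta> = - g" unfolding umap .
    then have "\<beta> = reflect (e1 + e2) (- g)" by (metis reflect_reflect)
    then have b: "\<beta> = - reflect (e1 + e2) g" by simp
    have gG: "g \<in> f.base" using S.red_set[OF us(1)] vg D(6) by simp
    have "g \<notin> {e1 - e2, e3 - e4, e3 + e4}"
    proof
      assume g: "g \<in> {e1 - e2, e3 - e4, e3 + e4}"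
      then have "\<beta> = - g" "g \<in> P" using b fixed[OF g] CP CW by auto
      then show False using mem_P(2) pos_not_neg by blast
    qed
    then have "g = e2 - e3" using gG unfolding f.base_def by blast
    then have "\<beta> = e1 + e3"
      using b f.kappa by (simp add: reflect_def inner_add_left inner_add_right inner_diff_left f.ip)
    then show "\<beta> = e1 + e3 \<and> \<alpha> + \<beta> = e1 + e2 \<and> \<alpha> = e2 - e3 \<and> {e1 - e2, e3 - e4, e3 + e4} \<inter> N = {}"
      using al a notW CW by auto
  qed
  show "?A \<longleftrightarrow> ?B"
    unfolding seqw equiv e1_def[symmetric] e2_def[symmetric] e3_def[symmetric] e4_def[symmetric] by (rule key)
qed

text \<open>\<open>\<beta> - \<alpha>\<close> is the sum of the three end nodes of the D4 diagram,
  and \<alpha> is its branch node.\<close>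

lemma not_gatherable_D4:
  assumes c: "coord_subsystem R \<Delta> (TypeD 4) S \<Gamma> \<epsilon>"
    and C1: "\<beta> = \<epsilon> 1 + \<epsilon> 3" "\<alpha> = \<epsilon> 2 - \<epsilon> 3"
  shows "{\<epsilon> 1 - \<epsilon> 2, \<epsilon> 3 - \<epsilon> 4, \<epsilon> 3 + \<epsilon> 4} \<inter> N = {} \<Longrightarrow> \<not> gatherable" "\<alpha> \<in> S" "\<beta> \<in> S"
proof -
  define e1 e2 e3 e4 \<kappa>' where "e1 = \<epsilon> 1" and "e2 = \<epsilon> 2" and "e3 = \<epsilon> 3" and "e4 = \<epsilon> 4" and "\<kappa>' = e1 \<bullet> e1"
  note D = coord_subsystem_D4_D[OF c e1_def e2_def e3_def e4_def, folded \<kappa>'_def]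
  note C = C1[folded e1_def e2_def e3_def]
  interpret f: frame4 e1 e2 e3 e4 \<kappa>' by (rule D(1))
  have CC: "f.C \<subseteq> P" "f.C \<subseteq> S" using D(5) by auto
  have m: "e1 - e2 \<in> f.C" "e3 - e4 \<in> f.C" "e3 + e4 \<in> f.C" "e1 + e3 \<in> f.C" "e2 - e3 \<in> f.C"
    by (simp_all add: f.C_def coords_D4_def)
  show "\<alpha> \<in> S" "\<beta> \<in> S" using m CC C by auto
  assume n: "{\<epsilon> 1 - \<epsilon> 2, \<epsilon> 3 - \<epsilon> 4, \<epsilon> 3 + \<epsilon> 4} \<inter> N = {}"
  have n: "{e1 - e2, e3 - e4, e3 + e4} \<inter> N = {}" unfolding e1_def e2_def e3_def e4_def by (rule n)
  have "\<beta> - \<alpha> = 1 *\<^sub>R (e1 - e2) + 1 *\<^sub>R (e3 - e4) + 1 *\<^sub>R (e3 + e4)"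
    unfolding C by simp
  then show "\<not> gatherable" by (rule not_gatherable_if_relation) (use m CC n in auto)
qed

text \<open>The four roots are to form the D4 diagram with \<alpha> at the branch node. The nodes
  \<open>y\<close> and \<open>z\<close> become \<open>e3 - e4\<close> and \<open>e3 + e4\<close>, so
  \<open>e3\<close> and \<open>e4\<close> are half their sum and half their difference.\<close>

lemma exists_D4:
  assumes xyz: "{x, y, z} \<subseteq> P - N" "x + y + z = \<beta> - \<alpha>" "x \<bullet> y = 0" "x \<bullet> z = 0" "y \<bullet> z = 0"
    "x \<bullet> \<alpha> = - \<kappa>" "y \<bullet> \<alpha> = - \<kappa>" "z \<bullet> \<alpha> = - \<kappa>"
    and n: "x \<bullet> x = 2 * \<kappa>" "y \<bullet> y = 2 * \<kappa>" "z \<bullet> z = 2 * \<kappa>"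
  shows "\<exists>S \<Gamma> \<epsilon>. coord_subsystem R \<Delta> (TypeD 4) S \<Gamma> \<epsilon> \<and>
    \<beta> = \<epsilon> 1 + \<epsilon> 3 \<and> \<alpha> + \<beta> = \<epsilon> 1 + \<epsilon> 2 \<and> \<alpha> = \<epsilon> 2 - \<epsilon> 3 \<and> {\<epsilon> 1 - \<epsilon> 2, \<epsilon> 3 - \<epsilon> 4, \<epsilon> 3 + \<epsilon> 4} \<inter> N = {}"
proof -
  define g where "g = \<alpha> + \<beta>"
  have be: "\<beta> = \<alpha> + x + y + z"
  proof -
    have "\<beta> = (x + y + z) + \<alpha>" unfolding xyz(2) by simp
    then show ?thesis by (simp add: algebra_simps)
  qed
  have comm: "y \<bullet> x = 0" "z \<bullet> x = 0" "z \<bullet> y = 0" "\<alpha> \<bullet> x = - \<kappa>" "\<alpha> \<bullet> y = - \<kappa>" "\<alpha> \<bullet> z = - \<kappa>"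
    using xyz by (simp_all add: inner_commute)
  define e1 where "e1 = \<alpha> + x + (1/2) *\<^sub>R (y + z)"
  define e2 where "e2 = \<alpha> + (1/2) *\<^sub>R (y + z)"
  define e3 where "e3 = (1/2) *\<^sub>R (y + z)"
  define e4 where "e4 = (1/2) *\<^sub>R (z - y)"
  have frame: "frame4 e1 e2 e3 e4 \<kappa>"
    by unfold_locales
      (use \<kappa>(1) in \<open>simp_all add: e1_def e2_def e3_def e4_def inner_add_left inner_add_right inner_diff_left
        inner_diff_right xyz(3-8) comm n \<kappa>(2)\<close>)
  interpret f: frame4 e1 e2 e3 e4 \<kappa> by (rule frame)
  have half: "(1/2) *\<^sub>R v + (1/2) *\<^sub>R v = v" for v :: 'a by (simp flip: scaleR_left_distrib)
  have b1: "e1 - e2 = x" by (simp add: e1_def e2_def)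
  have b2: "e2 - e3 = \<alpha>" by (simp add: e2_def e3_def)
  have b3: "e3 - e4 = y"
  proof -
    have "e3 - e4 = (1/2) *\<^sub>R y + (1/2) *\<^sub>R y" by (simp add: e3_def e4_def scaleR_right_diff_distrib scaleR_add_right)
    then show ?thesis by (simp only: half)
  qed
  have b4: "e3 + e4 = z"
  proof -
    have "e3 + e4 = (1/2) *\<^sub>R z + (1/2) *\<^sub>R z" by (simp add: e3_def e4_def scaleR_right_diff_distrib scaleR_add_right)
    then show ?thesis by (simp only: half)
  qed
  have b5: "e1 + e3 = \<beta>"
  proof -
    have "e1 + e3 = \<alpha> + x + ((1/2) *\<^sub>R (y + z) + (1/2) *\<^sub>R (y + z))" by (simp add: e1_def e3_def algebra_simps)
    then show ?thesis unfolding half be by (simp add: algebra_simps)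
  qed
  have b6: "e1 + e2 = \<alpha> + \<beta>"
  proof -
    have "e1 + e2 = (e2 - e3) + (e1 + e3)" by simp
    then show ?thesis by (simp only: b2 b5)
  qed
  have base: "f.base \<subseteq> P" unfolding f.base_def b1 b2 b3 b4 using xyz(1) mem_P by auto
  define \<epsilon> :: "nat \<Rightarrow> 'a" where "\<epsilon> = (\<lambda>i. if i = 1 then e1 else if i = 2 then e2 else if i = 3 then e3 else e4)"
  have eps: "\<epsilon> 1 = e1" "\<epsilon> 2 = e2" "\<epsilon> 3 = e3" "\<epsilon> 4 = e4" by (simp_all add: \<epsilon>_def)
  have co: "coord_subsystem R \<Delta> (TypeD 4) (f.C \<union> uminus ` f.C) f.base \<epsilon>"
    unfolding \<epsilon>_def by (rule coord_subsystem_D4[OF frame base])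
  have "\<beta> = \<epsilon> 1 + \<epsilon> 3 \<and> \<alpha> + \<beta> = \<epsilon> 1 + \<epsilon> 2 \<and> \<alpha> = \<epsilon> 2 - \<epsilon> 3 \<and> {\<epsilon> 1 - \<epsilon> 2, \<epsilon> 3 - \<epsilon> 4, \<epsilon> 3 + \<epsilon> 4} \<inter> N = {}"
    unfolding eps b1 b2 b3 b4 b5 b6 using xyz(1) by auto
  then show ?thesis using co by blast
qed

end

section \<open>Root lengths of the types\<close>

lemma type_edge_equal:
  assumes "\<And>i j. i \<in> {1..rank X} \<Longrightarrow> j \<in> {1..rank X} \<Longrightarrow> cartan_number (a i) (a j) = of_int (cartan_matrix X i j)"
    and "\<And>i. i \<in> {1..rank X} \<Longrightarrow> a i \<noteq> 0"
    and ij: "i \<in> {1..rank X}" "j \<in> {1..rank X}" "cartan_matrix X j i = - 1"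
  shows "cartan_matrix X i j = - 1 \<Longrightarrow> a j \<bullet> a j = a i \<bullet> a i"
    and "cartan_matrix X i j = - 2 \<Longrightarrow> a i \<bullet> a i = 2 * (a j \<bullet> a j)"
proof -
  have nz: "a i \<bullet> a i \<noteq> 0" "a j \<bullet> a j \<noteq> 0" using assms by auto
  have ji: "2 * (a j \<bullet> a i) / (a i \<bullet> a i) = - 1" using assms(1)[OF ij(2,1)] ij(3) by (simp add: cartan_number_def)
  then have 1: "a i \<bullet> a i = - 2 * (a j \<bullet> a i)" using nz by (simp add: field_simps)
  show "a j \<bullet> a j = a i \<bullet> a i" if "cartan_matrix X i j = - 1"
  proof -
    have "2 * (a i \<bullet> a j) / (a j \<bullet> a j) = - 1" using assms(1)[OF ij(1,2)] that by (simp add: cartan_number_def)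
    then have "a j \<bullet> a j = - 2 * (a i \<bullet> a j)" using nz by (simp add: field_simps)
    then show ?thesis using 1 by (simp add: inner_commute)
  qed
  show "a i \<bullet> a i = 2 * (a j \<bullet> a j)" if "cartan_matrix X i j = - 2"
  proof -
    have "2 * (a i \<bullet> a j) / (a j \<bullet> a j) = - 2" using assms(1)[OF ij(1,2)] that by (simp add: cartan_number_def)
    then have "a j \<bullet> a j = - (a i \<bullet> a j)" using nz by (simp add: field_simps)
    then show ?thesis using 1 by (simp add: inner_commute)
  qed
qed

lemma chain_equal:
  fixes f :: "nat \<Rightarrow> 'b"
  assumes "\<And>i. l \<le> i \<Longrightarrow> i < u \<Longrightarrow> f (Suc i) = f i" "l \<le> i" "i \<le> u"
  shows "f i = f l"
  using assms(2,3)
proof (induction i rule: dec_induct)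
  case (step n)
  then show ?case using assms(1)[of n] by simp
qed simp

context based_roots
begin

lemma type_sequence:
  assumes "has_type X \<Delta>"
  obtains a where "a ` {1..rank X} = \<Delta>"
    "\<And>i j. i \<in> {1..rank X} \<Longrightarrow> j \<in> {1..rank X} \<Longrightarrow> cartan_matrix X j i = - 1 \<Longrightarrow> cartan_matrix X i j = - 1 \<Longrightarrow> a j \<bullet> a j = a i \<bullet> a i"
    "\<And>i j. i \<in> {1..rank X} \<Longrightarrow> j \<in> {1..rank X} \<Longrightarrow> cartan_matrix X j i = - 1 \<Longrightarrow> cartan_matrix X i j = - 2 \<Longrightarrow> a i \<bullet> a i = 2 * (a j \<bullet> a j)"
proof -
  obtain a where a: "bij_betw a {1..rank X} \<Delta>"
    "\<And>i j. i \<in> {1..rank X} \<Longrightarrow> j \<in> {1..rank X} \<Longrightarrow> cartan_number (a i) (a j) = of_int (cartan_matrix X i j)"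
    using assms unfolding has_type_def by blast
  have im: "a ` {1..rank X} = \<Delta>" using a(1) by (simp add: bij_betw_def)
  have nz: "a i \<noteq> 0" if "i \<in> {1..rank X}" for i 
  proof -
    have "a i \<in> \<Delta>" using im that by blast
    then show ?thesis using base_sub root_zero by (metis subsetD)
  qed
  show ?thesis by (rule that[OF im]) (use type_edge_equal[OF a(2) nz] in blast)+
qed

lemma simply_laced_norms:
  assumes "has_type X \<Delta>" and X: "(\<exists>n\<ge>4. X = TypeD n) \<or> X \<in> {TypeE 6, TypeE 7, TypeE 8}"
  shows "\<exists>c. \<forall>x\<in>R. x \<bullet> x = c"
proof -
  obtain a where a: "a ` {1..rank X} = \<Delta>"
    "\<And>i j. i \<in> {1..rank X} \<Longrightarrow> j \<in> {1..rank X} \<Longrightarrow> cartan_matrix X j i = - 1 \<Longrightarrow> cartan_matrix X i j = - 1 \<Longrightarrow> a j \<bullet> a j = a i \<bullet> a i"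
    using type_sequence[OF assms(1)] by metis
  define f where "f i = a i \<bullet> a i" for i
  have e: "f j = f i" if "i \<in> {1..rank X}" "j \<in> {1..rank X}" "cartan_matrix X j i = - 1" "cartan_matrix X i j = - 1" for i j
    using a(2)[OF that] by (simp add: f_def)
  have "\<exists>c. \<forall>i\<in>{1..rank X}. f i = c"
    using X
  proof (elim disjE exE conjE)
    fix n assume n: "4 \<le> n" "X = TypeD n"
    have s: "f (Suc i) = f i" if "1 \<le> i" "i < n - 1" for i
      by (rule e) (use n that in \<open>auto simp: cartan_matrix_def\<close>)
    have c: "f i = f 1" if "1 \<le> i" "i \<le> n - 1" for i by (rule chain_equal[of 1 "n - 1"]) (use s that in auto)
    have "f n = f (n - 2)" by (rule e) (use n in \<open>auto simp: cartan_matrix_def\<close>)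
    then have "f n = f 1" using c[of "n - 2"] n by simp
    then have "f i = f 1" if "i \<in> {1..n}" for i using c[of i] that by (cases "i = n") auto
    then show ?thesis unfolding n(2) rank.simps by blast
  next
    assume "X \<in> {TypeE 6, TypeE 7, TypeE 8}"
    then obtain n where n: "6 \<le> n" "X = TypeE n" by auto
    have s: "f (Suc i) = f i" if "3 \<le> i" "i < n" for i
      by (rule e) (use n that in \<open>auto simp: cartan_matrix_def\<close>)
    have c: "f i = f 3" if "3 \<le> i" "i \<le> n" for i by (rule chain_equal[of 3 n]) (use s that in auto)
    have "f 3 = f 1" "f 4 = f 2" by (rule e; use n in \<open>auto simp: cartan_matrix_def\<close>)+
    then have "f 1 = f 3" "f 2 = f 3" using c[of 4] n by simp_all
    then have "f i = f 3" if "i \<in> {1..n}" for i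
    proof (cases "3 \<le> i")
      case False
      then have "i = 1 \<or> i = 2" using that by auto
      then show ?thesis using \<open>f 1 = f 3\<close> \<open>f 2 = f 3\<close> by blast
    next
      case True
      then show ?thesis using c[OF True] that by simp
    qed
    then show ?thesis unfolding n(2) rank.simps by blast
  qed
  then obtain c where c: "\<And>i. i \<in> {1..rank X} \<Longrightarrow> f i = c" by blast
  have "x \<bullet> x = c" if x: "x \<in> R" for x
  proof -
    obtain b where "b \<in> \<Delta>" "x \<bullet> x = b \<bullet> b" using root_norm_simple[OF x] by blast
    then show ?thesis using a(1) c by (auto simp: f_def)
  qed
  then show ?thesis by blast
qed

text \<open>Lengths are constant along simple edges and change by the factor 2 in squared length at
  the double edge; \<open>root_norm_simple\<close> extends this from the base to all roots.\<close>

lemma two_norms: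
  assumes "has_type X \<Delta>" and X: "(\<exists>n\<ge>3. X = TypeB n) \<or> (\<exists>n\<ge>3. X = TypeC n) \<or> X = TypeF4"
  shows "\<exists>c>0. (\<forall>x\<in>R. x \<bullet> x = c \<or> x \<bullet> x = 2 * c) \<and> (\<exists>x\<in>R. x \<bullet> x = c) \<and> (\<exists>x\<in>R. x \<bullet> x = 2 * c)"
proof -
  obtain a where a: "a ` {1..rank X} = \<Delta>"
    "\<And>i j. i \<in> {1..rank X} \<Longrightarrow> j \<in> {1..rank X} \<Longrightarrow> cartan_matrix X j i = - 1 \<Longrightarrow> cartan_matrix X i j = - 1 \<Longrightarrow> a j \<bullet> a j = a i \<bullet> a i"
    "\<And>i j. i \<in> {1..rank X} \<Longrightarrow> j \<in> {1..rank X} \<Longrightarrow> cartan_matrix X j i = - 1 \<Longrightarrow> cartan_matrix X i j = - 2 \<Longrightarrow> a i \<bullet> a i = 2 * (a j \<bullet> a j)"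
    using type_sequence[OF assms(1)] by metis
  define f where "f i = a i \<bullet> a i" for i
  have e: "f j = f i" if "i \<in> {1..rank X}" "j \<in> {1..rank X}" "cartan_matrix X j i = - 1" "cartan_matrix X i j = - 1" for i j
    using a(2)[OF that] by (simp add: f_def)
  have e2: "f i = 2 * f j" if "i \<in> {1..rank X}" "j \<in> {1..rank X}" "cartan_matrix X j i = - 1" "cartan_matrix X i j = - 2" for i j
    using a(3)[OF that] by (simp add: f_def)
  have "\<exists>c. (\<forall>i\<in>{1..rank X}. f i = c \<or> f i = 2 * c) \<and> (\<exists>i\<in>{1..rank X}. f i = c) \<and> (\<exists>i\<in>{1..rank X}. f i = 2 * c)"
    using X
  proof (elim disjE exE conjE)
    fix n assume n: "3 \<le> n" "X = TypeB n"
    have s: "f (Suc i) = f i" if "1 \<le> i" "i < n - 1" for i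
      by (rule e) (use n that in \<open>auto simp: cartan_matrix_def\<close>)
    have c: "f i = f 1" if "1 \<le> i" "i \<le> n - 1" for i by (rule chain_equal[of 1 "n - 1"]) (use s that in auto)
    have l: "f (n - 1) = 2 * f n" by (rule e2) (use n in \<open>auto simp: cartan_matrix_def\<close>)
    have "f i = f n \<or> f i = 2 * f n" if "i \<in> {1..n}" for i
    proof (cases "i = n")
      case False
      then have "1 \<le> i" "i \<le> n - 1" "1 \<le> n - 1" using that n(1) by auto
      then have "f i = f (n - 1)" using c[of i] c[of "n - 1"] by simp
      then show ?thesis using l by simp
    qed (simp add: l)
    moreover have "n \<in> {1..n}" "n - 1 \<in> {1..n}" using n by auto
    ultimately show ?thesis unfolding n(2) rank.simps using l by blast
  next
    fix n assume n: "3 \<le> n" "X = TypeC n"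
    have s: "f (Suc i) = f i" if "1 \<le> i" "i < n - 1" for i
      by (rule e) (use n that in \<open>auto simp: cartan_matrix_def\<close>)
    have c: "f i = f 1" if "1 \<le> i" "i \<le> n - 1" for i by (rule chain_equal[of 1 "n - 1"]) (use s that in auto)
    have l: "f n = 2 * f (n - 1)" by (rule e2) (use n in \<open>auto simp: cartan_matrix_def\<close>)
    have "f i = f (n - 1) \<or> f i = 2 * f (n - 1)" if "i \<in> {1..n}" for i
    proof (cases "i = n")
      case False
      then have "1 \<le> i" "i \<le> n - 1" "1 \<le> n - 1" using that n(1) by auto
      then have "f i = f (n - 1)" using c[of i] c[of "n - 1"] by simp
      then show ?thesis using l by simp
    qed (simp add: l)
    moreover have "n \<in> {1..n}" "n - 1 \<in> {1..n}" using n by auto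
    ultimately show ?thesis unfolding n(2) rank.simps using l by blast
  next
    assume X: "X = TypeF4"
    have "f 2 = f 1" "f 4 = f 3" by (rule e; use X in \<open>auto simp: cartan_matrix_def\<close>)+
    moreover have "f 2 = 2 * f 3" by (rule e2) (use X in \<open>auto simp: cartan_matrix_def\<close>)
    moreover have "i = 1 \<or> i = 2 \<or> i = 3 \<or> i = 4" if "i \<in> {1..4::nat}" for i using that by auto
    moreover have "(1::nat) \<in> {1..4}" "(3::nat) \<in> {1..4}" by auto
    ultimately show ?thesis using X by (intro exI[of _ "f 3"]) (metis rank.simps(5))
  qed
  then obtain c where c: "\<And>i. i \<in> {1..rank X} \<Longrightarrow> f i = c \<or> f i = 2 * c"
    "\<exists>i\<in>{1..rank X}. f i = c" "\<exists>i\<in>{1..rank X}. f i = 2 * c" by blast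
  have aR: "a i \<in> R" if "i \<in> {1..rank X}" for i using that a(1) base_sub by blast
  have "x \<bullet> x = c \<or> x \<bullet> x = 2 * c" if x: "x \<in> R" for x
  proof -
    obtain b where "b \<in> \<Delta>" "x \<bullet> x = b \<bullet> b" using root_norm_simple[OF x] by blast
    then obtain i where "i \<in> {1..rank X}" "x \<bullet> x = f i" using a(1) by (auto simp: f_def)
    then show ?thesis using c(1)[of i] by simp
  qed
  moreover have "\<exists>x\<in>R. x \<bullet> x = c" "\<exists>x\<in>R. x \<bullet> x = 2 * c" using c(2,3) aR by (auto simp: f_def)
  moreover from this have "0 < c" using root_zero by (metis inner_gt_zero_iff)
  ultimately show ?thesis by blast
qed

end


section \<open>The two criteria for gatherability\<close>

context triple_word
begin

text \<open>The two alternatives for the lengths are those of a long and of a short triple.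
  Irreducibility provides the root of the other length not orthogonal to \<alpha> that the
  obstructions require. In this direction a long triple yields a subsystem B3 and a short one a
  subsystem C3.\<close>

lemma criterion_two_lengths:
  assumes irr: "irreducible_roots R"
    and n: "(\<forall>x\<in>R. x \<bullet> x = \<kappa> \<or> x \<bullet> x = 2 * \<kappa>) \<and> (\<exists>x\<in>R. x \<bullet> x = \<kappa>) \<or>
      (\<forall>x\<in>R. x \<bullet> x = 2 * \<kappa> \<or> x \<bullet> x = 4 * \<kappa>) \<and> (\<exists>x\<in>R. x \<bullet> x = 4 * \<kappa>)"
  shows "\<not> gatherable \<longleftrightarrow> (\<exists>Y\<in>{TypeB 3, TypeC 3}. \<exists>S \<Gamma> \<epsilon>. coord_subsystem R \<Delta> Y S \<Gamma> \<epsilon> \<and>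
    \<beta> = \<epsilon> 1 + \<epsilon> 3 \<and> \<alpha> = \<epsilon> 2 - \<epsilon> 3 \<and> \<epsilon> 1 - \<epsilon> 2 \<notin> N \<and> coord_factor Y *\<^sub>R \<epsilon> 3 \<notin> N)"
proof
  assume ng: "\<not> gatherable"
  have aR: "\<alpha> \<in> R" using mem_P pos_root by blast
  from n show "\<exists>Y\<in>{TypeB 3, TypeC 3}. \<exists>S \<Gamma> \<epsilon>. coord_subsystem R \<Delta> Y S \<Gamma> \<epsilon> \<and>
    \<beta> = \<epsilon> 1 + \<epsilon> 3 \<and> \<alpha> = \<epsilon> 2 - \<epsilon> 3 \<and> \<epsilon> 1 - \<epsilon> 2 \<notin> N \<and> coord_factor Y *\<^sub>R \<epsilon> 3 \<notin> N"
  proof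
    assume l: "(\<forall>x\<in>R. x \<bullet> x = \<kappa> \<or> x \<bullet> x = 2 * \<kappa>) \<and> (\<exists>x\<in>R. x \<bullet> x = \<kappa>)"
    then obtain y where "y \<in> R" "y \<bullet> y \<noteq> \<alpha> \<bullet> \<alpha>" using \<kappa> by auto
    then obtain e0 where e0: "e0 \<in> R" "e0 \<bullet> e0 \<noteq> \<alpha> \<bullet> \<alpha>" "e0 \<bullet> \<alpha> \<noteq> 0"
      using nonorthogonal_other_length[OF rs irr aR] by blast
    then have "e0 \<bullet> e0 = \<kappa>" using l \<kappa> by auto
    then obtain d e where "d \<in> P - N" "e \<in> P - N" "d \<bullet> d = 2 * \<kappa>" "e \<bullet> e = \<kappa>" "d + 2 *\<^sub>R e = \<beta> - \<alpha>"
      "d \<bullet> \<alpha> = - \<kappa>" "e \<bullet> \<alpha> = - \<kappa>" using long_obstruction[OF _ ng e0(1) _ e0(3)] l by blast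
    then show ?thesis using exists_BC[of 1 2 d e] by simp
  next
    assume l: "(\<forall>x\<in>R. x \<bullet> x = 2 * \<kappa> \<or> x \<bullet> x = 4 * \<kappa>) \<and> (\<exists>x\<in>R. x \<bullet> x = 4 * \<kappa>)"
    then obtain y where "y \<in> R" "y \<bullet> y \<noteq> \<alpha> \<bullet> \<alpha>" using \<kappa> by auto
    then obtain e0 where e0: "e0 \<in> R" "e0 \<bullet> e0 \<noteq> \<alpha> \<bullet> \<alpha>" "e0 \<bullet> \<alpha> \<noteq> 0"
      using nonorthogonal_other_length[OF rs irr aR] by blast
    then have "e0 \<bullet> e0 = 4 * \<kappa>" using l \<kappa> by auto
    then obtain d g where "d \<in> P - N" "g \<in> P - N" "d \<bullet> d = 2 * \<kappa>" "g \<bullet> g = 4 * \<kappa>" "d + g = \<beta> - \<alpha>"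
      "d \<bullet> \<alpha> = - \<kappa>" "g \<bullet> \<alpha> = - 2 * \<kappa>" using short_obstruction[OF _ ng e0(1) _ e0(3)] l by blast
    then show ?thesis using exists_BC[of 2 1 d g] by simp
  qed
next
  assume "\<exists>Y\<in>{TypeB 3, TypeC 3}. \<exists>S \<Gamma> \<epsilon>. coord_subsystem R \<Delta> Y S \<Gamma> \<epsilon> \<and>
    \<beta> = \<epsilon> 1 + \<epsilon> 3 \<and> \<alpha> = \<epsilon> 2 - \<epsilon> 3 \<and> \<epsilon> 1 - \<epsilon> 2 \<notin> N \<and> coord_factor Y *\<^sub>R \<epsilon> 3 \<notin> N"
  then obtain Y S \<Gamma> \<epsilon> where Y: "Y = TypeB 3 \<or> Y = TypeC 3" and c: "coord_subsystem R \<Delta> Y S \<Gamma> \<epsilon>"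
    "\<beta> = \<epsilon> 1 + \<epsilon> 3" "\<alpha> = \<epsilon> 2 - \<epsilon> 3" "\<epsilon> 1 - \<epsilon> 2 \<notin> N" "coord_factor Y *\<^sub>R \<epsilon> 3 \<notin> N" by blast
  from Y obtain k h where "(Y, k, h) \<in> {(TypeB 3, 1, 2), (TypeC 3, 2::nat, 1::nat)}" by blast
  then show "\<not> gatherable" using not_gatherable_BC(1) c by blast
qed

lemma criterion_simply_laced:
  assumes n: "\<And>x. x \<in> R \<Longrightarrow> x \<bullet> x = 2 * \<kappa>"
  shows "\<not> gatherable \<longleftrightarrow> (\<exists>S \<Gamma> \<epsilon>. coord_subsystem R \<Delta> (TypeD 4) S \<Gamma> \<epsilon> \<and>
    \<beta> = \<epsilon> 1 + \<epsilon> 3 \<and> \<alpha> + \<beta> = \<epsilon> 1 + \<epsilon> 2 \<and> \<alpha> = \<epsilon> 2 - \<epsilon> 3 \<and> {\<epsilon> 1 - \<epsilon> 2, \<epsilon> 3 - \<epsilon> 4, \<epsilon> 3 + \<epsilon> 4} \<inter> N = {})"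
proof
  assume ng: "\<not> gatherable"
  obtain x y z where xyz: "{x, y, z} \<subseteq> P - N" "x + y + z = \<beta> - \<alpha>" "x \<bullet> y = 0" "x \<bullet> z = 0" "y \<bullet> z = 0"
    "x \<bullet> \<alpha> = - \<kappa>" "y \<bullet> \<alpha> = - \<kappa>" "z \<bullet> \<alpha> = - \<kappa>" using simply_laced_obstruction[OF n ng] by metis
  have "x \<bullet> x = 2 * \<kappa>" "y \<bullet> y = 2 * \<kappa>" "z \<bullet> z = 2 * \<kappa>" using xyz(1) n pos_root by auto
  from exists_D4[OF xyz this] show "\<exists>S \<Gamma> \<epsilon>. coord_subsystem R \<Delta> (TypeD 4) S \<Gamma> \<epsilon> \<and>
    \<beta> = \<epsilon> 1 + \<epsilon> 3 \<and> \<alpha> + \<beta> = \<epsilon> 1 + \<epsilon> 2 \<and> \<alpha> = \<epsilon> 2 - \<epsilon> 3 \<and> {\<epsilon> 1 - \<epsilon> 2, \<epsilon> 3 - \<epsilon> 4, \<epsilon> 3 + \<epsilon> 4} \<inter> N = {}" .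
qed (use not_gatherable_D4(1) in blast)

end

theorem theorem1:
  fixes R \<Delta> :: "'a::euclidean_space set" and X :: dynkin
    and w :: "'a \<Rightarrow> 'a" and ws seg :: "'a list" and \<alpha> \<beta> \<gamma> :: 'a and r q :: nat
  assumes "root_system R" and "span R = UNIV" and "irreducible_roots R"
    and "is_base R \<Delta>" and "has_type X \<Delta>"
    and "(\<exists>n\<ge>3. X = TypeB n) \<or> (\<exists>n\<ge>3. X = TypeC n) \<or> (\<exists>n\<ge>4. X = TypeD n) \<or>
         X \<in> {TypeE 6, TypeE 7, TypeE 8} \<or> X = TypeF4"
    and "w \<in> weyl_group \<Delta>" and "reduced_decomposition \<Delta> w ws"
    and "0 < r" and "r < q" and "q < length ws"
    and "lambda_seq ws ! 0 = \<alpha>" and "lambda_seq ws ! r = \<gamma>" and "lambda_seq ws ! q = \<beta>"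
    and "\<alpha> + \<beta> = \<gamma>"
    and "\<And>n. X = TypeB n \<Longrightarrow> \<forall>x\<in>{\<alpha>, \<beta>, \<gamma>}. long_root R x"
    and "\<And>n. X = TypeC n \<Longrightarrow> \<forall>x\<in>{\<alpha>, \<beta>, \<gamma>}. short_root R x"
    and "X = TypeF4 \<Longrightarrow>
           (\<forall>x\<in>{\<alpha>, \<beta>, \<gamma>}. long_root R x) \<or> (\<forall>x\<in>{\<alpha>, \<beta>, \<gamma>}. short_root R x)"
  defines "seg \<equiv> segment 0 q (lambda_seq ws)"
  shows
    "((\<exists>n. X = TypeB n) \<or> (\<exists>n. X = TypeC n) \<or> X = TypeF4 \<longrightarrow>
        (\<not> gatherable_inside \<Delta> ws 0 q {\<alpha>, \<beta>, \<gamma>} \<longleftrightarrow>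
           (\<exists>Y\<in>{TypeB 3, TypeC 3}. \<exists>S \<Gamma> \<epsilon>. coord_subsystem R \<Delta> Y S \<Gamma> \<epsilon> \<and>
              \<beta> = \<epsilon> 1 + \<epsilon> 3 \<and> \<alpha> = \<epsilon> 2 - \<epsilon> 3 \<and>
              \<epsilon> 1 - \<epsilon> 2 \<notin> set seg \<and> coord_factor Y *\<^sub>R \<epsilon> 3 \<notin> set seg)) \<and>
        (\<not> gatherable_inside \<Delta> ws 0 q {\<alpha>, \<beta>, \<gamma>} \<longleftrightarrow>
           (\<exists>Y\<in>{TypeB 3, TypeC 3}. \<exists>S \<Gamma> \<epsilon>. coord_subsystem R \<Delta> Y S \<Gamma> \<epsilon> \<and>
              \<alpha> \<in> S \<and> \<beta> \<in> S \<and> \<gamma> = \<epsilon> 1 + \<epsilon> 2 \<and>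
              (let L = filter (\<lambda>x. x \<in> S \<inter> pos_roots R \<Delta>) seg in
                 coxeter_equiv_seq \<Gamma> L (seq_BC3 (coord_factor Y) \<epsilon>) \<or>
                 coxeter_equiv_seq \<Gamma> (rev L) (seq_BC3 (coord_factor Y) \<epsilon>)))) \<and>
        (\<forall>Y\<in>{TypeB 3, TypeC 3}. \<forall>S \<Gamma> \<epsilon>.
           coord_subsystem R \<Delta> Y S \<Gamma> \<epsilon> \<and> \<alpha> \<in> S \<and> \<beta> \<in> S \<longrightarrow>
           (\<beta> = \<epsilon> 1 + \<epsilon> 3 \<and> \<alpha> = \<epsilon> 2 - \<epsilon> 3 \<and>
            \<epsilon> 1 - \<epsilon> 2 \<notin> set seg \<and> coord_factor Y *\<^sub>R \<epsilon> 3 \<notin> set seg \<longleftrightarrow>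
            \<gamma> = \<epsilon> 1 + \<epsilon> 2 \<and>
            (let L = filter (\<lambda>x. x \<in> S \<inter> pos_roots R \<Delta>) seg in
               coxeter_equiv_seq \<Gamma> L (seq_BC3 (coord_factor Y) \<epsilon>) \<or>
               coxeter_equiv_seq \<Gamma> (rev L) (seq_BC3 (coord_factor Y) \<epsilon>)))) \<and>
        (\<forall>Y\<in>{TypeB 3, TypeC 3}. \<forall>S \<Gamma> \<epsilon>. coord_subsystem R \<Delta> Y S \<Gamma> \<epsilon> \<longrightarrow>
           (\<exists>vs. reduced_decomposition \<Gamma> (reflect (\<epsilon> 1 + \<epsilon> 2)) vs \<and>
              lambda_seq vs = seq_BC3 (coord_factor Y) \<epsilon>) \<and>
           (Y = TypeB 3 \<longrightarrow> maximal_root \<Gamma> S (\<epsilon> 1 + \<epsilon> 2)) \<and>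
           (Y = TypeC 3 \<longrightarrow> maximal_root \<Gamma> {x. short_root S x} (\<epsilon> 1 + \<epsilon> 2))))
     \<and>
     ((\<exists>n. X = TypeD n) \<or> X \<in> {TypeE 6, TypeE 7, TypeE 8} \<longrightarrow>
        (\<not> gatherable_inside \<Delta> ws 0 q {\<alpha>, \<beta>, \<gamma>} \<longleftrightarrow>
           (\<exists>S \<Gamma> \<epsilon>. coord_subsystem R \<Delta> (TypeD 4) S \<Gamma> \<epsilon> \<and>
              \<beta> = \<epsilon> 1 + \<epsilon> 3 \<and> \<gamma> = \<epsilon> 1 + \<epsilon> 2 \<and> \<alpha> = \<epsilon> 2 - \<epsilon> 3 \<and>
              {\<epsilon> 1 - \<epsilon> 2, \<epsilon> 3 - \<epsilon> 4, \<epsilon> 3 + \<epsilon> 4} \<inter> set seg = {})) \<and>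
        (\<not> gatherable_inside \<Delta> ws 0 q {\<alpha>, \<beta>, \<gamma>} \<longleftrightarrow>
           (\<exists>S \<Gamma> \<epsilon>. coord_subsystem R \<Delta> (TypeD 4) S \<Gamma> \<epsilon> \<and>
              \<beta> = \<epsilon> 1 + \<epsilon> 3 \<and> \<gamma> = \<epsilon> 1 + \<epsilon> 2 \<and> \<alpha> = \<epsilon> 2 - \<epsilon> 3 \<and>
              coxeter_equiv_seq \<Gamma> (filter (\<lambda>x. x \<in> S \<inter> pos_roots R \<Delta>) seg) (seq_D4 \<epsilon>))) \<and>
        (\<not> gatherable_inside \<Delta> ws 0 q {\<alpha>, \<beta>, \<gamma>} \<longleftrightarrow>
           (\<exists>S \<Gamma> \<epsilon> \<theta>. coord_subsystem R \<Delta> (TypeD 4) S \<Gamma> \<epsilon> \<and>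
              \<alpha> \<in> S \<and> \<beta> \<in> S \<and> maximal_root \<Gamma> S \<theta> \<and>
              set seg \<inter> (S \<inter> pos_roots R \<Delta>) =
                lambda_set (S \<inter> pos_roots R \<Delta>) (reflect \<theta>))) \<and>
        (\<forall>S \<Gamma> \<epsilon> \<theta>.
           coord_subsystem R \<Delta> (TypeD 4) S \<Gamma> \<epsilon> \<and> \<alpha> \<in> S \<and> \<beta> \<in> S \<and> maximal_root \<Gamma> S \<theta> \<longrightarrow>
           (\<beta> = \<epsilon> 1 + \<epsilon> 3 \<and> \<gamma> = \<epsilon> 1 + \<epsilon> 2 \<and> \<alpha> = \<epsilon> 2 - \<epsilon> 3 \<and>
            {\<epsilon> 1 - \<epsilon> 2, \<epsilon> 3 - \<epsilon> 4, \<epsilon> 3 + \<epsilon> 4} \<inter> set seg = {} \<longleftrightarrow>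
            coxeter_equiv_seq \<Gamma> (filter (\<lambda>x. x \<in> S \<inter> pos_roots R \<Delta>) seg) (seq_D4 \<epsilon>)) \<and>
           (coxeter_equiv_seq \<Gamma> (filter (\<lambda>x. x \<in> S \<inter> pos_roots R \<Delta>) seg) (seq_D4 \<epsilon>) \<longleftrightarrow>
            set seg \<inter> (S \<inter> pos_roots R \<Delta>) =
              lambda_set (S \<inter> pos_roots R \<Delta>) (reflect \<theta>))))"
proof -
  interpret based_roots R \<Delta> using assms(1,4) by unfold_locales
  have red: "red ws" using assms(8) reduced_iff_red by blast
  have g: "\<gamma> = \<alpha> + \<beta>" using assms(15) by simp
  have "lambda_seq ws ! i \<in> R" if "i < length ws" for i
    using that lambda_seq_root[OF red_set[OF red]] nth_mem[of i "lambda_seq ws"] by auto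
  then have abR: "\<alpha> \<in> R" "\<beta> \<in> R" "\<gamma> \<in> R" using assms(9-14) by (metis less_trans)+
  have triple: "triple_word R \<Delta> ws q r \<alpha> \<beta> \<kappa>"
    if "0 < \<kappa>" "\<alpha> \<bullet> \<alpha> = 2 * \<kappa>" "\<beta> \<bullet> \<beta> = 2 * \<kappa>" "\<gamma> \<bullet> \<gamma> = 2 * \<kappa>" for \<kappa>
    by unfold_locales (use that red assms(9-14) g in auto)
  show ?thesis
  proof ((rule conjI; rule impI), goal_cases)
    case BCF: 1
    then have "(\<exists>n\<ge>3. X = TypeB n) \<or> (\<exists>n\<ge>3. X = TypeC n) \<or> X = TypeF4" using assms(6) by auto
    then obtain c where c: "0 < c" "\<And>x. x \<in> R \<Longrightarrow> x \<bullet> x = c \<or> x \<bullet> x = 2 * c" "\<exists>x\<in>R. x \<bullet> x = c" "\<exists>x\<in>R. x \<bullet> x = 2 * c"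
      using two_norms[OF assms(5)] by blast
    have long: "x \<bullet> x = 2 * c" if "long_root R x" for x
    proof -
      obtain y where "y \<in> R" "y \<bullet> y = 2 * c" using c(4) by blast
      then have "2 * c \<le> x \<bullet> x" using that unfolding long_root_def norm_eq_sqrt_inner by force
      then show ?thesis using c(1) c(2)[of x] that unfolding long_root_def by auto
    qed
    have short: "x \<bullet> x = c" if "short_root R x" for x
    proof -
      obtain y where "y \<in> R" "y \<bullet> y = c" using c(3) by blast
      then have "x \<bullet> x \<le> c" using that unfolding short_root_def norm_eq_sqrt_inner by force
      then show ?thesis using c(1) c(2)[of x] that unfolding short_root_def by auto
    qed
    have "(\<forall>x\<in>{\<alpha>, \<beta>, \<gamma>}. long_root R x) \<or> (\<forall>x\<in>{\<alpha>, \<beta>, \<gamma>}. short_root R x)"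
      using BCF assms(16-18) by blast
    then have len: "(\<forall>x\<in>{\<alpha>, \<beta>, \<gamma>}. x \<bullet> x = 2 * c) \<or> (\<forall>x\<in>{\<alpha>, \<beta>, \<gamma>}. x \<bullet> x = c)"
      using long short by blast
    \<comment> \<open>Half the squared length of the triple: \<open>c\<close> for a long one and
      \<open>c / 2\<close> for a short one.\<close>
    obtain \<kappa> where \<kappa>: "0 < \<kappa>" "\<alpha> \<bullet> \<alpha> = 2 * \<kappa>" "\<beta> \<bullet> \<beta> = 2 * \<kappa>" "\<gamma> \<bullet> \<gamma> = 2 * \<kappa>"
      and n: "(\<forall>x\<in>R. x \<bullet> x = \<kappa> \<or> x \<bullet> x = 2 * \<kappa>) \<and> (\<exists>x\<in>R. x \<bullet> x = \<kappa>) \<or>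
        (\<forall>x\<in>R. x \<bullet> x = 2 * \<kappa> \<or> x \<bullet> x = 4 * \<kappa>) \<and> (\<exists>x\<in>R. x \<bullet> x = 4 * \<kappa>)"
      using len
    proof (elim disjE)
      assume "\<forall>x\<in>{\<alpha>, \<beta>, \<gamma>}. x \<bullet> x = 2 * c"
      then show thesis using that[of c] c by auto
    next
      assume "\<forall>x\<in>{\<alpha>, \<beta>, \<gamma>}. x \<bullet> x = c"
      then show thesis using that[of "c / 2"] c by auto
    qed
    interpret T: triple_word R \<Delta> ws q r \<alpha> \<beta> \<kappa> by (rule triple[OF \<kappa>])
    have seg: "T.N = set seg" unfolding seg_def by (rule T.seg_N[symmetric])
    define C1 where "C1 Y \<epsilon> \<longleftrightarrow> \<beta> = \<epsilon> 1 + \<epsilon> 3 \<and> \<alpha> = \<epsilon> 2 - \<epsilon> 3 \<and>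
      \<epsilon> 1 - \<epsilon> 2 \<notin> set seg \<and> coord_factor Y *\<^sub>R \<epsilon> 3 \<notin> set seg" for Y and \<epsilon> :: "nat \<Rightarrow> 'a"
    define C2 where "C2 Y S \<Gamma> \<epsilon> \<longleftrightarrow> \<alpha> + \<beta> = \<epsilon> 1 + \<epsilon> 2 \<and>
      (let L = filter (\<lambda>x. x \<in> S \<inter> pos_roots R \<Delta>) seg in
         coxeter_equiv_seq \<Gamma> L (seq_BC3 (coord_factor Y) \<epsilon>) \<or>
         coxeter_equiv_seq \<Gamma> (rev L) (seq_BC3 (coord_factor Y) \<epsilon>))" for Y S \<Gamma> and \<epsilon> :: "nat \<Rightarrow> 'a"
    have Yk: "\<exists>k h. (Y, k, h) \<in> {(TypeB 3, 1, 2), (TypeC 3, 2::nat, 1::nat)}" if "Y \<in> {TypeB 3, TypeC 3}" for Y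
      using that by blast
    have c1: "\<not> T.gatherable \<longleftrightarrow> (\<exists>Y\<in>{TypeB 3, TypeC 3}. \<exists>S \<Gamma> \<epsilon>. coord_subsystem R \<Delta> Y S \<Gamma> \<epsilon> \<and> C1 Y \<epsilon>)"
      unfolding C1_def seg[symmetric] by (rule T.criterion_two_lengths[OF assms(3) n])
    have c3: "C1 Y \<epsilon> \<longleftrightarrow> C2 Y S \<Gamma> \<epsilon>"
      if H: "Y \<in> {TypeB 3, TypeC 3}" "coord_subsystem R \<Delta> Y S \<Gamma> \<epsilon>" "\<alpha> \<in> S" "\<beta> \<in> S" for Y S \<Gamma> \<epsilon>
    proof -
      obtain k h where "(Y, k, h) \<in> {(TypeB 3, 1, 2), (TypeC 3, 2::nat, 1::nat)}" using Yk[OF H(1)] by blast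
      from T.criterion_BC[OF this H(2-4)] show ?thesis
        unfolding C1_def C2_def Let_def seg[symmetric] unfolding seg_def .
    qed
    have mem: "\<alpha> \<in> S \<and> \<beta> \<in> S"
      if H: "Y \<in> {TypeB 3, TypeC 3}" "coord_subsystem R \<Delta> Y S \<Gamma> \<epsilon>" "C1 Y \<epsilon>" for Y S \<Gamma> \<epsilon>
    proof -
      obtain k h where k: "(Y, k, h) \<in> {(TypeB 3, 1, 2), (TypeC 3, 2::nat, 1::nat)}" using Yk[OF H(1)] by blast
      show ?thesis using T.not_gatherable_BC(2,3)[OF k H(2)] H(3) unfolding C1_def seg by blast
    qed
    have c2: "\<not> T.gatherable \<longleftrightarrow>
      (\<exists>Y\<in>{TypeB 3, TypeC 3}. \<exists>S \<Gamma> \<epsilon>. coord_subsystem R \<Delta> Y S \<Gamma> \<epsilon> \<and> \<alpha> \<in> S \<and> \<beta> \<in> S \<and> C2 Y S \<Gamma> \<epsilon>)"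
      unfolding c1 using c3 mem by meson
    have c3': "\<forall>Y\<in>{TypeB 3, TypeC 3}. \<forall>S \<Gamma> \<epsilon>.
      coord_subsystem R \<Delta> Y S \<Gamma> \<epsilon> \<and> \<alpha> \<in> S \<and> \<beta> \<in> S \<longrightarrow> (C1 Y \<epsilon> \<longleftrightarrow> C2 Y S \<Gamma> \<epsilon>)"
      using c3 by meson
    have c4: "\<forall>Y\<in>{TypeB 3, TypeC 3}. \<forall>S \<Gamma> \<epsilon>. coord_subsystem R \<Delta> Y S \<Gamma> \<epsilon> \<longrightarrow>
       (\<exists>vs. reduced_decomposition \<Gamma> (reflect (\<epsilon> 1 + \<epsilon> 2)) vs \<and>
          lambda_seq vs = seq_BC3 (coord_factor Y) \<epsilon>) \<and>
       (Y = TypeB 3 \<longrightarrow> maximal_root \<Gamma> S (\<epsilon> 1 + \<epsilon> 2)) \<and>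
       (Y = TypeC 3 \<longrightarrow> maximal_root \<Gamma> {x. short_root S x} (\<epsilon> 1 + \<epsilon> 2))"
    proof (intro ballI allI impI)
      fix Y S \<Gamma> and \<epsilon> :: "nat \<Rightarrow> 'a"
      assume Y: "Y \<in> {TypeB 3, TypeC 3}" and co: "coord_subsystem R \<Delta> Y S \<Gamma> \<epsilon>"
      obtain k h where k: "(Y, k, h) \<in> {(TypeB 3, 1, 2), (TypeC 3, 2::nat, 1::nat)}" using Yk[OF Y] by blast
      show "(\<exists>vs. reduced_decomposition \<Gamma> (reflect (\<epsilon> 1 + \<epsilon> 2)) vs \<and>
          lambda_seq vs = seq_BC3 (coord_factor Y) \<epsilon>) \<and>
       (Y = TypeB 3 \<longrightarrow> maximal_root \<Gamma> S (\<epsilon> 1 + \<epsilon> 2)) \<and>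
       (Y = TypeC 3 \<longrightarrow> maximal_root \<Gamma> {x. short_root S x} (\<epsilon> 1 + \<epsilon> 2))"
        using highest_root_BC[OF k co] by blast
    qed
    show ?case
      unfolding g using c1[unfolded C1_def] c2[unfolded C2_def] c3'[unfolded C1_def C2_def] c4 by (intro conjI)
  next
    case DE: 2
    then have "(\<exists>n\<ge>4. X = TypeD n) \<or> X \<in> {TypeE 6, TypeE 7, TypeE 8}" using assms(6) by auto
    then obtain c where c: "\<And>x. x \<in> R \<Longrightarrow> x \<bullet> x = c" using simply_laced_norms[OF assms(5)] by blast
    define \<kappa> where "\<kappa> = c / 2"
    have n: "x \<bullet> x = 2 * \<kappa>" if "x \<in> R" for x using c[OF that] by (simp add: \<kappa>_def)
    have "\<alpha> \<noteq> 0" using abR root_zero by blast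
    then have pos: "0 < \<kappa>" using n[OF abR(1)] inner_gt_zero_iff[of \<alpha>] by linarith
    interpret T: triple_word R \<Delta> ws q r \<alpha> \<beta> \<kappa>
      by (rule triple[OF pos n[OF abR(1)] n[OF abR(2)] n[OF abR(3)]])
    have seg: "T.N = set seg" unfolding seg_def by (rule T.seg_N[symmetric])
    define C1 where "C1 \<epsilon> \<longleftrightarrow> \<beta> = \<epsilon> 1 + \<epsilon> 3 \<and> \<alpha> + \<beta> = \<epsilon> 1 + \<epsilon> 2 \<and> \<alpha> = \<epsilon> 2 - \<epsilon> 3 \<and>
      {\<epsilon> 1 - \<epsilon> 2, \<epsilon> 3 - \<epsilon> 4, \<epsilon> 3 + \<epsilon> 4} \<inter> set seg = {}" for \<epsilon> :: "nat \<Rightarrow> 'a"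
    define C2 where "C2 S \<Gamma> \<epsilon> \<longleftrightarrow>
      coxeter_equiv_seq \<Gamma> (filter (\<lambda>x. x \<in> S \<inter> pos_roots R \<Delta>) seg) (seq_D4 \<epsilon>)" for S \<Gamma> and \<epsilon> :: "nat \<Rightarrow> 'a"
    define C3 where "C3 S \<theta> \<longleftrightarrow> set seg \<inter> (S \<inter> pos_roots R \<Delta>) =
      lambda_set (S \<inter> pos_roots R \<Delta>) (reflect \<theta>)" for S \<theta>
    have d1: "\<not> T.gatherable \<longleftrightarrow> (\<exists>S \<Gamma> \<epsilon>. coord_subsystem R \<Delta> (TypeD 4) S \<Gamma> \<epsilon> \<and> C1 \<epsilon>)"
      unfolding C1_def seg[symmetric] by (rule T.criterion_simply_laced[OF n])
    have e12: "C1 \<epsilon> \<longleftrightarrow> C2 S \<Gamma> \<epsilon>" and e23: "C2 S \<Gamma> \<epsilon> \<longleftrightarrow> C3 S (\<epsilon> 1 + \<epsilon> 2)"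
      if "coord_subsystem R \<Delta> (TypeD 4) S \<Gamma> \<epsilon>" "\<alpha> \<in> S" "\<beta> \<in> S" for S \<Gamma> \<epsilon>
      using T.criterion_D4[OF that] unfolding C1_def C2_def C3_def seg[symmetric] unfolding seg_def by blast+
    have mem: "\<alpha> \<in> S \<and> \<beta> \<in> S"
      if "coord_subsystem R \<Delta> (TypeD 4) S \<Gamma> \<epsilon>" "\<beta> = \<epsilon> 1 + \<epsilon> 3" "\<alpha> = \<epsilon> 2 - \<epsilon> 3" for S \<Gamma> \<epsilon>
      using T.not_gatherable_D4(2,3)[OF that] by blast
    have C1D: "\<beta> = \<epsilon> 1 + \<epsilon> 3" "\<alpha> + \<beta> = \<epsilon> 1 + \<epsilon> 2" "\<alpha> = \<epsilon> 2 - \<epsilon> 3" if "C1 \<epsilon>" for \<epsilon>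
      using that unfolding C1_def by blast+
    have top: "maximal_root \<Gamma> S (\<epsilon> 1 + \<epsilon> 2)" if "coord_subsystem R \<Delta> (TypeD 4) S \<Gamma> \<epsilon>" for S \<Gamma> \<epsilon>
      by (rule highest_root_D4[OF that])
    \<comment> \<open>The last formulation speaks of any maximal root instead of the coordinates;
      uniqueness identifies it with \<open>\<epsilon> 1 + \<epsilon> 2\<close>.\<close>
    have uniq: "\<theta> = \<epsilon> 1 + \<epsilon> 2" if "coord_subsystem R \<Delta> (TypeD 4) S \<Gamma> \<epsilon>" "maximal_root \<Gamma> S \<theta>" for S \<Gamma> \<epsilon> \<theta>
    proof -
      interpret S: based_roots S \<Gamma> using that(1) unfolding coord_subsystem_def by unfold_locales auto
      show ?thesis by (rule S.maximal_root_unique[OF that(2) top[OF that(1)]])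
    qed
    have d2: "\<not> T.gatherable \<longleftrightarrow> (\<exists>S \<Gamma> \<epsilon>. coord_subsystem R \<Delta> (TypeD 4) S \<Gamma> \<epsilon> \<and>
              \<beta> = \<epsilon> 1 + \<epsilon> 3 \<and> \<alpha> + \<beta> = \<epsilon> 1 + \<epsilon> 2 \<and> \<alpha> = \<epsilon> 2 - \<epsilon> 3 \<and> C2 S \<Gamma> \<epsilon>)"
      unfolding d1
    proof (intro iffI; elim exE conjE)
      fix S \<Gamma> \<epsilon> assume co: "coord_subsystem R \<Delta> (TypeD 4) S \<Gamma> \<epsilon>" and C1: "C1 \<epsilon>"
      then have "C2 S \<Gamma> \<epsilon>" using e12 mem[OF co C1D(1,3)[OF C1]] by blast
      then show "\<exists>S \<Gamma> \<epsilon>. coord_subsystem R \<Delta> (TypeD 4) S \<Gamma> \<epsilon> \<and>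
              \<beta> = \<epsilon> 1 + \<epsilon> 3 \<and> \<alpha> + \<beta> = \<epsilon> 1 + \<epsilon> 2 \<and> \<alpha> = \<epsilon> 2 - \<epsilon> 3 \<and> C2 S \<Gamma> \<epsilon>"
        using co C1D[OF C1] by blast
    next
      fix S \<Gamma> \<epsilon> assume co: "coord_subsystem R \<Delta> (TypeD 4) S \<Gamma> \<epsilon>"
        and e: "\<beta> = \<epsilon> 1 + \<epsilon> 3" "\<alpha> = \<epsilon> 2 - \<epsilon> 3" and C2: "C2 S \<Gamma> \<epsilon>"
      then have "C1 \<epsilon>" using e12[OF co] mem[OF co e] by simp
      then show "\<exists>S \<Gamma> \<epsilon>. coord_subsystem R \<Delta> (TypeD 4) S \<Gamma> \<epsilon> \<and> C1 \<epsilon>" using co by blast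
    qed
    have d3: "\<not> T.gatherable \<longleftrightarrow> (\<exists>S \<Gamma> \<epsilon> \<theta>. coord_subsystem R \<Delta> (TypeD 4) S \<Gamma> \<epsilon> \<and>
              \<alpha> \<in> S \<and> \<beta> \<in> S \<and> maximal_root \<Gamma> S \<theta> \<and> C3 S \<theta>)"
      unfolding d1
    proof (intro iffI; elim exE conjE)
      fix S \<Gamma> \<epsilon> assume co: "coord_subsystem R \<Delta> (TypeD 4) S \<Gamma> \<epsilon>" and C1: "C1 \<epsilon>"
      have ab: "\<alpha> \<in> S" "\<beta> \<in> S" using mem[OF co C1D(1,3)[OF C1]] by auto
      then have "C3 S (\<epsilon> 1 + \<epsilon> 2)" using e12[OF co ab] e23[OF co ab] C1 by blast
      then show "\<exists>S \<Gamma> \<epsilon> \<theta>. coord_subsystem R \<Delta> (TypeD 4) S \<Gamma> \<epsilon> \<and>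
              \<alpha> \<in> S \<and> \<beta> \<in> S \<and> maximal_root \<Gamma> S \<theta> \<and> C3 S \<theta>" using co ab top[OF co] by blast
    next
      fix S \<Gamma> \<theta> and \<epsilon> :: "nat \<Rightarrow> 'a"
      assume co: "coord_subsystem R \<Delta> (TypeD 4) S \<Gamma> \<epsilon>" and ab: "\<alpha> \<in> S" "\<beta> \<in> S"
        and m: "maximal_root \<Gamma> S \<theta>" "C3 S \<theta>"
      then have "C1 \<epsilon>" using e12[OF co ab] e23[OF co ab] uniq[OF co m(1)] by blast
      then show "\<exists>S \<Gamma> \<epsilon>. coord_subsystem R \<Delta> (TypeD 4) S \<Gamma> \<epsilon> \<and> C1 \<epsilon>" using co by blast
    qed
    have d4: "\<forall>S \<Gamma> \<epsilon> \<theta>. coord_subsystem R \<Delta> (TypeD 4) S \<Gamma> \<epsilon> \<and> \<alpha> \<in> S \<and> \<beta> \<in> S \<and> maximal_root \<Gamma> S \<theta> \<longrightarrow>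
      (C1 \<epsilon> \<longleftrightarrow> C2 S \<Gamma> \<epsilon>) \<and> (C2 S \<Gamma> \<epsilon> \<longleftrightarrow> C3 S \<theta>)"
      using e12 e23 uniq by blast
    show ?case
      unfolding g using d1[unfolded C1_def] d2[unfolded C2_def] d3[unfolded C3_def]
        d4[unfolded C1_def C2_def C3_def] by (intro conjI)
  qed
qed

end
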